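(* Fix an integer $l\ge 0$, let $\frac{l}{2l+1}<r<\frac{l+1}{2l+3}$ and $\delta=r-\frac{l}{2l+1}$. Let $(\mathcal X_1,\mathcal X_2,\ldots)$ be the random process of subsets of $S^1$ in which $\mathcal X_1$ is a uniformly random point and $\mathcal X_{n+1}$ is obtained from $\mathcal X_n$ by adding an independent uniformly random point of $S^1$. Let $\mathrm{wf}$ denote either $\mathrm{wf}_{<}$ or $\mathrm{wf}_{\le}$, and define $$M(r)=\min\{n:\mathrm{wf}(\mathcal X_n;r)\ge\tfrac{l}{2l+1}\},\qquad N(r)=\min\{n:\mathrm{wf}(\mathcal X_n;r)>\tfrac{l}{2l+1}\}$$ (with $\min\emptyset=\infty$). Then, as $\delta\to 0$, $$\mathbf E[M(r)]=\Theta\Big(\big(\tfrac1\delta\big)^{\frac{2l}{2l+1}}\Big),\qquad \mathbf E[N(r)]=\Theta\Big(\tfrac1\delta\log\tfrac1\delta\Big),$$ where the implied constants may depend on $l$. In particular, the expected number of random points $n$ until $\mathbf{VR}(\mathcal X_n;r)\simeq S^{2l+1}$ is $\Theta(\frac1\delta\log\frac1\delta)$ as $\delta\to0$.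
   Context: $S^1$ is the circle of circumference $1$ with arc-length metric; points are identified with numbers in $[0,1)$ and $\vec d(x,y)$ denotes the clockwise distance from $x$ to $y$. For a finite $X\subseteq S^1$ and $0<r<\frac12$, $\overrightarrow{\mathbf{VR}}_{\le}(X;r)$ (resp. $\overrightarrow{\mathbf{VR}}_{<}(X;r)$) is the directed graph on $X$ with $x_1\to x_2$ iff $0<\vec d(x_1,x_2)\le r$ (resp. $<r$); it is a cyclic graph with respect to the clockwise order of $X$. $\mathrm{wf}_{\le}(X;r)$, $\mathrm{wf}_{<}(X;r)$ denote the winding fractions of these graphs, where the winding fraction of a cyclic graph $\overrightarrow G$ is $\sup\{k/n:\exists$ cyclic homomorphism $\overrightarrow{C_n^k}\to\overrightarrow G\}$. Here: a cyclic graph is a directed graph (no loops, no pair of opposite edges) with a cyclic vertex order $v_0\prec\cdots\prec v_{n-1}$ such that $v_i\to v_j$ implies $j=i+1$ or both $v_i\to v_{j-1}$ and $v_{i+1}\to v_j$ (indices mod $n$); $\overrightarrow{C_n^k}$ ($0\le k<n/2$) has vertices $\{0,\dots,n-1\}$ and $i\to j$ iff $0<(j-i)\bmod n\le k$; a cyclic homomorphism is a vertex map that is a directed-graph homomorphism ($v\to w$ implies $f(v)=f(w)$ or $f(v)\to f(w)$), is cyclic monotone (fibres are cyclic intervals of consecutive vertices and $f(s)\prec f(s')\prec f(s'')$ implies $s\prec s'\prec s''$), and is non-constant if the source has a directed cycle. $\mathbf{VR}(X;r)$ is the Vietoris–Rips complex: faces are finite subsets of diameter $<r$ (resp. $\le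 r$). $f(\delta)=\Theta(g(\delta))$ as $\delta\to0$ means $C_1g(\delta)\le f(\delta)\le C_2g(\delta)$ for constants $C_1,C_2>0$ and all sufficiently small $\delta$. *)

theory Defs
  imports "HOL-Probability.Probability"
begin

text \<open>Clockwise distance from x to y (points of S^1 are numbers in [0,1)).\<close>
definition cdist :: "real \<Rightarrow> real \<Rightarrow> real" where
  "cdist x y = (y - x) - of_int \<lfloor>y - x\<rfloor>"

definition gdist :: "real \<Rightarrow> real \<Rightarrow> real" where
  "gdist x y = min (cdist x y) (cdist y x)"

section \<open>Cyclic graphs on vertex set {0..<m} with cyclic order 0 < 1 < ... < m-1\<close>

definition cyc_btw :: "nat \<Rightarrow> nat \<Rightarrow> nat \<Rightarrow> nat \<Rightarrow> bool" where
  "cyc_btw m a b c \<longleftrightarrow> a < m \<and> b < m \<and> c < m \<and> a \<noteq> b \<and> b \<noteq> c \<and> a \<noteq> c \<and>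
     (b + m - a) mod m < (c + m - a) mod m"

definition cyc_interval :: "nat \<Rightarrow> nat set \<Rightarrow> bool" where
  "cyc_interval n S \<longleftrightarrow> S = {} \<or> (\<exists>a<n. \<exists>len\<le>n. S = {(a + i) mod n | i. i < len})"

definition Cnk :: "nat \<Rightarrow> nat \<Rightarrow> nat \<Rightarrow> nat \<Rightarrow> bool" where
  "Cnk n k i j \<longleftrightarrow> i < n \<and> j < n \<and> 0 < (j + n - i) mod n \<and> (j + n - i) mod n \<le> k"

definition cyclic_hom ::
  "nat \<Rightarrow> (nat \<Rightarrow> nat \<Rightarrow> bool) \<Rightarrow> nat \<Rightarrow> (nat \<Rightarrow> nat \<Rightarrow> bool) \<Rightarrow> (nat \<Rightarrow> nat) \<Rightarrow> bool" where
  "cyclic_hom n E m F f \<longleftrightarrow>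
     (\<forall>v<n. f v < m) \<and>
     (\<forall>v<n. \<forall>w<n. E v w \<longrightarrow> f v = f w \<or> F (f v) (f w)) \<and>
     (\<forall>y. cyc_interval n {v. v < n \<and> f v = y}) \<and>
     (\<forall>s<n. \<forall>s'<n. \<forall>s''<n. cyc_btw m (f s) (f s') (f s'') \<longrightarrow> cyc_btw n s s' s'') \<and>
     ((\<exists>v<n. (\<lambda>a b. a < n \<and> b < n \<and> E a b)\<^sup>+\<^sup>+ v v) \<longrightarrow> \<not> (\<exists>c. \<forall>v<n. f v = c))"

definition winding_fraction :: "nat \<Rightarrow> (nat \<Rightarrow> nat \<Rightarrow> bool) \<Rightarrow> real" where
  "winding_fraction m F =
     Sup {real k / real n | n k. 1 \<le> n \<and> 2 * k < n \<and> (\<exists>f. cyclic_hom n (Cnk n k) m F f)}"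

text \<open>Directed VR graph: vertices are the points of X listed in increasing (clockwise)
  order; strict = True gives VR_<, strict = False gives VR_\<le>.\<close>
definition vr_edge :: "bool \<Rightarrow> real set \<Rightarrow> real \<Rightarrow> nat \<Rightarrow> nat \<Rightarrow> bool" where
  "vr_edge strict X r i j \<longleftrightarrow>
     (let xs = sorted_list_of_set X in
       i < length xs \<and> j < length xs \<and> 0 < cdist (xs ! i) (xs ! j) \<and>
       (if strict then cdist (xs ! i) (xs ! j) < r else cdist (xs ! i) (xs ! j) \<le> r))"

definition wf :: "bool \<Rightarrow> real set \<Rightarrow> real \<Rightarrow> real" where
  "wf strict X r = winding_fraction (card X) (vr_edge strict X r)"

definition vr_face :: "bool \<Rightarrow> real set \<Rightarrow> real \<Rightarrow> real set \<Rightarrow> bool" where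
  "vr_face strict X r S \<longleftrightarrow> S \<noteq> {} \<and> finite S \<and> S \<subseteq> X \<and>
     (\<forall>x\<in>S. \<forall>y\<in>S. if strict then gdist x y < r else gdist x y \<le> r)"

text \<open>Geometric realization: barycentric-coordinate functions supported on a face.\<close>
definition vr_realization :: "bool \<Rightarrow> real set \<Rightarrow> real \<Rightarrow> (real \<Rightarrow> real) set" where
  "vr_realization strict X r =
     {f. (\<forall>x. 0 \<le> f x) \<and> vr_face strict X r {x. f x \<noteq> 0} \<and> sum f {x. f x \<noteq> 0} = 1}"

definition VR_top :: "bool \<Rightarrow> real set \<Rightarrow> real \<Rightarrow> (real \<Rightarrow> real) topology" where
  "VR_top strict X r = subtopology (powertop_real UNIV) (vr_realization strict X r)"

definition circle_process :: "(nat \<Rightarrow> real) measure" where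
  "circle_process = PiM UNIV (\<lambda>_. uniform_measure lborel {0..<1})"

definition Xn :: "(nat \<Rightarrow> real) \<Rightarrow> nat \<Rightarrow> real set" where
  "Xn \<omega> n = \<omega> ` {..<n}"

definition hit_time :: "(real set \<Rightarrow> bool) \<Rightarrow> (nat \<Rightarrow> real) \<Rightarrow> ennreal" where
  "hit_time P \<omega> = (if \<exists>n\<ge>1. P (Xn \<omega> n) then of_nat (LEAST n. n \<ge> 1 \<and> P (Xn \<omega> n)) else \<infinity>)"

definition expected_hit :: "(real set \<Rightarrow> bool) \<Rightarrow> ennreal" where
  "expected_hit P = (\<integral>\<^sup>+ \<omega>. hit_time P \<omega> \<partial>circle_process)"

definition Theta_at0 :: "real \<Rightarrow> real \<Rightarrow> (real \<Rightarrow> ennreal) \<Rightarrow> (real \<Rightarrow> real) \<Rightarrow> bool" where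
  "Theta_at0 a b F g \<longleftrightarrow> (\<exists>C1 C2 \<delta>0. C1 > 0 \<and> C2 > 0 \<and> \<delta>0 > 0 \<and>
     (\<forall>r. a < r \<and> r < b \<and> r - a < \<delta>0 \<longrightarrow>
        ennreal (C1 * g (r - a)) \<le> F r \<and> F r \<le> ennreal (C2 * g (r - a))))"

end

theory Submission
  imports Defs "HOL-Homology.Homology"
begin

text \<open>
  Write \<open>\<delta> = r - l/(2l+1)\<close>. In the circular distance graph the link of a vertex is covered by two
  cliques (the points within \<open>r\<close> on either side), and removing dominated vertices and suspension points
  reduces its clique complex to a cone or to a sphere.

  If an arc slightly longer than \<open>(2l+1)\<delta>\<close> contains no point of \<open>X\<close>, then removing vertices one
  by one shows that \<open>VR(X;r)\<close> has no homology in degree \<open>2l+1\<close>, and lifting cyclic homomorphisms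
  to the line shows that the winding fraction is at most \<open>l/(2l+1)\<close>. If every arc of length
  \<open>\<delta>/2\<close> meets \<open>X\<close>, the winding fraction exceeds \<open>l/(2l+1)\<close>; moreover all vertex links are
  contractible and stay so when points are added or deleted, so the homotopy type does not depend on
  \<open>X\<close>, and it is computed by varying the radius until \<open>X\<close> may be taken to be a regular polygon with
  \<open>4l+4\<close> vertices, whose complex is the boundary of a cross-polytope. Coupon collecting (a union
  bound above, a second moment below) then gives \<open>(1/\<delta>) log (1/\<delta>)\<close>.

  For the weak inequality one needs \<open>2l+1\<close> points that are, up to \<open>O(\<delta>)\<close>, the vertices of a regular
  polygon. With \<open>n\<close> points there are about \<open>n\<^sup>2\<^sup>l\<^sup>+\<^sup>1 \<delta>\<^sup>2\<^sup>l\<close> such tuples on average; a union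
  bound over tuples of cells and a second moment estimate show that this expectation decides.
\<close>

section \<open>Clique complexes and vertex links\<close>

text \<open>The thresholds come from one count: \<open>2 * l + 1\<close> steps of length
  \<open>r\<close> advance \<open>l\<close> turns plus an excess of
  \<open>(2 * l + 1) * \<delta>\<close>, so an empty arc longer than this excess blocks the winding.
  The other end of the range of radii, \<open>r \<le> (l + 1) * (1 - 2 * r)\<close>, is what lets
  links be contracted. To refute the sphere one vanishing homology group suffices, while obtaining
  it takes a homotopy equivalence; hence deletion of a vertex is treated twice, by excision and by
  an explicit homotopy. On a finite set the non-strict graph is the strict graph of a slightly
  larger radius. That radius depends on the set, so the deterministic statements are proved for
  strict graphs over a whole range of radii. The exponent \<open>2 * l / (2 * l + 1)\<close> solves
  \<open>n ^ (2 * l + 1) * \<delta> ^ (2 * l) = 1\<close>. It is 0 for \<open>l = 0\<close>, where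
  the lower bound is just that a hitting time is at least 1.\<close>

definition clq :: "('a \<Rightarrow> 'a \<Rightarrow> bool) \<Rightarrow> 'a set \<Rightarrow> ('a \<Rightarrow> real) set" where
  "clq E V = {f. (\<forall>x. 0 \<le> f x) \<and> (\<forall>x. x \<notin> V \<longrightarrow> f x = 0) \<and>
     (\<forall>x y. f x \<noteq> 0 \<longrightarrow> f y \<noteq> 0 \<longrightarrow> E x y) \<and> sum f V = 1}"

definition clq_top :: "('a \<Rightarrow> 'a \<Rightarrow> bool) \<Rightarrow> 'a set \<Rightarrow> ('a \<Rightarrow> real) topology" where
  "clq_top E V = subtopology (powertop_real UNIV) (clq E V)"

definition vtx :: "'a \<Rightarrow> 'a \<Rightarrow> real" where
  "vtx v = (\<lambda>x. if x = v then 1 else 0)"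

text \<open>In a clique complex the link of \<open>v\<close> is the clique complex on these
  vertices, so links need no separate kind of complex.\<close>

definition link_set :: "('a \<Rightarrow> 'a \<Rightarrow> bool) \<Rightarrow> 'a set \<Rightarrow> 'a \<Rightarrow> 'a set" where
  "link_set E V v = {u \<in> V - {v}. E v u}"

text \<open>Radial projection from the vertex \<open>v\<close> onto the opposite face, meaningful
  where \<open>f v < 1\<close>.\<close>

definition project_off :: "'a \<Rightarrow> ('a \<Rightarrow> real) \<Rightarrow> 'a \<Rightarrow> real" where
  "project_off v f = (\<lambda>x. if x = v then 0 else f x / (1 - f v))"

lemma topspace_clq_top [simp]: "topspace (clq_top E V) = clq E V"
  by (simp add: clq_top_def)

lemma clqD:
  assumes "f \<in> clq E V"
  shows "0 \<le> f x" "x \<notin> V \<Longrightarrow> f x = 0" "f x \<noteq> 0 \<Longrightarrow> f y \<noteq> 0 \<Longrightarrow> E x y" "sum f V = 1"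
  using assms by (auto simp: clq_def)

lemma continuous_map_clq_coord:
  "continuous_map (subtopology (clq_top E V) S) euclideanreal (\<lambda>f. f x)"
  unfolding clq_top_def
  by (intro continuous_map_from_subtopology continuous_map_product_projection) auto

lemma continuous_map_clq_coord':
  "continuous_map (clq_top E V) euclideanreal (\<lambda>f. f x)"
  using continuous_map_clq_coord[of E V UNIV x] by simp

lemma continuous_map_into_clq:
  "continuous_map Z (clq_top E V) h \<longleftrightarrow>
     (\<forall>x. continuous_map Z euclideanreal (\<lambda>z. h z x)) \<and> (\<forall>z\<in>topspace Z. h z \<in> clq E V)"
  by (auto simp: clq_top_def continuous_map_in_subtopology continuous_map_componentwise_UNIV)

lemma continuous_map_into_clq_sub:
  "continuous_map Z (subtopology (clq_top E V) S) h \<longleftrightarrow>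
     (\<forall>x. continuous_map Z euclideanreal (\<lambda>z. h z x)) \<and> (\<forall>z\<in>topspace Z. h z \<in> clq E V \<inter> S)"
  by (auto simp: continuous_map_in_subtopology continuous_map_into_clq)

lemma clq_le_1: "finite V \<Longrightarrow> f \<in> clq E V \<Longrightarrow> f x \<le> 1"
  by (metis clqD(1,2,4) member_le_sum zero_le_one)

lemma clq_off_sum:
  assumes "finite V" "v \<in> V" "f \<in> clq E V"
  shows "sum f (V - {v}) = 1 - f v"
  using assms by (simp add: sum_diff1 clqD(4))

lemma vtx_in_clq: "finite V \<Longrightarrow> v \<in> V \<Longrightarrow> E v v \<Longrightarrow> vtx v \<in> clq E V"
  by (auto simp: clq_def vtx_def)

lemma clq_mono: "finite V \<Longrightarrow> W \<subseteq> V \<Longrightarrow> clq E W \<subseteq> clq E V"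
proof
  fix f assume a: "finite V" "W \<subseteq> V" "f \<in> clq E W"
  have "sum f V = sum f W"
    using a by (intro sum.mono_neutral_right) (auto simp: clqD(2))
  then show "f \<in> clq E V" using a by (auto simp: clq_def)
qed

lemma clq_sub: 
  assumes "finite V" "W \<subseteq> V" "f \<in> clq E V" "\<And>x. x \<notin> W \<Longrightarrow> f x = 0"
  shows "f \<in> clq E W"
proof -
  have "sum f V = sum f W"
    using assms by (intro sum.mono_neutral_right) auto
  then show ?thesis using assms by (auto simp: clq_def)
qed

lemma clq_empty [simp]: "clq E {} = {}"
  by (auto simp: clq_def)

lemma clq_combine:
  assumes "f \<in> clq E V" "g \<in> clq E V" "0 \<le> t" "t \<le> 1"
    and "\<And>x y. f x \<noteq> 0 \<or> g x \<noteq> 0 \<Longrightarrow> f y \<noteq> 0 \<or> g y \<noteq> 0 \<Longrightarrow> E x y"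
  shows "(\<lambda>x. (1 - t) * f x + t * g x) \<in> clq E V"
proof -
  have "(\<Sum>x\<in>V. (1 - t) * f x + t * g x) = (1 - t) * sum f V + t * sum g V"
    by (simp add: sum.distrib sum_distrib_left)
  also have "\<dots> = 1" using assms(1,2) by (simp add: clqD(4))
  finally have "(\<Sum>x\<in>V. (1 - t) * f x + t * g x) = 1" .
  moreover have "E x y" if "(1 - t) * f x + t * g x \<noteq> 0" "(1 - t) * f y + t * g y \<noteq> 0" for x y
    using that by (intro assms(5)) auto
  ultimately show ?thesis
    using assms clqD(1,2)[OF assms(1)] clqD(1,2)[OF assms(2)] by (auto simp: clq_def)
qed

text \<open>The segment between two points lies in the complex as soon as the union of their
  supports is a clique. The set \<open>S\<close> keeps the homotopy inside an open piece such as a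
  star.\<close>

lemma straight_line_homotopic:
  assumes f: "continuous_map Z (subtopology (clq_top E V) S) f"
    and g: "continuous_map Z (subtopology (clq_top E V) S) g"
    and E: "\<And>z x y. z \<in> topspace Z \<Longrightarrow> f z x \<noteq> 0 \<or> g z x \<noteq> 0 \<Longrightarrow> f z y \<noteq> 0 \<or> g z y \<noteq> 0 \<Longrightarrow> E x y"
    and S: "\<And>z t. z \<in> topspace Z \<Longrightarrow> 0 \<le> t \<Longrightarrow> t \<le> 1 \<Longrightarrow> (\<lambda>x. (1 - t) * f z x + t * g z x) \<in> S"
  shows "homotopic_with (\<lambda>_. True) Z (subtopology (clq_top E V) S) f g"
proof -
  let ?h = "\<lambda>(t, z). \<lambda>x. (1 - t) * f z x + t * g z x"
  let ?P = "prod_topology (top_of_set {0..1::real}) Z"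
  have "continuous_map ?P (subtopology (clq_top E V) S) ?h"
    unfolding continuous_map_into_clq_sub
  proof (intro conjI allI ballI)
    fix x
    have t: "continuous_map ?P euclideanreal fst"
      using continuous_map_fst[of "top_of_set {0..1::real}" Z]
      by (simp add: continuous_map_in_subtopology)
    have f': "continuous_map ?P euclideanreal (\<lambda>p. f (snd p) x)"
      using continuous_map_compose[OF continuous_map_snd[of _ Z], of euclideanreal "\<lambda>z. f z x"]
        f[unfolded continuous_map_into_clq_sub] by (auto simp: o_def)
    have g': "continuous_map ?P euclideanreal (\<lambda>p. g (snd p) x)"
      using continuous_map_compose[OF continuous_map_snd[of _ Z], of euclideanreal "\<lambda>z. g z x"]
        g[unfolded continuous_map_into_clq_sub] by (auto simp: o_def)
    show "continuous_map ?P euclideanreal (\<lambda>z. ?h z x)"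
      unfolding case_prod_unfold
      by (intro continuous_intros t f' g')
  next
    fix p assume p: "p \<in> topspace ?P"
    obtain t z where tz: "p = (t, z)" by fastforce
    have t: "0 \<le> t" "t \<le> 1" "z \<in> topspace Z" using p tz by auto
    show "?h p \<in> clq E V \<inter> S"
      using clq_combine[of "f z" E V "g z" t] E[of z] S[of z t] t f g
      unfolding continuous_map_into_clq_sub tz by auto
  qed
  moreover have "\<forall>x. ?h (0, x) = f x" "\<forall>x. ?h (1, x) = g x" by auto
  ultimately show ?thesis unfolding homotopic_with_def by (intro exI[of _ ?h]) auto
qed

lemma straight_line_homotopic':
  assumes "continuous_map Z (clq_top E V) f" "continuous_map Z (clq_top E V) g"
    and "\<And>z x y. z \<in> topspace Z \<Longrightarrow> f z x \<noteq> 0 \<or> g z x \<noteq> 0 \<Longrightarrow> f z y \<noteq> 0 \<or> g z y \<noteq> 0 \<Longrightarrow> E x y"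
  shows "homotopic_with (\<lambda>_. True) Z (clq_top E V) f g"
  using straight_line_homotopic[of Z E V UNIV f g] assms by simp

lemma contractible_cone:
  assumes "finite V" "w \<in> V" "\<And>u. u \<in> V \<Longrightarrow> E w u" "\<And>u. u \<in> V \<Longrightarrow> E u w"
  shows "contractible_space (clq_top E V)"
proof -
  have "homotopic_with (\<lambda>_. True) (clq_top E V) (clq_top E V) id (\<lambda>f. vtx w)"
  proof (rule straight_line_homotopic')
    show "continuous_map (clq_top E V) (clq_top E V) (\<lambda>f. vtx w)"
      using vtx_in_clq[of V w E] assms by (auto simp: continuous_map_into_clq)
    fix z x y assume "z \<in> topspace (clq_top E V)" and x: "id z x \<noteq> 0 \<or> vtx w x \<noteq> 0" "id z y \<noteq> 0 \<or> vtx w y \<noteq> 0"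
    then have z: "z \<in> clq E V" by simp
    have "x \<in> V \<or> x = w" "y \<in> V \<or> y = w" using x clqD(2)[OF z] by (auto simp: vtx_def split: if_splits)
    then show "E x y" using x assms clqD(3)[OF z, of x y] by (auto simp: vtx_def split: if_splits)
  qed simp
  then show ?thesis unfolding contractible_space_def by blast
qed

section \<open>Deleting one vertex: radial projection, open star, punctured star and link\<close>

lemma project_off_in:
  assumes "finite V" "v \<in> V" "f \<in> clq E V" "f v < 1"
  shows "project_off v f \<in> clq E (V - {v})"
proof -
  have "(\<Sum>x\<in>V - {v}. project_off v f x) = (\<Sum>x\<in>V - {v}. f x / (1 - f v))"
    by (intro sum.cong) (auto simp: project_off_def)
  also have "\<dots> = sum f (V - {v}) / (1 - f v)" by (simp add: sum_divide_distrib)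
  also have "\<dots> = 1" using clq_off_sum[OF assms(1-3)] assms(4) by simp
  finally have "(\<Sum>x\<in>V - {v}. project_off v f x) = 1" .
  then show ?thesis
    using assms clqD[OF assms(3)] by (auto simp: clq_def project_off_def)
qed

lemma project_off_in_link:
  assumes "finite V" "v \<in> V" "f \<in> clq E V" "f v < 1" "f v \<noteq> 0"
  shows "project_off v f \<in> clq E (link_set E V v)"
proof (rule clq_sub[OF _ _ project_off_in[OF assms(1-4)]])
  fix x assume "x \<notin> link_set E V v"
  then show "project_off v f x = 0"
    using clqD(3)[OF assms(3), of v x] clqD(2)[OF assms(3), of x] assms(5)
    by (auto simp: link_set_def project_off_def)
qed (use assms in \<open>auto simp: link_set_def\<close>)

lemma project_off_supp: "project_off v f x \<noteq> 0 \<Longrightarrow> f x \<noteq> 0"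
  by (auto simp: project_off_def split: if_splits)

lemma continuous_map_project_off:
  assumes "\<And>z. z \<in> clq E V \<inter> S \<Longrightarrow> z v \<noteq> 1"
  shows "continuous_map (subtopology (clq_top E V) S) euclideanreal (\<lambda>f. project_off v f x)"
proof (cases "x = v")
  case False
  then show ?thesis unfolding project_off_def using assms
    by (auto intro!: continuous_map_real_divide continuous_intros continuous_map_clq_coord)
qed (simp add: project_off_def)

text \<open>The weight of \<open>v\<close> is spread proportionally over the other vertices. The
  segment from \<open>f\<close> to its projection stays in the support of \<open>f\<close>, and
  \<open>v\<close> only loses weight along it, so \<open>f v < 1\<close> persists.\<close>

lemma off_vertex_equivalent:
  assumes "finite V" "v \<in> V"
  shows "subtopology (clq_top E V) {f. f v < 1} homotopy_equivalent_space clq_top E (V - {v})"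
proof (rule deformation_retract_imp_homotopy_equivalent_space)
  let ?X = "subtopology (clq_top E V) {f. f v < 1}"
  have c: "continuous_map ?X euclideanreal (\<lambda>f. project_off v f x)" for x
    by (rule continuous_map_project_off) auto
  have c1: "continuous_map ?X (clq_top E (V - {v})) (project_off v)"
    using project_off_in[OF assms] c by (auto simp: continuous_map_into_clq)
  have c2: "continuous_map ?X ?X (project_off v)"
    unfolding continuous_map_into_clq_sub
    using project_off_in[OF assms, THEN subsetD[OF clq_mono, rotated 2]] assms c
    by (auto simp: project_off_def)
  show "homotopic_with (\<lambda>x. True) ?X ?X (project_off v) id"
  proof (rule straight_line_homotopic[OF c2])
    fix z x y assume z: "z \<in> topspace ?X"
    assume "project_off v z x \<noteq> 0 \<or> id z x \<noteq> 0" "project_off v z y \<noteq> 0 \<or> id z y \<noteq> 0"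
    then have "z x \<noteq> 0" "z y \<noteq> 0" using project_off_supp[of v z] by auto
    then show "E x y" using clqD(3) z by auto
  next
    fix z t assume z: "z \<in> topspace ?X" "0 \<le> t" "t \<le> (1::real)"
    have "t * z v < 1" using z clqD(1)[of z E V v]
      by (metis (no_types, lifting) IntD2 mem_Collect_eq mult_left_le_one_le order_le_less_trans topspace_subtopology IntD1 topspace_clq_top)
    then show "(\<lambda>x. (1 - t) * project_off v z x + t * id z x) \<in> {f. f v < 1}"
      by (simp add: project_off_def)
  qed simp
  show "retraction_maps ?X (clq_top E (V - {v})) (project_off v) id"
    unfolding retraction_maps_def
  proof (intro conjI ballI)
    show "continuous_map (clq_top E (V - {v})) ?X id"
      using continuous_map_clq_coord' clq_mono[of V "V - {v}" E] assms
      by (auto simp: continuous_map_into_clq_sub dest: clqD(2)[of _ E "V - {v}" v])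
    fix f assume "f \<in> topspace (clq_top E (V - {v}))"
    then have "f v = 0" using clqD(2)[of f E "V - {v}" v] by auto
    then show "project_off v (id f) = f" by (auto simp: project_off_def)
  qed (rule c1)
qed

lemma open_star_contractible:
  assumes "finite V" "v \<in> V" "E v v"
  shows "contractible_space (subtopology (clq_top E V) {f. 0 < f v})"
proof -
  let ?X = "subtopology (clq_top E V) {f. 0 < f v}"
  have "homotopic_with (\<lambda>_. True) ?X ?X id (\<lambda>f. vtx v)"
  proof (rule straight_line_homotopic)
    show "continuous_map ?X ?X (\<lambda>f. vtx v)"
      using vtx_in_clq[of V v E] assms by (auto simp: continuous_map_into_clq_sub vtx_def)
    fix z x y assume "z \<in> topspace ?X" and x: "id z x \<noteq> 0 \<or> vtx v x \<noteq> 0" "id z y \<noteq> 0 \<or> vtx v y \<noteq> 0"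
    then have z: "z \<in> clq E V" "z v > 0" by auto
    have "z x \<noteq> 0" "z y \<noteq> 0" using x z by (auto simp: vtx_def split: if_splits)
    then show "E x y" using clqD(3)[OF z(1), of x y] by simp
  next
    fix z t assume z: "z \<in> topspace ?X" "0 \<le> t" "t \<le> (1::real)"
    have "(1 - t) * z v + t > 0"
    proof (cases "t = 0")
      case False then show ?thesis using z by (intro add_nonneg_pos) auto
    qed (use z in auto)
    then show "(\<lambda>x. (1 - t) * id z x + t * vtx v x) \<in> {f. 0 < f v}"
      by (simp add: vtx_def)
  qed simp
  then show ?thesis unfolding contractible_space_def by blast
qed

lemma link_notin: "v \<notin> link_set E V v" and link_subset: "link_set E V v \<subseteq> V"
  by (auto simp: link_set_def)

lemma cone_point_in:
  assumes V: "finite V" "v \<in> V" "E v v" and E: "\<And>x y. E x y \<Longrightarrow> E y x"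
    and y: "y \<in> clq E (link_set E V v)" and a: "0 \<le> a" "a \<le> 1"
  shows "(\<lambda>x. (1 - a) * y x + a * vtx v x) \<in> clq E V"
proof (rule clq_combine)
  show "y \<in> clq E V" using y clq_mono[OF V(1) link_subset] by blast
  show "vtx v \<in> clq E V" by (rule vtx_in_clq) (use V in auto)
  fix p q assume p: "y p \<noteq> 0 \<or> vtx v p \<noteq> 0" and q: "y q \<noteq> 0 \<or> vtx v q \<noteq> 0"
  have "y u \<noteq> 0 \<Longrightarrow> E v u" for u using clqD(2)[OF y, of u] by (auto simp: link_set_def)
  then show "E p q" using p q V E clqD(3)[OF y, of p q]
    by (auto simp: vtx_def split: if_splits)
qed (use a in auto)

text \<open>The link is embedded at height \<open>f v = 1/2\<close>: every point of the punctured
  star slides along its own cone line to that height.\<close>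

lemma punctured_star_equivalent:
  assumes V: "finite V" "v \<in> V" "E v v" and E: "\<And>x y. E x y \<Longrightarrow> E y x"
  shows "subtopology (clq_top E V) {f. 0 < f v \<and> f v < 1} homotopy_equivalent_space clq_top E (link_set E V v)"
proof (rule deformation_retraction_imp_homotopy_equivalent_space)
  let ?X = "subtopology (clq_top E V) {f. 0 < f v \<and> f v < 1}"
  let ?i = "\<lambda>y x. (1 - 1/2) * y x + 1/2 * vtx v x :: real"
  have v0: "y v = 0" if "y \<in> clq E (link_set E V v)" for y
    using clqD(2)[OF that] link_notin[of v E V] by blast
  have i: "?i y \<in> clq E V" if "y \<in> clq E (link_set E V v)" for y
    using cone_point_in[OF V E that, of "1/2"] by simp
  have ci: "continuous_map (clq_top E (link_set E V v)) ?X ?i"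
    unfolding continuous_map_into_clq_sub
    by (intro conjI allI ballI continuous_intros continuous_map_clq_coord')
       (use i in \<open>auto simp: vtx_def dest!: v0\<close>)
  have cp: "continuous_map ?X (clq_top E (link_set E V v)) (project_off v)"
    unfolding continuous_map_into_clq
    using project_off_in_link[OF V(1,2)] by (auto intro!: continuous_map_project_off)
  show "retraction_maps ?X (clq_top E (link_set E V v)) (project_off v) ?i"
    unfolding retraction_maps_def
  proof (intro conjI ballI ci cp)
    fix y assume "y \<in> topspace (clq_top E (link_set E V v))"
    then show "project_off v (?i y) = y" using v0[of y] by (auto simp: project_off_def vtx_def)
  qed
  show "homotopic_with (\<lambda>x. True) ?X ?X (?i \<circ> project_off v) id"
  proof (rule straight_line_homotopic)
    show "continuous_map ?X ?X (?i \<circ> project_off v)" using cp ci continuous_map_compose by blast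
    fix z x y assume z: "z \<in> topspace ?X"
      and x: "(?i \<circ> project_off v) z x \<noteq> 0 \<or> id z x \<noteq> 0" and y: "(?i \<circ> project_off v) z y \<noteq> 0 \<or> id z y \<noteq> 0"
    have "z x \<noteq> 0" "z y \<noteq> 0" using x y z project_off_supp[of v z]
      by (auto simp: vtx_def split: if_splits)
    then show "E x y" using clqD(3) z by auto
  next
    fix z t assume z: "z \<in> topspace ?X" "0 \<le> t" "t \<le> (1::real)"
    have zv: "0 < z v" "z v < 1" using z by auto
    have "0 < (1 - t) * (1/2) + t * z v"
    proof (cases "t = 0")
      case False then show ?thesis using z zv by (intro add_nonneg_pos mult_pos_pos) auto
    qed simp
    moreover have "(1 - t) * (1/2) + t * z v < 1"
      by (rule convex_bound_lt) (use z zv in auto)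
    ultimately show "(\<lambda>x. (1 - t) * (?i \<circ> project_off v) z x + t * id z x) \<in> {f. 0 < f v \<and> f v < 1}"
      by (simp add: project_off_def vtx_def)
  qed simp
qed

text \<open>A contraction of the link to a point extends to a deformation that pushes the star of
  \<open>v\<close> off \<open>v\<close>: first the link contraction runs at constant weight of
  \<open>v\<close>, then that weight is lowered to 0. Damping by the height \<open>f v\<close> keeps
  the complement of the open star fixed. The link must be nonempty because the empty space counts as
  contractible.\<close>

lemma contractible_link_equivalent:
  assumes V: "finite V" "v \<in> V" and refl: "\<And>x. E x x" and sym: "\<And>x y. E x y \<Longrightarrow> E y x"
    and L: "link_set E V v \<noteq> {}" "contractible_space (clq_top E (link_set E V v))"
  shows "clq_top E V homotopy_equivalent_space clq_top E (V - {v})"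
proof -
  define L where "L = link_set E V v"
  have LV: "L \<subseteq> V" "v \<notin> L" "finite L"
    using V by (auto simp: L_def link_set_def)
  have vL0: "y v = 0" if "y \<in> clq E L" for y
    using clqD(2)[OF that] LV by blast
  obtain u where u: "u \<in> L" using L by (auto simp: L_def)
  have "vtx u \<in> clq E L" by (rule vtx_in_clq) (use LV u refl in auto)
  then have "clq_top E L \<noteq> trivial_topology"
    by (metis empty_iff null_topspace_iff_trivial topspace_clq_top)
  then obtain p where p: "p \<in> clq E L" and hom: "homotopic_with (\<lambda>x. True) (clq_top E L) (clq_top E L) id (\<lambda>x. p)"
    using L(2) unfolding contractible_space L_def[symmetric] by auto
  then obtain H where H: "continuous_map (prod_topology (top_of_set {0..1::real}) (clq_top E L)) (clq_top E L) H"
    and H0: "\<And>y. H (0, y) = y" and H1: "\<And>y. H (1, y) = p"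
    unfolding homotopic_with_def by auto
  \<comment> \<open>The damping factor: 0 on the face \<open>f v = 0\<close>, where nothing may
    move, and 1 from height 1/2 on, where the link coordinate is forgotten because it degenerates at
    \<open>f v = 1\<close>.\<close>
  define \<sigma> where "\<sigma> f = min 1 (2 * f v)" for f :: "'a \<Rightarrow> real"
  \<comment> \<open>Agrees with \<open>project_off\<close> up to height 1/2; the \<open>max\<close>
    keeps the denominator positive, hence the map continuous everywhere.\<close>
  define nr where "nr f = (\<lambda>x. if x = v then 0 else f x / max (1/2) (1 - f v))" for f :: "'a \<Rightarrow> real"
  \<comment> \<open>\<open>A\<close> is the weight given to \<open>v\<close> and \<open>B\<close>
    the time fed to \<open>H\<close>: \<open>B\<close> rises to \<sigma> in the first half of the
    homotopy, \<open>A\<close> falls to 0 in the second.\<close>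
  define A where "A = (\<lambda>z::real \<times> ('a \<Rightarrow> real). \<sigma> (snd z) * min 1 (2 - 2 * fst z))"
  define B where "B = (\<lambda>z::real \<times> ('a \<Rightarrow> real). \<sigma> (snd z) * min 1 (2 * fst z))"
  define mid where "mid z = (\<lambda>x. (1 - A z) * H (B z, nr (snd z)) x + A z * vtx v x)" for z
  define top where "top z = (\<lambda>x. (1 - A z) * p x + A z * vtx v x)" for z
  define D where "D z = (if snd z v = 0 then snd z else if snd z v \<le> 1/2 then mid z else top z)" for z
  let ?K = "clq_top E V"
  let ?P = "prod_topology (top_of_set {0..1::real}) ?K"
  \<comment> \<open>The closed star of \<open>v\<close>, written as a preimage of a closed set; on
    it, up to height 1/2, \<open>nr\<close> lands in the link.\<close>
  define C where "C = {z \<in> topspace ?P. (\<Sum>y\<in>insert v L. snd z y) \<in> {1}}"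
  have cfst: "continuous_map ?P euclideanreal fst"
    using continuous_map_fst[of "top_of_set {0..1::real}" ?K]
    by (simp add: continuous_map_in_subtopology)
  have csnd: "continuous_map ?P euclideanreal (\<lambda>z. snd z x)" for x
    using continuous_map_compose[OF continuous_map_snd[of _ ?K] continuous_map_clq_coord', of _ x]
    by (simp add: o_def)
  have c\<sigma>: "continuous_map ?P euclideanreal (\<lambda>z. \<sigma> (snd z))"
    unfolding \<sigma>_def by (intro continuous_map_real_min continuous_intros csnd)
  have cA: "continuous_map ?P euclideanreal A"
    unfolding A_def by (intro continuous_map_real_min continuous_intros cfst c\<sigma>)
  have cB: "continuous_map ?P euclideanreal B"
    unfolding B_def by (intro continuous_map_real_min continuous_intros cfst c\<sigma>)
  have cnr: "continuous_map ?P euclideanreal (\<lambda>z. nr (snd z) x)" for x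
  proof (cases "x = v")
    case False
    then show ?thesis unfolding nr_def
      by (simp, intro continuous_map_real_divide continuous_map_real_max continuous_intros csnd) auto
  qed (simp add: nr_def)
  have AB: "0 \<le> A z" "A z \<le> 1" "0 \<le> B z" "B z \<le> 1" if "z \<in> topspace ?P" for z
  proof -
    have "snd z \<in> clq E V" "0 \<le> fst z" "fst z \<le> 1" using that by (auto simp: mem_Times_iff)
    then have "0 \<le> \<sigma> (snd z)" "\<sigma> (snd z) \<le> 1" using clqD(1)[of "snd z" E V v] by (auto simp: \<sigma>_def)
    then show "0 \<le> A z" "A z \<le> 1" "0 \<le> B z" "B z \<le> 1"
      using \<open>0 \<le> fst z\<close> \<open>fst z \<le> 1\<close> by (auto simp: A_def B_def mult_le_one)
  qed
  have closedC: "closedin ?P C"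
    unfolding C_def
    by (rule closedin_continuous_map_preimage) (auto intro!: continuous_map_sum csnd LV)
  have C_supp: "snd z y = 0" if "z \<in> C" "y \<notin> insert v L" for z y
  proof -
    have z: "snd z \<in> clq E V" "(\<Sum>y\<in>insert v L. snd z y) = 1" using that by (auto simp: C_def)
    have "sum (snd z) V = sum (snd z) (V - insert v L) + sum (snd z) (insert v L)"
      using V LV by (intro sum.subset_diff) auto
    then have "sum (snd z) (V - insert v L) = 0" using z clqD(4)[OF z(1)] by simp
    then have "\<forall>y\<in>V - insert v L. snd z y = 0"
      using V clqD(1)[OF z(1)] by (subst (asm) sum_nonneg_eq_0_iff) auto
    then show ?thesis using that(2) clqD(2)[OF z(1), of y] by (cases "y \<in> V") auto
  qed
  have posC: "z \<in> C" if "z \<in> topspace ?P" "snd z v \<noteq> 0" for z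
  proof -
    have z: "snd z \<in> clq E V" using that by auto
    have "snd z y = 0" if "y \<notin> insert v L" for y
      using clqD(3)[OF z, of v y] \<open>snd z v \<noteq> 0\<close> that clqD(2)[OF z, of y] by (auto simp: L_def link_set_def)
    then have "sum (snd z) V = sum (snd z) (insert v L)"
      using V LV by (intro sum.mono_neutral_right) auto
    then show ?thesis using that z clqD(4)[OF z] by (auto simp: C_def)
  qed
  have nr_eq: "nr f = project_off v f" if "f v \<le> 1/2" for f
    using that by (auto simp: nr_def project_off_def max_def)
  have nr_in: "nr (snd z) \<in> clq E L" if "z \<in> C" "snd z v \<le> 1/2" for z
  proof (rule clq_sub[OF _ _ project_off_in[of V v "snd z" E, folded nr_eq[of "snd z", OF that(2)]]])
    show "nr (snd z) x = 0" if "x \<notin> L" for x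
      using C_supp[OF \<open>z \<in> C\<close>, of x] that by (auto simp: nr_def)
  qed (use that V LV in \<open>auto simp: C_def\<close>)
  \<comment> \<open>At height 1/2 either all weight is on \<open>v\<close> or \<open>H\<close> has
    reached its constant end, so the link coordinate drops out and the two formulas agree.\<close>
  have mid_top: "mid z = top z" if "z \<in> topspace ?P" "snd z v = 1/2" for z
  proof -
    have "\<sigma> (snd z) = 1" using that by (simp add: \<sigma>_def)
    then have "A z = 1 \<or> B z = 1" by (auto simp: A_def B_def min_def)
    then show ?thesis using H1 by (auto simp: mid_def top_def)
  qed
  have cmid: "continuous_map (subtopology ?P {z \<in> C. snd z v \<le> 1/2}) euclideanreal (\<lambda>z. mid z x)" for x
  proof -
    have 1: "continuous_map (subtopology ?P {z \<in> C. snd z v \<le> 1/2})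
        (prod_topology (top_of_set {0..1::real}) (clq_top E L)) (\<lambda>z. (B z, nr (snd z)))"
      unfolding continuous_map_pairwise o_def
      by (auto simp: continuous_map_in_subtopology continuous_map_into_clq AB nr_in
          intro!: continuous_map_from_subtopology cB cnr)
    have "continuous_map (subtopology ?P {z \<in> C. snd z v \<le> 1/2}) (clq_top E L) (\<lambda>z. H (B z, nr (snd z)))"
      using continuous_map_compose[OF 1 H] by (simp add: o_def)
    then have "continuous_map (subtopology ?P {z \<in> C. snd z v \<le> 1/2}) euclideanreal (\<lambda>z. H (B z, nr (snd z)) x)"
      by (simp add: continuous_map_into_clq)
    then show ?thesis unfolding mid_def
      by (intro continuous_map_add continuous_map_real_mult continuous_map_diff continuous_map_from_subtopology[OF cA]) simp_all
  qed
  have ctop: "continuous_map ?P euclideanreal (\<lambda>z. top z x)" for x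
    unfolding top_def by (intro continuous_intros cA)
  have Dx: "continuous_map ?P euclideanreal (\<lambda>z. D z x)" for x
  proof -
    let ?g = "\<lambda>z. if snd z v \<le> 1/2 then mid z x else top z x"
    have "continuous_map (subtopology ?P C) euclideanreal ?g"
    proof (rule continuous_map_cases_le)
      show "continuous_map (subtopology (subtopology ?P C) {z \<in> topspace (subtopology ?P C). snd z v \<le> 1/2}) euclideanreal (\<lambda>z. mid z x)"
        unfolding subtopology_subtopology
        by (rule continuous_map_from_subtopology_mono[OF cmid]) auto
    qed (use mid_top in \<open>auto intro!: continuous_map_from_subtopology csnd ctop\<close>)
    moreover have cl: "?P closure_of {z. snd z v \<noteq> 0} \<subseteq> C"
      using posC by (subst closure_of_restrict, intro closure_of_minimal closedC) auto
    ultimately have g: "continuous_map (subtopology ?P (?P closure_of {z. \<not> snd z v = 0})) euclideanreal ?g"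
      using continuous_map_from_subtopology_mono by blast
    have "closedin ?P {z \<in> topspace ?P. snd z v \<in> {0}}"
      by (rule closedin_continuous_map_preimage[OF csnd]) auto
    then have cl0: "?P closure_of {z. snd z v = 0} \<subseteq> {z \<in> topspace ?P. snd z v = 0}"
      by (subst closure_of_restrict, intro closure_of_minimal) auto
    \<comment> \<open>Gluing over the closed face \<open>f v = 0\<close> and the closure of its
      complement, which lies in \<open>C\<close>. On the overlap \<open>A\<close> and
      \<open>B\<close> vanish, and \<open>mid\<close> returns the point itself.\<close>
    have "continuous_map ?P euclideanreal (\<lambda>z. if snd z v = 0 then snd z x else ?g z)"
    proof (rule continuous_map_cases[OF _ g])
      show "continuous_map (subtopology ?P (?P closure_of {x. snd x v = 0})) euclideanreal (\<lambda>z. snd z x)"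
        by (intro continuous_map_from_subtopology csnd)
      fix z assume z: "z \<in> ?P frontier_of {z. snd z v = 0}"
      then have "z \<in> ?P closure_of {z. snd z v = 0}" by (simp add: frontier_of_def)
      then have z0: "z \<in> topspace ?P" "snd z v = 0" using cl0 by auto
      have zC: "z \<in> C"
        using z cl closure_of_mono[of "topspace ?P - {z. snd z v = 0}" "{z. snd z v \<noteq> 0}" ?P]
        unfolding frontier_of_closures by blast
      have "A z = 0" "B z = 0" using z0 by (auto simp: A_def B_def \<sigma>_def)
      moreover have "nr (snd z) = snd z" using z0 by (auto simp: nr_def)
      ultimately show "snd z x = ?g z" using z0 H0 by (simp add: mid_def)
    qed
    then show ?thesis unfolding D_def by (simp add: if_distrib[of "\<lambda>f. f x"] cong: if_cong)
  qed
  have Hin: "H (t, y) \<in> clq E L" if "0 \<le> t" "t \<le> 1" "y \<in> clq E L" for t y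
    using H that by (auto simp: continuous_map_into_clq)
  have D_in: "D z \<in> clq E V" if z: "z \<in> topspace ?P" for z
  proof -
    have "snd z v \<noteq> 0 \<Longrightarrow> snd z v \<le> 1/2 \<Longrightarrow> mid z \<in> clq E V"
      unfolding mid_def
      by (rule cone_point_in[OF V refl sym Hin[unfolded L_def], unfolded L_def[symmetric]])
        (use AB[OF z] nr_in posC[OF z] in auto)
    moreover have "top z \<in> clq E V" unfolding top_def
      by (rule cone_point_in[OF V refl sym p[unfolded L_def]]) (use AB[OF z] in auto)
    ultimately show ?thesis using z by (auto simp: D_def)
  qed
  have cD: "continuous_map ?P ?K D"
    unfolding continuous_map_into_clq using Dx D_in by auto
  have hD: "homotopic_with (\<lambda>_. True) ?K ?K (\<lambda>f. D (0, f)) (\<lambda>f. D (1, f))"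
    unfolding homotopic_with_def using cD by (intro exI[of _ D]) auto
  have c0: "continuous_map ?K ?K (\<lambda>f. D (0, f))" "continuous_map ?K ?K (\<lambda>f. D (1, f))"
    using homotopic_with_imp_continuous_maps[OF hD] by auto
  \<comment> \<open>At time 0 weight only moves towards \<open>v\<close> within the support of
    \<open>f\<close>, so segments join this map to the identity.\<close>
  have D0: "f x \<noteq> 0" if f: "f \<in> clq E V" and x: "D (0, f) x \<noteq> 0" for f x
  proof (cases "f v = 0")
    case False
    show ?thesis
    proof (cases "f v \<le> 1/2")
      case True
      then have "D (0, f) x = (1 - A (0, f)) * nr f x + A (0, f) * vtx v x"
        using False by (simp add: D_def mid_def B_def H0)
      then show ?thesis using False x by (auto simp: nr_def vtx_def split: if_splits)
    next
      case h: False
      then have "A (0, f) = 1" by (simp add: A_def \<sigma>_def)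
      then show ?thesis using False x h by (auto simp: D_def top_def vtx_def split: if_splits)
    qed
  qed (use x in \<open>simp add: D_def\<close>)
  have h0: "homotopic_with (\<lambda>_. True) ?K ?K (\<lambda>f. D (0, f)) id"
    by (rule straight_line_homotopic'[OF c0(1)]) (use D0 clqD(3) in force)+
  have h: "homotopic_with (\<lambda>_. True) ?K ?K (\<lambda>f. D (1, f)) id"
    using homotopic_with_trans[OF homotopic_with_symD[OF hD] h0] .
  have D1: "D (1, f) v = 0" if "f \<in> clq E V" for f
  proof -
    have "(1, f) \<in> topspace ?P" using that by simp
    moreover have "A (1, f) = 0" by (simp add: A_def)
    ultimately show ?thesis
      using vL0[OF p] vL0[OF Hin[OF AB(3,4) nr_in[OF posC]], of "(1, f)" "(1, f)"]
      by (auto simp: D_def mid_def top_def)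
  qed
  have r: "retraction_maps ?K (clq_top E (V - {v})) (\<lambda>f. D (1, f)) id"
    unfolding retraction_maps_def
  proof (intro conjI ballI)
    show "continuous_map ?K (clq_top E (V - {v})) (\<lambda>f. D (1, f))"
      unfolding continuous_map_into_clq
    proof (intro conjI allI ballI)
      fix f assume "f \<in> topspace ?K"
      then have f: "f \<in> clq E V" by simp
      have "D (1, f) \<in> clq E V" using D_in[of "(1, f)"] f by simp
      then show "D (1, f) \<in> clq E (V - {v})"
        by (rule clq_sub[OF V(1), rotated]) (use D1[OF f] clqD(2)[OF \<open>D (1, f) \<in> clq E V\<close>] in auto)
    qed (use c0(2) in \<open>auto simp: continuous_map_into_clq\<close>)
    show "continuous_map (clq_top E (V - {v})) ?K id"
      using continuous_map_clq_coord' clq_mono[of V "V - {v}" E] V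
      by (auto simp: continuous_map_into_clq)
    fix f assume "f \<in> topspace (clq_top E (V - {v}))"
    then have "f v = 0" using clqD(2)[of f E "V - {v}" v] by auto
    then show "D (1, id f) = f" by (simp add: D_def)
  qed
  show ?thesis
    by (rule deformation_retract_imp_homotopy_equivalent_space[OF h r])
qed

text \<open>Exact sequence of the pair formed by the complex and its part \<open>f v < 1\<close>.
  That part is the complex without \<open>v\<close> up to homotopy; after excising the face
  \<open>f v = 0\<close>, the relative group is that of the contractible open star modulo the
  punctured star, i.e. the reduced homology of the link one degree lower.\<close>

lemma reduced_homology_vertex_removal:
  assumes V: "finite V" "v \<in> V" and refl: "\<And>x. E x x" and sym: "\<And>x y. E x y \<Longrightarrow> E y x"
    and p: "p \<ge> 1"
    and 1: "trivial_group (reduced_homology_group p (clq_top E (V - {v})))"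
    and 2: "trivial_group (reduced_homology_group (p - 1) (clq_top E (link_set E V v)))"
  shows "trivial_group (reduced_homology_group p (clq_top E V))"
proof -
  let ?X = "clq_top E V"
  let ?T = "{f::'a\<Rightarrow>real. f v < 1}" and ?U = "{f::'a\<Rightarrow>real. f v = 0}"
  let ?O = "subtopology ?X {f. 0 < f v}"
  have star: "contractible_space ?O"
    by (rule open_star_contractible[OF V]) (rule refl)
  have nn: "0 \<le> f v" "f v \<le> 1" if "f \<in> clq E V" for f
    using clqD(1)[OF that] clq_le_1[OF V(1) that] by auto
  have "closedin ?X {f \<in> topspace ?X. f v \<in> {0}}"
    by (rule closedin_continuous_map_preimage[OF continuous_map_clq_coord']) auto
  then have "?X closure_of ?U \<subseteq> {f \<in> topspace ?X. f v \<in> {0}}"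
    by (subst closure_of_restrict, intro closure_of_minimal) auto
  moreover have "openin ?X {f \<in> topspace ?X. f v \<in> {..<1}}"
    by (rule openin_continuous_map_preimage[OF continuous_map_clq_coord']) auto
  then have "{f \<in> topspace ?X. f v \<in> {..<1}} \<subseteq> ?X interior_of ?T"
    by (intro interior_of_maximal) auto
  moreover have "{f \<in> topspace ?X. f v \<in> {0}} \<subseteq> {f \<in> topspace ?X. f v \<in> {..<1}}" by auto
  ultimately have cl: "?X closure_of ?U \<subseteq> ?X interior_of ?T" by (meson subset_trans)
  have s: "subtopology ?X (UNIV - ?U) = ?O"
  proof -
    have "topspace ?X \<inter> (UNIV - ?U) = topspace ?X \<inter> {f. 0 < f v}" using nn(1) by (auto simp: less_le)
    then show ?thesis using subtopology_restrict[of ?X "UNIV - ?U"] subtopology_restrict[of ?X "{f. 0 < f v}"] by argo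
  qed
  have "relative_homology_group p ?O (?T - ?U) \<cong> relative_homology_group p ?X ?T"
    using is_isoI[OF homology_excision_axiom[OF cl subset_UNIV, of p]] by (simp add: s)
  moreover have "trivial_group (relative_homology_group p ?O (?T - ?U))"
  proof (cases "topspace ?O \<inter> (?T - ?U) = {}")
    \<comment> \<open>For an isolated \<open>v\<close> the punctured star is empty and the relative
      group is the homology of the contractible star, which vanishes in degree
      \<open>p \<ge> 1\<close>.\<close>
    case True
    then have "relative_homology_group p ?O (?T - ?U) = homology_group p ?O"
      by (metis relative_homology_group_restrict)
    then show ?thesis
      using trivial_reduced_homology_group_contractible_space[OF star, where p = p]
        p by (simp add: un_reduced_homology_group)
  next
    case False
    have e: "subtopology ?O (?T - ?U) = subtopology ?X {f. 0 < f v \<and> f v < 1}"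
      unfolding subtopology_subtopology by (rule arg_cong[where f="subtopology ?X"]) auto
    have "relative_homology_group p ?O (?T - ?U) \<cong> reduced_homology_group (p - 1) (subtopology ?O (?T - ?U))"
      by (rule isomorphic_group_relative_homology_of_contractible[OF star False])
    moreover have "reduced_homology_group (p - 1) (subtopology ?O (?T - ?U)) \<cong> reduced_homology_group (p - 1) (clq_top E (link_set E V v))"
      unfolding e
      by (intro homotopy_equivalent_space_imp_isomorphic_reduced_homology_groups punctured_star_equivalent) (use V refl sym in auto)
    ultimately show ?thesis using 2
      by (meson group_reduced_homology_group group_relative_homology_group isomorphic_group_triviality)
  qed
  ultimately have t3: "trivial_group (relative_homology_group p ?X ?T)"
    by (meson group_relative_homology_group isomorphic_group_triviality)
  have t1: "trivial_group (reduced_homology_group p (subtopology ?X ?T))"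
    using 1 homotopy_equivalent_space_imp_isomorphic_reduced_homology_groups[OF off_vertex_equivalent[OF V]]
      isomorphic_group_triviality group_reduced_homology_group by blast
  let ?h = "hom_induced p ?X {} ?X ?T id" and ?i = "hom_induced p (subtopology ?X ?T) {} ?X {} id"
  let ?R = "reduced_homology_group p ?X"
  have ex: "kernel ?R (relative_homology_group p ?X ?T) ?h = ?i ` carrier (reduced_homology_group p (subtopology ?X ?T))"
    and h: "group_hom ?R (relative_homology_group p ?X ?T) ?h"
    and i: "group_hom (reduced_homology_group p (subtopology ?X ?T)) ?R ?i"
    using homology_exactness_reduced_3[of p ?X ?T] by (auto simp: group_hom_def group_hom_axioms_def)
  have "kernel ?R (relative_homology_group p ?X ?T) ?h = carrier ?R"
    by (rule group_hom.kernel_to_trivial_group[OF h t3])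
  moreover have "?i ` carrier (reduced_homology_group p (subtopology ?X ?T)) = {\<one>\<^bsub>?R\<^esub>}"
    using t1 group_hom.hom_one[OF i] by (simp add: trivial_group_def)
  ultimately show ?thesis using ex by (simp add: trivial_group_def)
qed

section \<open>Complexes covered by two cliques\<close>

text \<open>The link of \<open>v\<close> is a cone with apex \<open>w\<close>.\<close>

lemma dominated_vertex_equivalent:
  assumes V: "finite V" "v \<in> V" "w \<in> V" "w \<noteq> v"
    and refl: "\<And>x. E x x" and sym: "\<And>x y. E x y \<Longrightarrow> E y x"
    and dom: "E v w" "\<And>u. u \<in> V \<Longrightarrow> E v u \<Longrightarrow> E w u"
  shows "clq_top E V homotopy_equivalent_space clq_top E (V - {v})"
proof (rule contractible_link_equivalent)
  have w: "w \<in> link_set E V v" using V dom by (simp add: link_set_def)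
  then show "link_set E V v \<noteq> {}" by blast
  show "contractible_space (clq_top E (link_set E V v))"
    by (rule contractible_cone[OF _ w]) (use V dom sym in \<open>auto simp: link_set_def\<close>)
qed (use V refl sym in auto)

lemma dominated_set_equivalent:
  assumes "finite R" "finite V" "R \<subseteq> V - {w}" "w \<in> V"
    and refl: "\<And>x. E x x" and sym: "\<And>x y. E x y \<Longrightarrow> E y x"
    and dom: "\<And>v. v \<in> R \<Longrightarrow> E v w" "\<And>u v. v \<in> R \<Longrightarrow> u \<in> V \<Longrightarrow> E v u \<Longrightarrow> E w u"
  shows "clq_top E V homotopy_equivalent_space clq_top E (V - R)"
  using assms(1,3) dom
proof (induction R rule: finite_induct)
  case empty
  then show ?case by (simp add: homotopy_equivalent_space_refl)
next
  case (insert v R)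
  have "clq_top E V homotopy_equivalent_space clq_top E (V - R)"
    using insert by (intro insert.IH) auto
  also have "clq_top E (V - R) homotopy_equivalent_space clq_top E (V - R - {v})"
    by (rule dominated_vertex_equivalent[where w = w]) (use insert assms in auto)
  also have "V - R - {v} = V - insert v R" by blast
  finally show ?case .
qed

section \<open>Two cliques whose non-adjacent pairs are given by a sliding window\<close>

lemma finite_minimizer:
  fixes c :: "'a \<Rightarrow> real"
  assumes "finite A" "A \<noteq> {}"
  obtains x where "x \<in> A" "\<And>y. y \<in> A \<Longrightarrow> c x \<le> c y"
proof -
  have "Min (c ` A) \<in> c ` A" using assms by simp
  then obtain x where "x \<in> A" "Min (c ` A) = c x" by blast
  moreover have "Min (c ` A) \<le> c y" if "y \<in> A" for y using assms that by simp
  ultimately show ?thesis using that by simp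
qed

text \<open>Abstract form of the link of a point on the circle: \<open>A\<close> and
  \<open>B\<close> are the neighbours on its two sides, \<open>w\<close> will be
  \<open>1 - 2 * r\<close>, and \<open>c\<close> is a coordinate in which each point of
  \<open>A\<close> misses exactly the points of \<open>B\<close> in a window of width
  \<open>w\<close>.\<close>

definition two_clique :: "('a \<Rightarrow> 'a \<Rightarrow> bool) \<Rightarrow> 'a set \<Rightarrow> 'a set \<Rightarrow> ('a \<Rightarrow> real) \<Rightarrow> real \<Rightarrow> bool" where
  "two_clique E A B c w \<longleftrightarrow> finite A \<and> finite B \<and> A \<inter> B = {} \<and>
     (\<forall>x. E x x) \<and> (\<forall>x y. E x y \<longrightarrow> E y x) \<and>
     (\<forall>x\<in>A. \<forall>y\<in>A. E x y) \<and> (\<forall>x\<in>B. \<forall>y\<in>B. E x y) \<and>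
     (\<forall>a\<in>A. \<forall>b\<in>B. E a b \<longleftrightarrow> \<not> (c a \<le> c b \<and> c b \<le> c a + w))"

lemma two_cliqueD:
  assumes "two_clique E A B c w"
  shows "finite A" "finite B" "A \<inter> B = {}" "E x x" "E x y \<Longrightarrow> E y x"
    "x \<in> A \<Longrightarrow> y \<in> A \<Longrightarrow> E x y" "x \<in> B \<Longrightarrow> y \<in> B \<Longrightarrow> E x y"
    "a \<in> A \<Longrightarrow> b \<in> B \<Longrightarrow> E a b \<longleftrightarrow> \<not> (c a \<le> c b \<and> c b \<le> c a + w)"
proof -
  note h = assms[unfolded two_clique_def]
  show "finite A"
    using h[THEN conjunct1] .
  show "finite B"
    using h[THEN conjunct2, THEN conjunct1] .
  show "A \<inter> B = {}"
    using h[THEN conjunct2, THEN conjunct2, THEN conjunct1] .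
  show "E x x"
    using h[THEN conjunct2, THEN conjunct2, THEN conjunct2, THEN conjunct1, rule_format] .
  show "E y x" if "E x y"
    using h[THEN conjunct2, THEN conjunct2, THEN conjunct2, THEN conjunct2, THEN conjunct1, rule_format, OF that] .
  show "E x y" if "x \<in> A" "y \<in> A"
    using h[THEN conjunct2, THEN conjunct2, THEN conjunct2, THEN conjunct2, THEN conjunct2, THEN conjunct1, rule_format, OF that] .
  show "E x y" if "x \<in> B" "y \<in> B"
    using h[THEN conjunct2, THEN conjunct2, THEN conjunct2, THEN conjunct2, THEN conjunct2, THEN conjunct2, THEN conjunct1, rule_format, OF that] .
  show "E a b \<longleftrightarrow> \<not> (c a \<le> c b \<and> c b \<le> c a + w)" if "a \<in> A" "b \<in> B"
    using h[THEN conjunct2, THEN conjunct2, THEN conjunct2, THEN conjunct2, THEN conjunct2, THEN conjunct2, THEN conjunct2, rule_format, OF that] .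
qed

lemma two_clique_subset:
  assumes "two_clique E A B c w" "A' \<subseteq> A" "B' \<subseteq> B"
  shows "two_clique E A' B' c w"
  unfolding two_clique_def
proof (intro conjI allI ballI impI)
  note D = two_cliqueD[OF assms(1)]
  show "finite A'" "finite B'" using D(1,2) assms(2,3) finite_subset by blast+
  show "A' \<inter> B' = {}" using D(3) assms(2,3) by blast
  show "E x x" for x by (rule D(4))
  show "E y x" if "E x y" for x y using that by (rule D(5))
  show "E x y" if "x \<in> A'" "y \<in> A'" for x y by (rule D(6)) (use assms that in auto)
  show "E x y" if "x \<in> B'" "y \<in> B'" for x y by (rule D(7)) (use assms that in auto)
  show "E a b \<longleftrightarrow> \<not> (c a \<le> c b \<and> c b \<le> c a + w)" if "a \<in> A'" "b \<in> B'" for a b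
    by (rule D(8)) (use assms that in auto)
qed

text \<open>Let \<alpha> be the minimum of \<open>A\<close>. A point of \<open>B\<close> below it is
  adjacent to everything; if \<open>B\<close> has no point up to \<open>c \<alpha> + w\<close>, then
  \<alpha> is. Otherwise the two minima are non-adjacent.\<close>

lemma two_clique_cases:
  assumes tc: "two_clique E A B c w"
  obtains "A \<union> B = {}"
  | x where "x \<in> A \<union> B" "\<And>y. y \<in> A \<union> B \<Longrightarrow> E x y" "\<And>y. y \<in> A \<union> B \<Longrightarrow> E y x"
  | \<alpha> \<beta> where "\<alpha> \<in> A" "\<beta> \<in> B" "c \<alpha> \<le> c \<beta>" "c \<beta> \<le> c \<alpha> + w"
      "\<And>a. a \<in> A \<Longrightarrow> c \<alpha> \<le> c a" "\<And>b. b \<in> B \<Longrightarrow> c \<beta> \<le> c b"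
proof -
  have fin: "finite A" "finite B" using two_cliqueD(1,2)[OF tc] .
  have sym: "E x y \<Longrightarrow> E y x" for x y using two_cliqueD(5)[OF tc] .
  have EA: "E x y" if "x \<in> A" "y \<in> A" for x y using two_cliqueD(6)[OF tc that] .
  have EB: "E x y" if "x \<in> B" "y \<in> B" for x y using two_cliqueD(7)[OF tc that] .
  have EAB: "E a b \<longleftrightarrow> \<not> (c a \<le> c b \<and> c b \<le> c a + w)" if "a \<in> A" "b \<in> B" for a b
    using two_cliqueD(8)[OF tc that] .
  show ?thesis
  proof (cases "A = {}")
    case True
    show ?thesis
    proof (cases "B = {}")
      case False
      then obtain b where b: "b \<in> B" by blast
      show ?thesis
        by (rule that(2)[of b]) (use b EB True in auto)
    qed (use True that(1) in auto)
  next
    case False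
    obtain \<alpha> where \<alpha>: "\<alpha> \<in> A" "\<And>a. a \<in> A \<Longrightarrow> c \<alpha> \<le> c a"
      using finite_minimizer[OF fin(1) False, where c = c] by metis
    show ?thesis
    proof (cases "\<exists>b\<in>B. c b < c \<alpha>")
      case True
      then obtain b where b: "b \<in> B" "c b < c \<alpha>" by blast
      have ab: "E a b" if "a \<in> A" for a
        using EAB[OF that b(1)] \<alpha>(2)[OF that] b by auto
      show ?thesis
        by (rule that(2)[of b]) (use b EB ab sym in blast)+
    next
      case nb: False
      show ?thesis
      proof (cases "\<exists>b\<in>B. c b \<le> c \<alpha> + w")
        case True
        then obtain b where b: "b \<in> B" "c b \<le> c \<alpha> + w" by blast
        obtain \<beta> where \<beta>: "\<beta> \<in> B" "\<And>b. b \<in> B \<Longrightarrow> c \<beta> \<le> c b"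
          using finite_minimizer[OF fin(2), where c = c] b by (metis empty_iff)
        show ?thesis
        proof (rule that(3)[OF \<alpha>(1) \<beta>(1)])
          show "c \<alpha> \<le> c \<beta>" using nb \<beta>(1) by (auto simp: not_less)
          show "c \<beta> \<le> c \<alpha> + w" using \<beta>(2)[OF b(1)] b(2) by simp
        qed (use \<alpha> \<beta> in auto)
      next
        case False
        have \<alpha>b: "E \<alpha> b" if "b \<in> B" for b using EAB[OF \<alpha>(1) that] False that by auto
        show ?thesis
          by (rule that(2)[of \<alpha>]) (use \<alpha> EA sym \<alpha>b in blast)+
      qed
    qed
  qed
qed

context
  fixes E :: "'a \<Rightarrow> 'a \<Rightarrow> bool" and A B :: "'a set" and c :: "'a \<Rightarrow> real" and w :: real and \<alpha> \<beta> :: 'a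
  assumes tc: "two_clique E A B c w"
    and \<alpha>: "\<alpha> \<in> A" "\<And>a. a \<in> A \<Longrightarrow> c \<alpha> \<le> c a"
    and \<beta>: "\<beta> \<in> B" "\<And>b. b \<in> B \<Longrightarrow> c \<beta> \<le> c b"
    and \<alpha>\<beta>: "c \<alpha> \<le> c \<beta>" "c \<beta> \<le> c \<alpha> + w"
begin

text \<open>Points of \<open>A\<close> up to \<open>c \<beta>\<close> are dominated by \<alpha>,
  points of \<open>B\<close> up to \<open>c \<alpha> + w\<close> by \<beta>. The survivors
  \<open>R\<close> are adjacent to both \<alpha> and \<beta>, which are not adjacent to each other:
  what remains is the suspension of the complex on \<open>R\<close>.\<close>

lemma two_clique_reduce:
  defines "R \<equiv> {a \<in> A. c \<beta> < c a} \<union> {b \<in> B. c \<alpha> + w < c b}"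
  shows "clq_top E (A \<union> B) homotopy_equivalent_space clq_top E (insert \<alpha> (insert \<beta> R))"
    and "link_set E (insert \<alpha> (insert \<beta> R)) \<beta> = R"
    and "contractible_space (clq_top E (insert \<alpha> (insert \<beta> R) - {\<beta>}))"
proof -
  have fin: "finite A" "finite B" and dis: "A \<inter> B = {}" using two_cliqueD(1,2,3)[OF tc] .
  have refl: "E x x" for x using two_cliqueD(4)[OF tc] .
  have sym: "E x y \<Longrightarrow> E y x" for x y using two_cliqueD(5)[OF tc] .
  have EA: "E x y" if "x \<in> A" "y \<in> A" for x y using two_cliqueD(6)[OF tc that] .
  have EB: "E x y" if "x \<in> B" "y \<in> B" for x y using two_cliqueD(7)[OF tc that] .
  have EAB: "E a b \<longleftrightarrow> \<not> (c a \<le> c b \<and> c b \<le> c a + w)" if "a \<in> A" "b \<in> B" for a b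
    using two_cliqueD(8)[OF tc that] .
  have ne: "\<alpha> \<noteq> \<beta>" using \<alpha> \<beta> dis by auto
  let ?RA = "{a \<in> A. a \<noteq> \<alpha> \<and> c a \<le> c \<beta>}" and ?RB = "{b \<in> B. b \<noteq> \<beta> \<and> c b \<le> c \<alpha> + w}"
  have "clq_top E (A \<union> B) homotopy_equivalent_space clq_top E (A \<union> B - ?RA)"
  proof (rule dominated_set_equivalent[where w = \<alpha>])
    fix u v assume v: "v \<in> ?RA" and u: "u \<in> A \<union> B" and E: "E v u"
    show "E \<alpha> u"
    proof (cases "u \<in> A")
      case False
      then have "u \<in> B" using u by auto
      moreover have "c \<alpha> \<le> c v" "v \<in> A" "c v \<le> c \<beta>" using \<alpha>(2) v by auto
      ultimately show ?thesis using EAB[of v u] EAB[of \<alpha> u] E \<alpha>(1) \<beta>(2)[of u] by auto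
    qed (use EA \<alpha> in auto)
  qed (use fin \<alpha> EA dis in \<open>auto intro: refl sym\<close>)
  also have "clq_top E (A \<union> B - ?RA) homotopy_equivalent_space clq_top E (A \<union> B - ?RA - ?RB)"
  proof (rule dominated_set_equivalent[where w = \<beta>])
    fix u v assume v: "v \<in> ?RB" and u: "u \<in> A \<union> B - ?RA" and E: "E v u"
    show "E \<beta> u"
    proof (cases "u \<in> B")
      case False
      then have uA: "u \<in> A" using u by auto
      have "u \<noteq> \<alpha>" using EAB[of \<alpha> v] v sym[OF E] \<alpha>(1) \<beta>(2)[of v] \<alpha>\<beta> by auto
      then have "c \<beta> < c u" using uA u by auto
      then show ?thesis using EAB[of u \<beta>] uA \<beta>(1) sym[of u \<beta>] by auto
    qed (use EB \<beta> in auto)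
  qed (use fin \<beta> EB dis in \<open>auto intro: refl sym\<close>)
  also have "A \<union> B - ?RA - ?RB = insert \<alpha> (insert \<beta> R)"
    using \<alpha> \<beta> \<alpha>\<beta> dis unfolding R_def by auto
  finally show "clq_top E (A \<union> B) homotopy_equivalent_space clq_top E (insert \<alpha> (insert \<beta> R))" .
  have n: "\<not> E \<beta> \<alpha>" using EAB[of \<alpha> \<beta>] \<alpha> \<beta> \<alpha>\<beta> sym by blast
  have r: "E \<beta> x" if "x \<in> R" for x
    using that EAB[of x \<beta>] EB[of \<beta> x] \<beta>(1) sym[of x \<beta>] unfolding R_def by auto
  have \<beta>R: "\<beta> \<notin> R" using \<beta> \<alpha>\<beta> dis unfolding R_def by auto
  have "\<alpha> \<notin> R" using \<alpha> \<alpha>\<beta> dis unfolding R_def by auto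
  then show "link_set E (insert \<alpha> (insert \<beta> R)) \<beta> = R"
    using n r \<beta>R unfolding link_set_def by auto
  have a: "E \<alpha> x" if "x \<in> R" for x
    using that EAB[of \<alpha> x] EA[of \<alpha> x] \<alpha> unfolding R_def by auto
  show "contractible_space (clq_top E (insert \<alpha> (insert \<beta> R) - {\<beta>}))"
  proof (rule contractible_cone[where w = \<alpha>])
    show "finite (insert \<alpha> (insert \<beta> R) - {\<beta>})" using fin by (simp add: R_def)
  qed (use ne a refl sym in blast)+
qed

text \<open>The suspension of a contractible complex is contractible. \<open>R = {}\<close> must be
  excluded, as it leaves the two isolated points \<alpha> and \<beta>.\<close>

lemma two_clique_reduce_contractible:
  defines "R \<equiv> {a \<in> A. c \<beta> < c a} \<union> {b \<in> B. c \<alpha> + w < c b}"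
  assumes "R \<noteq> {}" "contractible_space (clq_top E R)"
  shows "contractible_space (clq_top E (A \<union> B))"
proof -
  let ?M = "insert \<alpha> (insert \<beta> R)"
  have "finite R" using two_cliqueD(1,2)[OF tc] by (simp add: R_def)
  then have "clq_top E ?M homotopy_equivalent_space clq_top E (?M - {\<beta>})"
    using contractible_link_equivalent[of ?M \<beta> E, unfolded two_clique_reduce(2)[folded R_def],
        OF _ _ two_cliqueD(4,5)[OF tc] assms(2,3)] by simp
  then show ?thesis
    using two_clique_reduce(1,3)[folded R_def] homotopy_equivalent_space_contractibility by blast
qed

lemma two_clique_reduce_homology:
  defines "R \<equiv> {a \<in> A. c \<beta> < c a} \<union> {b \<in> B. c \<alpha> + w < c b}"
  assumes "trivial_group (reduced_homology_group p (clq_top E R))" "p \<ge> 0"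
  shows "trivial_group (reduced_homology_group (p + 1) (clq_top E (A \<union> B)))"
proof -
  let ?M = "insert \<alpha> (insert \<beta> R)"
  have "finite R" using two_cliqueD(1,2)[OF tc] by (simp add: R_def)
  then have "trivial_group (reduced_homology_group (p + 1) (clq_top E ?M))"
    using reduced_homology_vertex_removal[of ?M \<beta> E "p + 1", unfolded two_clique_reduce(2)[folded R_def],
        OF _ _ two_cliqueD(4,5)[OF tc] _
          trivial_reduced_homology_group_contractible_space[OF two_clique_reduce(3)[folded R_def]]] assms(2,3)
    by simp
  then show ?thesis
    using homotopy_equivalent_space_imp_isomorphic_reduced_homology_groups[OF two_clique_reduce(1)[folded R_def]]
      isomorphic_group_triviality group_reduced_homology_group by blast
qed

end

text \<open>A suspension step replaces lower bounds \<open>s\<close> on \<open>A\<close> and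
  \<open>t\<close> on \<open>B\<close> by \<open>t\<close> and \<open>s + w\<close>; the value is
  the bound on \<open>B\<close> after \<open>i\<close> steps.\<close>

primrec link_bound :: "real \<Rightarrow> nat \<Rightarrow> real \<Rightarrow> real \<Rightarrow> real" where
  "link_bound w 0 s t = t"
| "link_bound w (Suc i) s t = link_bound w i t (s + w)"

text \<open>Each suspension step lowers the degree by one. After \<open>i\<close> steps the lower
  bound for \<open>B\<close> has reached the upper bound \<open>R\<close> of all coordinates, so
  \<open>B\<close> is empty and \<open>A\<close> spans a simplex or nothing.\<close>

lemma two_clique_acyclic:
  assumes "two_clique E A B c w" "\<And>a. a \<in> A \<Longrightarrow> s \<le> c a" "\<And>b. b \<in> B \<Longrightarrow> t \<le> c b"
    "\<And>x. x \<in> A \<union> B \<Longrightarrow> c x < R" "R \<le> link_bound w i s t"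
  shows "trivial_group (reduced_homology_group (int i) (clq_top E (A \<union> B)))"
  using assms
proof (induction i arbitrary: A B s t)
  case 0
  have "B = {}" using 0 by fastforce
  have "contractible_space (clq_top E A)"
  proof (cases "A = {}")
    case True
    then show ?thesis by (metis clq_empty contractible_space_empty null_topspace_iff_trivial topspace_clq_top)
  next
    case False
    then obtain a where "a \<in> A" by blast
    then show ?thesis
      by (intro contractible_cone[where w = a]) (use two_cliqueD(1,6)[OF 0(1)] in auto)
  qed
  then show ?case using \<open>B = {}\<close> trivial_reduced_homology_group_contractible_space by simp
next
  case (Suc i)
  show ?case
  proof (rule two_clique_cases[OF Suc.prems(1)])
    assume "A \<union> B = {}"
    then show ?thesis by (simp add: trivial_reduced_homology_group_empty)
  next
    fix x assume x: "x \<in> A \<union> B" "\<And>y. y \<in> A \<union> B \<Longrightarrow> E x y" "\<And>y. y \<in> A \<union> B \<Longrightarrow> E y x"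
    have "contractible_space (clq_top E (A \<union> B))"
      by (rule contractible_cone[where w = x and E = E]) (use two_cliqueD(1,2)[OF Suc.prems(1)] x in auto)
    then show ?thesis by (rule trivial_reduced_homology_group_contractible_space)
  next
    fix \<alpha> \<beta>
    assume ab: "\<alpha> \<in> A" "\<beta> \<in> B" "c \<alpha> \<le> c \<beta>" "c \<beta> \<le> c \<alpha> + w"
      "\<And>a. a \<in> A \<Longrightarrow> c \<alpha> \<le> c a" "\<And>b. b \<in> B \<Longrightarrow> c \<beta> \<le> c b"
    let ?A = "{a \<in> A. c \<beta> < c a}" and ?B = "{b \<in> B. c \<alpha> + w < c b}"
    have "trivial_group (reduced_homology_group (int i) (clq_top E (?A \<union> ?B)))"
    proof (rule Suc.IH)
      show "two_clique E ?A ?B c w" by (rule two_clique_subset[OF Suc.prems(1)]) auto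
      show "t \<le> c a" if "a \<in> ?A" for a using that Suc.prems(3)[OF ab(2)] by auto
      show "s + w \<le> c b" if "b \<in> ?B" for b using that Suc.prems(2)[OF ab(1)] by auto
      show "R \<le> link_bound w i t (s + w)" using Suc.prems(5) by simp
    qed (use Suc.prems(4) in auto)
    then show ?thesis
      using two_clique_reduce_homology[OF Suc.prems(1) ab(1) ab(5) ab(2) ab(6) ab(3,4), of "int i"]
      by (simp add: add.commute)
  qed
qed

lemma two_clique_step_contractible:
  assumes tc: "two_clique E A B c w" and "A \<union> B \<noteq> {}"
    and step: "\<And>\<alpha> \<beta>. \<lbrakk>\<alpha> \<in> A; \<beta> \<in> B; \<And>a. a \<in> A \<Longrightarrow> c \<alpha> \<le> c a; \<And>b. b \<in> B \<Longrightarrow> c \<beta> \<le> c b\<rbrakk> \<Longrightarrow>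
      {a \<in> A. c \<beta> < c a} \<union> {b \<in> B. c \<alpha> + w < c b} \<noteq> {} \<and>
      contractible_space (clq_top E ({a \<in> A. c \<beta> < c a} \<union> {b \<in> B. c \<alpha> + w < c b}))"
  shows "contractible_space (clq_top E (A \<union> B))"
proof (rule two_clique_cases[OF tc])
  fix x assume x: "x \<in> A \<union> B" "\<And>y. y \<in> A \<union> B \<Longrightarrow> E x y" "\<And>y. y \<in> A \<union> B \<Longrightarrow> E y x"
  show ?thesis
    by (rule contractible_cone[where w = x and E = E]) (use two_cliqueD(1,2)[OF tc] x in auto)
next
  fix \<alpha> \<beta>
  assume ab: "\<alpha> \<in> A" "\<beta> \<in> B" "c \<alpha> \<le> c \<beta>" "c \<beta> \<le> c \<alpha> + w"
    "\<And>a. a \<in> A \<Longrightarrow> c \<alpha> \<le> c a" "\<And>b. b \<in> B \<Longrightarrow> c \<beta> \<le> c b"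
  then show ?thesis
    using two_clique_reduce_contractible[OF tc ab(1) ab(5) ab(2) ab(6) ab(3,4)] step[OF ab(1,2,5,6)] by blast
qed (use assms in auto)

text \<open>The points \<open>b 0 < a 0\<close>, \<open>a 0 + w < b 1 < a 1\<close>, ... guide the
  reductions: two suspension steps use up one pair and raise the lower bound for \<open>A\<close> by
  \<open>w\<close>, while the next pair shows that something is left. At the end no room remains for
  \<open>B\<close>, and the last \<open>a\<close> makes the remaining simplex on \<open>A\<close>
  nonempty.\<close>

lemma two_clique_chain_contractible:
  assumes "two_clique E A B c w" "\<And>a. a \<in> A \<Longrightarrow> s \<le> c a"
    "\<And>x. x \<in> A \<union> B \<Longrightarrow> c x < R" "R \<le> s + real (Suc i) * w"
    and w: "0 \<le> w"
    and chain: "\<And>j. j \<le> i \<Longrightarrow> b j \<in> B \<and> a j \<in> A \<and> c (b j) < c (a j)"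
    "\<And>j. j < i \<Longrightarrow> c (a j) + w < c (b (Suc j))"
  shows "contractible_space (clq_top E (A \<union> B))"
  using assms(1-4) chain
proof (induction i arbitrary: A B s a b)
  case 0
  note p = 0
  have 00: "b 0 \<in> B" "a 0 \<in> A" "c (b 0) < c (a 0)" using p(5)[of 0] by auto
  show ?case
  proof (rule two_clique_step_contractible[OF p(1)])
    fix \<alpha> \<beta> assume ab: "\<alpha> \<in> A" "\<beta> \<in> B" "\<And>a. a \<in> A \<Longrightarrow> c \<alpha> \<le> c a" "\<And>b. b \<in> B \<Longrightarrow> c \<beta> \<le> c b"
    \<comment> \<open>The bound \<open>R \<le> s + w\<close> leaves no room for points of
      \<open>B\<close> beyond the window of \<alpha>.\<close>
    have B: "{b \<in> B. c \<alpha> + w < c b} = {}"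
      using p(2)[OF ab(1)] p(3,4) by fastforce
    have a: "a 0 \<in> {a \<in> A. c \<beta> < c a}" using 00 ab(4)[OF 00(1)] by auto
    then show "{a \<in> A. c \<beta> < c a} \<union> {b \<in> B. c \<alpha> + w < c b} \<noteq> {} \<and>
      contractible_space (clq_top E ({a \<in> A. c \<beta> < c a} \<union> {b \<in> B. c \<alpha> + w < c b}))"
      unfolding B Un_empty_right
      by (intro conjI contractible_cone[OF _ a]) (use two_cliqueD(1,6)[OF p(1)] 00(2) in auto)
  qed (use 00 in auto)
next
  case (Suc i)
  note p = Suc.prems
  have 00: "b 0 \<in> B" "a 0 \<in> A" "c (b 0) < c (a 0)" using p(5)[of 0] by auto
  show ?case
  proof (rule two_clique_step_contractible[OF p(1)])
    fix \<alpha> \<beta> assume ab: "\<alpha> \<in> A" "\<beta> \<in> B" "\<And>a. a \<in> A \<Longrightarrow> c \<alpha> \<le> c a" "\<And>b. b \<in> B \<Longrightarrow> c \<beta> \<le> c b"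
    let ?A = "{a \<in> A. c \<beta> < c a}" and ?B = "{b \<in> B. c \<alpha> + w < c b}"
    have a0: "a 0 \<in> ?A" using 00 ab(4)[OF 00(1)] by auto
    have tc': "two_clique E ?A ?B c w" by (rule two_clique_subset[OF p(1)]) auto
    have "contractible_space (clq_top E (?A \<union> ?B))"
    proof (rule two_clique_step_contractible[OF tc'])
      fix \<alpha>' \<beta>' assume ab': "\<alpha>' \<in> ?A" "\<beta>' \<in> ?B" "\<And>a. a \<in> ?A \<Longrightarrow> c \<alpha>' \<le> c a" "\<And>b. b \<in> ?B \<Longrightarrow> c \<beta>' \<le> c b"
      let ?A' = "{a \<in> ?A. c \<beta>' < c a}" and ?B' = "{b \<in> ?B. c \<alpha>' + w < c b}"
      have a0': "c \<alpha>' \<le> c (a 0)" using ab'(3)[OF a0] .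
      \<comment> \<open>The later pairs lie beyond both windows; they survive the two reductions and
        serve the induction with indices shifted by one.\<close>
      have ab0: "c (a 0) + w < c (b (Suc j)) \<and> c \<alpha> + w < c (b (Suc j))" if "j \<le> i" for j
        using that
      proof (induction j)
        case 0
        then show ?case using p(6)[of 0] ab(3)[OF 00(2)] by auto
      next
        case (Suc j)
        then show ?case using p(5)[of "Suc j"] p(6)[of "Suc j"] ab(3)[of "a (Suc j)"] ab(3)[OF 00(2)] w by auto
      qed
      have bB: "b (Suc j) \<in> ?B'" if "j \<le> i" for j
        using ab0[OF that] p(5)[of "Suc j"] that a0' by auto
      have b1: "c \<beta>' \<le> c (b (Suc j))" if "j \<le> i" for j
        using ab'(4)[of "b (Suc j)"] bB[OF that] by auto
      have aA: "a (Suc j) \<in> ?A'" if "j \<le> i" for j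
        using b1[OF that] p(5)[of "Suc j"] that ab(4)[of "b (Suc j)"] by auto
      have "contractible_space (clq_top E (?A' \<union> ?B'))"
      proof (rule Suc.IH)
        show "two_clique E ?A' ?B' c w" by (rule two_clique_subset[OF p(1)]) auto
        show "s + w \<le> c x" if "x \<in> ?A'" for x
          using that ab'(2) p(2)[OF ab(1)] by auto
        show "R \<le> (s + w) + real (Suc i) * w" using p(4) by (simp add: algebra_simps)
        show "b (Suc j) \<in> ?B' \<and> a (Suc j) \<in> ?A' \<and> c (b (Suc j)) < c (a (Suc j))" if "j \<le> i" for j
          using bB[OF that] aA[OF that] p(5)[of "Suc j"] that by auto
        show "c (a (Suc j)) + w < c (b (Suc (Suc j)))" if "j < i" for j using p(6)[of "Suc j"] that by auto
      qed (use p(3) in auto)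
      then show "?A' \<union> ?B' \<noteq> {} \<and> contractible_space (clq_top E (?A' \<union> ?B'))" using aA[of 0] by blast
    qed (use a0 in blast)
    then show "?A \<union> ?B \<noteq> {} \<and> contractible_space (clq_top E (?A \<union> ?B))" using a0 by blast
  qed (use 00 in auto)
qed

section \<open>Vietoris--Rips complexes of circle points\<close>

lemma cdist_eq:
  assumes "x \<in> {0..<1}" "y \<in> {0..<1}"
  shows "cdist x y = (if x \<le> y then y - x else y - x + 1)"
proof (cases "x \<le> y")
  case True
  then have "\<lfloor>y - x\<rfloor> = 0" using assms by (intro floor_unique) auto
  then show ?thesis using True by (simp add: cdist_def)
next
  case False
  then have "\<lfloor>y - x\<rfloor> = -1" using assms by (intro floor_unique) auto
  then show ?thesis using False by (simp add: cdist_def)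
qed

lemma cdist_unique:
  assumes "y - x = s + of_int n" "0 \<le> s" "s < 1"
  shows "cdist x y = s"
proof -
  have "\<lfloor>y - x\<rfloor> = n" using assms by (intro floor_unique) auto
  then show ?thesis using assms by (simp add: cdist_def)
qed

lemma cdist_range: "0 \<le> cdist x y" "cdist x y < 1"
  unfolding cdist_def by linarith+

definition near :: "real \<Rightarrow> real \<Rightarrow> real \<Rightarrow> bool" where
  "near r x y \<longleftrightarrow> gdist x y < r"

lemma near_refl: "0 < r \<Longrightarrow> near r x x"
  by (simp add: near_def gdist_def cdist_def)

lemma near_sym: "near r x y \<Longrightarrow> near r y x"
  by (simp add: near_def gdist_def min.commute)

lemma clq_cong:
  assumes "\<And>x y. x \<in> V \<Longrightarrow> y \<in> V \<Longrightarrow> E x y \<longleftrightarrow> F x y"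
  shows "clq_top E V = clq_top F V"
proof -
  have "(\<forall>x. x \<notin> V \<longrightarrow> f x = 0) \<Longrightarrow>
      (\<forall>x y. f x \<noteq> 0 \<longrightarrow> f y \<noteq> 0 \<longrightarrow> E x y) \<longleftrightarrow> (\<forall>x y. f x \<noteq> 0 \<longrightarrow> f y \<noteq> 0 \<longrightarrow> F x y)" for f :: "'a \<Rightarrow> real"
    using assms by metis
  then have "clq E V = clq F V" unfolding clq_def by blast
  then show ?thesis by (simp add: clq_top_def)
qed

lemma VR_top_strict_eq:
  assumes X: "finite X"
  shows "VR_top True X r = clq_top (near r) X"
proof -
  have "f \<in> vr_realization True X r \<longleftrightarrow> f \<in> clq (near r) X" for f
  proof
    assume f: "f \<in> vr_realization True X r"
    then have f1: "\<forall>x. 0 \<le> f x" "{x. f x \<noteq> 0} \<subseteq> X" "sum f {x. f x \<noteq> 0} = 1"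
        "\<forall>x\<in>{x. f x \<noteq> 0}. \<forall>y\<in>{x. f x \<noteq> 0}. gdist x y < r"
      by (auto simp: vr_realization_def vr_face_def)
    have "sum f X = sum f {x. f x \<noteq> 0}"
      using X f1 by (intro sum.mono_neutral_right) auto
    then show "f \<in> clq (near r) X" using f1 by (auto simp: clq_def near_def)
  next
    assume f: "f \<in> clq (near r) X"
    have sub: "{x. f x \<noteq> 0} \<subseteq> X" using clqD(2)[OF f] by auto
    have s: "sum f X = sum f {x. f x \<noteq> 0}"
      using X sub by (intro sum.mono_neutral_right) auto
    have "{x. f x \<noteq> 0} \<noteq> {}" using s clqD(4)[OF f] by (metis sum.empty zero_neq_one)
    then show "f \<in> vr_realization True X r"
      using s sub X clqD[OF f] finite_subset[OF sub X]
      by (auto simp: vr_realization_def vr_face_def near_def)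
  qed
  then have "vr_realization True X r = clq (near r) X" by blast
  then show ?thesis by (simp add: VR_top_def clq_top_def)
qed

text \<open>Finitely many distances occur, so \<open>r'\<close> can be put between \<open>r\<close>
  and the next larger one. Adding \<open>b\<close> to the candidates keeps \<open>r'\<close> below a
  prescribed bound.\<close>

lemma strict_radius:
  assumes "finite X" "r < b"
  obtains r' where "r < r'" "r' < b" "\<And>x y. x \<in> X \<Longrightarrow> y \<in> X \<Longrightarrow> cdist x y \<le> r \<longleftrightarrow> cdist x y < r'"
proof -
  let ?D = "insert b {d \<in> (\<lambda>(x, y). cdist x y) ` (X \<times> X). r < d}"
  have fin: "finite ?D" using assms by auto
  have "r < Min ?D" using assms fin by (subst Min_gr_iff) auto
  then obtain r' where r': "r < r'" "r' < Min ?D" using dense by blast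
  show ?thesis
  proof (rule that[OF r'(1)])
    have "Min ?D \<le> b" using fin by (intro Min_le) auto
    then show "r' < b" using r' by linarith
    fix x y assume xy: "x \<in> X" "y \<in> X"
    have "Min ?D \<le> cdist x y" if "r < cdist x y" using fin xy that by (intro Min_le) auto
    then show "cdist x y \<le> r \<longleftrightarrow> cdist x y < r'" using r' by force
  qed
qed

lemma vr_strict_radius:
  assumes X: "finite X" and r': "\<And>x y. x \<in> X \<Longrightarrow> y \<in> X \<Longrightarrow> cdist x y \<le> r \<longleftrightarrow> cdist x y < r'"
  shows "VR_top False X r = VR_top True X r'" "wf False X r = wf True X r'"
proof -
  have "gdist x y \<le> r \<longleftrightarrow> gdist x y < r'" if "x \<in> X" "y \<in> X" for x y
    using r'[OF that] r'[OF that(2,1)] by (auto simp: gdist_def min_le_iff_disj min_less_iff_disj)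
  then have "vr_face False X r S \<longleftrightarrow> vr_face True X r' S" for S
    unfolding vr_face_def by (auto simp: subset_iff)
  then have "vr_realization False X r = vr_realization True X r'" by (simp add: vr_realization_def)
  then show "VR_top False X r = VR_top True X r'" by (simp add: VR_top_def)
  have "vr_edge False X r i j \<longleftrightarrow> vr_edge True X r' i j" for i j
    using X r' nth_mem[of _ "sorted_list_of_set X"] by (auto simp: vr_edge_def Let_def)
  then have "vr_edge False X r = vr_edge True X r'" by blast
  then show "wf False X r = wf True X r'" by (simp add: wf_def)
qed

text \<open>Clockwise distance from \<open>v\<close> for neighbours after \<open>v\<close>, and from
  the point at distance \<open>r\<close> before \<open>v\<close> for those preceding it, so that
  both sides take values between 0 and \<open>r\<close>.\<close>

definition link_coord :: "real \<Rightarrow> real \<Rightarrow> real \<Rightarrow> real" where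
  "link_coord r v u = (if cdist v u < r then cdist v u else r - cdist u v)"

text \<open>For \<open>a\<close> before and \<open>b\<close> after \<open>v\<close> the clockwise
  distance from \<open>a\<close> to \<open>b\<close> is the sum of their distances to
  \<open>v\<close>. Being at least \<open>r\<close> apart both ways round then reads
  \<open>c a \<le> c b\<close> and \<open>c b \<le> c a + (1 - 2 * r)\<close> in link
  coordinates.\<close>

lemma link_two_clique:
  assumes X: "finite X" "X \<subseteq> {0..<1}" "v \<in> {0..<1}" "v \<notin> X" and r: "0 < r" "r \<le> 1/2"
  defines "A \<equiv> {u \<in> X. cdist u v < r}" and "B \<equiv> {u \<in> X. cdist v u < r}"
  shows "two_clique (near r) A B (link_coord r v) (1 - 2 * r)"
    and "link_set (near r) (insert v X) v = A \<union> B"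
    and "\<And>a. a \<in> A \<Longrightarrow> link_coord r v a = r - cdist a v"
    and "\<And>b. b \<in> B \<Longrightarrow> link_coord r v b = cdist v b"
    and "\<And>u. u \<in> A \<union> B \<Longrightarrow> 0 < link_coord r v u \<and> link_coord r v u < r"
proof -
  have uv: "cdist u v + cdist v u = 1" "0 < cdist u v" "0 < cdist v u" "u \<in> {0..<1}" if "u \<in> X" for u
  proof -
    have u: "u \<in> {0..<1}" "u \<noteq> v" using X that by auto
    then show "cdist u v + cdist v u = 1" "0 < cdist u v" "0 < cdist v u" "u \<in> {0..<1}"
      using cdist_eq[OF u(1) X(3)] cdist_eq[OF X(3) u(1)] X(3) by auto
  qed
  show cA: "link_coord r v a = r - cdist a v" if "a \<in> A" for a
    using that uv[of a] r by (auto simp: A_def link_coord_def)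
  show cB: "link_coord r v b = cdist v b" if "b \<in> B" for b
    using that by (auto simp: B_def link_coord_def)
  show "0 < link_coord r v u \<and> link_coord r v u < r" if "u \<in> A \<union> B" for u
    using that cA[of u] cB[of u] uv[of u] by (auto simp: A_def B_def)
  show "link_set (near r) (insert v X) v = A \<union> B"
    using X(4) by (auto simp: link_set_def A_def B_def near_def gdist_def min_less_iff_disj)
  show "two_clique (near r) A B (link_coord r v) (1 - 2 * r)"
    unfolding two_clique_def
  proof (intro conjI allI ballI impI)
    show "finite A" "finite B" using X by (auto simp: A_def B_def)
    show "A \<inter> B = {}" using uv r by (fastforce simp: A_def B_def)
    show "near r x x" for x using near_refl r by blast
    show "near r x y \<Longrightarrow> near r y x" for x y by (rule near_sym)
    show "near r x y" if "x \<in> A" "y \<in> A" for x y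
    proof -
      have x: "x \<in> {0..<1}" "cdist x v < r" and y: "y \<in> {0..<1}" "cdist y v < r"
        using that uv by (auto simp: A_def)
      show ?thesis
        using x y X(3) r unfolding near_def gdist_def cdist_eq[OF x(1) y(1)] cdist_eq[OF y(1) x(1)]
          cdist_eq[OF x(1) X(3)] cdist_eq[OF y(1) X(3)]
        by (auto split: if_splits)
    qed
    show "near r x y" if "x \<in> B" "y \<in> B" for x y
    proof -
      have x: "x \<in> {0..<1}" "cdist v x < r" and y: "y \<in> {0..<1}" "cdist v y < r"
        using that uv by (auto simp: B_def)
      show ?thesis
        using x y X(3) r unfolding near_def gdist_def cdist_eq[OF x(1) y(1)] cdist_eq[OF y(1) x(1)]
          cdist_eq[OF X(3) x(1)] cdist_eq[OF X(3) y(1)]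
        by (auto split: if_splits)
    qed
    show "near r a b \<longleftrightarrow> \<not> (link_coord r v a \<le> link_coord r v b \<and> link_coord r v b \<le> link_coord r v a + (1 - 2 * r))"
      if ab: "a \<in> A" "b \<in> B" for a b
    proof -
      have a: "a \<in> X" "a \<in> {0..<1}" "cdist a v < r" and b: "b \<in> X" "b \<in> {0..<1}" "cdist v b < r"
        using that uv by (auto simp: A_def B_def)
      have d: "cdist a b = cdist a v + cdist v b" "cdist b a = 1 - (cdist a v + cdist v b)"
        using a b X(3) r uv(2,3)[OF a(1)] uv(2,3)[OF b(1)]
        unfolding cdist_eq[OF a(2) X(3)] cdist_eq[OF X(3) b(2)] cdist_eq[OF b(2) a(2)] cdist_eq[OF a(2) b(2)]
        by (auto split: if_splits)
      show ?thesis unfolding near_def gdist_def cA[OF ab(1)] cB[OF ab(2)] d by auto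
    qed
  qed
qed

lemma link_bound_even: "link_bound w (2 * l) s t = t + real l * w"
  by (induction l arbitrary: s t) (auto simp: algebra_simps)

text \<open>Delete the last point \<open>v\<close> before the gap. Its clockwise neighbours have
  coordinate at least \<gamma>, and \<open>2 * l\<close> suspension steps raise this bound to
  \<open>\<gamma> + l * (1 - 2 * r) \<ge> r\<close>, above all link coordinates. The gap survives
  the deletion, so induction on \<open>X\<close> applies.\<close>

lemma gap_acyclic:
  assumes "finite X" "X \<subseteq> {0..<1}" and p: "p \<in> {0..<1}"
    and "\<And>x. x \<in> X \<Longrightarrow> \<not> (0 < cdist p x \<and> cdist p x < \<gamma>)"
    and r: "0 < r" "r \<le> 1/2" "r \<le> \<gamma> + real l * (1 - 2 * r)"
  shows "trivial_group (reduced_homology_group (int (2 * l + 1)) (clq_top (near r) X))"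
  using assms(1,2,4)
proof (induction X rule: finite_psubset_induct)
  case (psubset X)
  show ?case
  proof (cases "X = {}")
    case True
    then show ?thesis by (simp add: trivial_reduced_homology_group_empty)
  next
    case False
    obtain v where v: "v \<in> X" "\<And>x. x \<in> X \<Longrightarrow> cdist v p \<le> cdist x p"
      using finite_minimizer[OF psubset.hyps False, where c = "\<lambda>x. cdist x p"] by metis
    let ?X = "X - {v}"
    have v01: "v \<in> {0..<1}" using v psubset.prems by auto
    \<comment> \<open>As \<open>v\<close> is the last point of \<open>X\<close> up to
      \<open>p\<close>, the next point clockwise comes only after the gap.\<close>
    have gap: "\<gamma> \<le> cdist v u" if "u \<in> ?X" for u
    proof -
      have u: "u \<in> {0..<1}" "u \<noteq> v" "cdist v p \<le> cdist u p" "\<not> (0 < cdist p u \<and> cdist p u < \<gamma>)"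
        using that psubset.prems v(2) by auto
      show ?thesis
        using u v01 p unfolding cdist_eq[OF v01 u(1)] cdist_eq[OF v01 p] cdist_eq[OF u(1) p] cdist_eq[OF p u(1)]
        by (auto split: if_splits)
    qed
    note tc = link_two_clique[of ?X v r]
    let ?A = "{u \<in> ?X. cdist u v < r}" and ?B = "{u \<in> ?X. cdist v u < r}"
    have h: "finite ?X" "?X \<subseteq> {0..<1}" "v \<notin> ?X" using psubset by auto
    have ins: "insert v ?X = X" using v by auto
    have "trivial_group (reduced_homology_group (int (2 * l)) (clq_top (near r) (?A \<union> ?B)))"
    proof (rule two_clique_acyclic[OF tc(1)[OF h(1,2) v01 h(3) r(1,2)]])
      show "0 \<le> link_coord r v a" if "a \<in> ?A" for a
        using tc(5)[OF h(1,2) v01 h(3) r(1,2), of a] that by auto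
      show "\<gamma> \<le> link_coord r v b" if "b \<in> ?B" for b
        using gap[of b] tc(4)[OF h(1,2) v01 h(3) r(1,2), of b] that by auto
      show "link_coord r v u < r" if "u \<in> ?A \<union> ?B" for u
        using tc(5)[OF h(1,2) v01 h(3) r(1,2), of u] that by auto
      show "r \<le> link_bound (1 - 2 * r) (2 * l) 0 \<gamma>" using r(3) by (simp add: link_bound_even)
    qed
    then have 2: "trivial_group (reduced_homology_group (int (2 * l + 1) - 1) (clq_top (near r) (link_set (near r) X v)))"
      using tc(2)[OF h(1,2) v01 h(3) r(1,2)] unfolding ins by simp
    have 1: "trivial_group (reduced_homology_group (int (2 * l + 1)) (clq_top (near r) ?X))"
      by (rule psubset.IH) (use v psubset.prems in auto)
    show ?thesis
      by (rule reduced_homology_vertex_removal[OF psubset.hyps v(1) near_refl[OF r(1)] near_sym _ 1 2]) simp_all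
  qed
qed

lemma gap_not_sphere:
  assumes "finite X" "X \<subseteq> {0..<1}" "p \<in> {0..<1}"
    "\<And>x. x \<in> X \<Longrightarrow> \<not> (0 < cdist p x \<and> cdist p x < \<gamma>)"
    "0 < r" "r \<le> 1/2" "r \<le> \<gamma> + real l * (1 - 2 * r)"
  shows "\<not> clq_top (near r) X homotopy_equivalent_space nsphere (2 * l + 1)"
proof
  assume "clq_top (near r) X homotopy_equivalent_space nsphere (2 * l + 1)"
  note iso = homotopy_equivalent_space_imp_isomorphic_reduced_homology_groups[OF this, of "int (2 * l + 1)"]
  have "trivial_group (reduced_homology_group (int (2 * l + 1)) (clq_top (near r) X))"
    by (rule gap_acyclic[OF assms(1-3) _ assms(5-7)]) (use assms(4) in blast)
  then have "trivial_group (reduced_homology_group (int (2 * l + 1)) (nsphere (2 * l + 1)))"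
    using isomorphic_group_triviality[OF iso] by simp
  then show False by (simp only: trivial_reduced_homology_group_nsphere)
qed

section \<open>Dense sets give spheres\<close>

text \<open>The hypothesis of \<open>two_clique_chain_contractible\<close> for the link of every
  point \<open>v\<close> outside \<open>X\<close>, in link coordinates, with \<open>b j\<close>
  after and \<open>a j\<close> before \<open>v\<close>. Asking only for the existence of points in
  \<open>X\<close> makes it stable under adding points.\<close>

definition filled :: "nat \<Rightarrow> real \<Rightarrow> real set \<Rightarrow> bool" where
  "filled l r X \<longleftrightarrow> (\<forall>v\<in>{0..<1}. v \<notin> X \<longrightarrow>
     (\<exists>b a. (\<forall>j\<le>l. b j \<in> X \<and> a j \<in> X \<and> cdist v (b j) < r \<and> cdist (a j) v < r \<and>
                cdist v (b j) < r - cdist (a j) v) \<and>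
            (\<forall>j<l. r - cdist (a j) v + (1 - 2 * r) < cdist v (b (Suc j)))))"

lemma filled_mono:
  assumes "filled l r X" "X \<subseteq> Y"
  shows "filled l r Y"
  unfolding filled_def
proof (intro ballI impI)
  fix v :: real assume v: "v \<in> {0..<1}" "v \<notin> Y"
  then have v': "v \<notin> X" using assms(2) by blast
  obtain b a where H: "(\<forall>j\<le>l. b j \<in> X \<and> a j \<in> X \<and> cdist v (b j) < r \<and> cdist (a j) v < r \<and>
                cdist v (b j) < r - cdist (a j) v) \<and>
            (\<forall>j<l. r - cdist (a j) v + (1 - 2 * r) < cdist v (b (Suc j)))"
    using assms(1)[unfolded filled_def, THEN bspec, OF v(1), THEN mp, OF v'] by (elim exE)
  show "\<exists>b a. (\<forall>j\<le>l. b j \<in> Y \<and> a j \<in> Y \<and> cdist v (b j) < r \<and> cdist (a j) v < r \<and>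
                cdist v (b j) < r - cdist (a j) v) \<and>
            (\<forall>j<l. r - cdist (a j) v + (1 - 2 * r) < cdist v (b (Suc j)))"
    by (rule exI[of _ b], rule exI[of _ a]) (use H assms(2) in auto)
qed

text \<open>The chain makes the link of \<open>v\<close> contractible. The hypothesis
  \<open>r \<le> (l + 1) * (1 - 2 * r)\<close>, i.e. \<open>r \<le> (l + 1) / (2 * l + 3)\<close>,
  is the bound on coordinates that ends the chain argument.\<close>

lemma filled_insert_equivalent:
  assumes X: "finite X" "X \<subseteq> {0..<1}" "filled l r X" and v: "v \<in> {0..<1}"
    and r: "0 < r" "r \<le> real (l + 1) * (1 - 2 * r)"
  shows "clq_top (near r) (insert v X) homotopy_equivalent_space clq_top (near r) X"
proof (cases "v \<in> X")
  case True
  then show ?thesis by (simp add: insert_absorb homotopy_equivalent_space_refl)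
next
  case False
  have w: "0 < 1 - 2 * r"
  proof (rule ccontr)
    assume "\<not> 0 < 1 - 2 * r"
    then have "real (l + 1) * (1 - 2 * r) \<le> 0" by (intro mult_nonneg_nonpos) auto
    then show False using r by linarith
  qed
  then have r2: "r \<le> 1/2" by simp
  note tc = link_two_clique[OF X(1,2) v False r(1) r2]
  let ?A = "{u \<in> X. cdist u v < r}" and ?B = "{u \<in> X. cdist v u < r}"
  obtain b a where H: "(\<forall>j\<le>l. b j \<in> X \<and> a j \<in> X \<and> cdist v (b j) < r \<and> cdist (a j) v < r \<and>
                cdist v (b j) < r - cdist (a j) v) \<and>
            (\<forall>j<l. r - cdist (a j) v + (1 - 2 * r) < cdist v (b (Suc j)))"
    using X(3)[unfolded filled_def, THEN bspec, OF v, THEN mp, OF False] by (elim exE)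
  have ba: "b j \<in> X \<and> a j \<in> X \<and> cdist v (b j) < r \<and> cdist (a j) v < r \<and>
                cdist v (b j) < r - cdist (a j) v" if "j \<le> l" for j
    using H that by blast
  have ab: "r - cdist (a j) v + (1 - 2 * r) < cdist v (b (Suc j))" if "j < l" for j
    using H that by blast
  have mem: "b j \<in> ?B" "a j \<in> ?A" if "j \<le> l" for j using ba[OF that] by auto
  have "contractible_space (clq_top (near r) (?A \<union> ?B))"
  proof (rule two_clique_chain_contractible[OF tc(1)])
    show "0 \<le> link_coord r v a" if "a \<in> ?A" for a using tc(5)[of a] that by auto
    show "link_coord r v u < r" if "u \<in> ?A \<union> ?B" for u using tc(5)[of u] that by auto
    show "r \<le> 0 + real (Suc l) * (1 - 2 * r)" using r(2) by simp
    show "b j \<in> ?B \<and> a j \<in> ?A \<and> link_coord r v (b j) < link_coord r v (a j)" if "j \<le> l" for j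
      using mem[OF that] tc(3)[of "a j"] tc(4)[of "b j"] ba[OF that] by auto
    show "link_coord r v (a j) + (1 - 2 * r) < link_coord r v (b (Suc j))" if "j < l" for j
      using mem(2)[of j] mem(1)[of "Suc j"] tc(3)[of "a j"] tc(4)[of "b (Suc j)"] ab[OF that] that by auto
  qed (use w in auto)
  moreover have "?A \<union> ?B \<noteq> {}" using mem(1)[of 0] by blast
  ultimately have "clq_top (near r) (insert v X) homotopy_equivalent_space clq_top (near r) (insert v X - {v})"
    using contractible_link_equivalent[of "insert v X" v "near r", OF _ _ near_refl[OF r(1)] near_sym]
      X(1) tc(2) by simp
  then show ?thesis using False by simp
qed

lemma filled_union_equivalent:
  assumes "finite F" "F \<subseteq> {0..<1}" "finite X" "X \<subseteq> {0..<1}" "filled l r X"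
    "0 < r" "r \<le> real (l + 1) * (1 - 2 * r)"
  shows "clq_top (near r) (F \<union> X) homotopy_equivalent_space clq_top (near r) X"
  using assms(1,2)
proof (induction F rule: finite_induct)
  case empty
  then show ?case by (simp add: homotopy_equivalent_space_refl)
next
  case (insert v F)
  have "clq_top (near r) (insert v (F \<union> X)) homotopy_equivalent_space clq_top (near r) (F \<union> X)"
    by (rule filled_insert_equivalent[where l = l])
      (use insert assms filled_mono[OF assms(5), of "F \<union> X"] in auto)
  also have "clq_top (near r) (F \<union> X) homotopy_equivalent_space clq_top (near r) X"
    using insert by auto
  finally show ?case by simp
qed

text \<open>Both sets are compared with their union, reached by inserting the points of one into the
  other.\<close>

lemma filled_equivalent:
  assumes "finite X" "X \<subseteq> {0..<1}" "filled l r X" "finite Y" "Y \<subseteq> {0..<1}" "filled l r Y"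
    "0 < r" "r \<le> real (l + 1) * (1 - 2 * r)"
  shows "clq_top (near r) X homotopy_equivalent_space clq_top (near r) Y"
proof -
  have "clq_top (near r) (X \<union> Y) homotopy_equivalent_space clq_top (near r) Y"
    by (rule filled_union_equivalent) (use assms in auto)
  moreover have "clq_top (near r) (Y \<union> X) homotopy_equivalent_space clq_top (near r) X"
    by (rule filled_union_equivalent) (use assms in auto)
  ultimately show ?thesis
    by (metis Un_commute homotopy_equivalent_space_sym homotopy_eqv_trans)
qed

definition circle_dense :: "real \<Rightarrow> real set \<Rightarrow> bool" where
  "circle_dense g X \<longleftrightarrow> (\<forall>p\<in>{0..<1}. \<exists>x\<in>X. 0 < cdist p x \<and> cdist p x < g)"

lemma circle_dense_offset:
  assumes d: "circle_dense g X" and v: "v \<in> {0..<1}" and s: "0 \<le> s" "s + g \<le> 1" "0 < g"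
  shows "\<exists>x\<in>X. s < cdist v x \<and> cdist v x < s + g"
proof -
  define e :: int where "e = (if v + s < 1 then 0 else 1)"
  define p where "p = v + s - of_int e"
  have "p \<in> {0..<1}" using v s by (auto simp: p_def e_def)
  then obtain x where x: "x \<in> X" "0 < cdist p x" "cdist p x < g"
    using d unfolding circle_dense_def by blast
  have "cdist v x = s + cdist p x"
  proof (rule cdist_unique)
    show "x - v = s + cdist p x + of_int (\<lfloor>x - p\<rfloor> - e)" by (simp add: cdist_def p_def)
  qed (use x s in auto)
  then show ?thesis using x by (intro bexI[of _ x]) auto
qed

text \<open>The chain is picked greedily: each point is taken from an arc of length \<open>g\<close>
  that starts where its inequality begins to hold. The \<open>2 * l + 2\<close> picks cost less than
  \<open>g\<close> each and the \<open>l\<close> windows cost \<open>1 - 2 * r\<close> each;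
  together they stay within \<open>r\<close>.\<close>

lemma circle_dense_filled:
  assumes d: "circle_dense g X" and X: "X \<subseteq> {0..<1}" and g: "0 < g"
    and r: "0 < r" "r < 1/2" and gr: "real (2 * l + 2) * g + real l * (1 - 2 * r) \<le> r"
  shows "filled l r X"
  unfolding filled_def
proof (intro ballI impI)
  fix v :: real assume v: "v \<in> {0..<1}" "v \<notin> X"
  define pk where "pk s = (SOME x. x \<in> X \<and> s < cdist v x \<and> cdist v x < s + g)" for s
  have pk: "pk s \<in> X" "s < cdist v (pk s)" "cdist v (pk s) < s + g" if "0 \<le> s" "s + g \<le> 1" for s
  proof -
    have "\<exists>x. x \<in> X \<and> s < cdist v x \<and> cdist v x < s + g"
      using circle_dense_offset[OF d v(1) that g] by blast
    from someI_ex[OF this] show "pk s \<in> X" "s < cdist v (pk s)" "cdist v (pk s) < s + g"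
      by (auto simp: pk_def)
  qed
  \<comment> \<open>Since \<open>cdist a v = 1 - cdist v a\<close>, the link coordinate of
    \<open>a\<close> is \<open>cdist v a + r - 1\<close>. So \<open>a\<close> is sought beyond
    \<open>cdist v b + 1 - r\<close>, and the next \<open>b\<close> beyond
    \<open>cdist v a - r\<close>.\<close>
  define b where "b = rec_nat (pk 0) (\<lambda>j y. pk (cdist v (pk (cdist v y + 1 - r)) - r))"
  define a where "a j = pk (cdist v (b j) + 1 - r)" for j
  have b0: "b 0 = pk 0" and bS: "b (Suc j) = pk (cdist v (a j) - r)" for j
    by (simp_all add: b_def a_def)
  define w where "w = 1 - 2 * r"
  have w: "0 < w" using r by (simp add: w_def)
  have jl: "real j * w + real (2 * j + 2) * g \<le> r" if "j \<le> l" for j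
  proof -
    have "real j * w + real (2 * j + 2) * g \<le> real l * w + real (2 * l + 2) * g"
      using that w g by (intro add_mono mult_right_mono) auto
    then show ?thesis using gr by (simp add: w_def)
  qed
  have "2 * g \<le> r" using jl[of 0] by simp
  have av: "cdist (a' ::real) v = 1 - cdist v a'" if "a' \<in> X" for a'
  proof -
    have a': "a' \<in> {0..<1}" "a' \<noteq> v" using that X v by auto
    then show ?thesis using cdist_eq[OF a'(1) v(1)] cdist_eq[OF v(1) a'(1)] by auto
  qed
  have A: "a j \<in> X" "cdist v (b j) + 1 - r < cdist v (a j)" "cdist v (a j) < cdist v (b j) + 1 - r + g"
    if "j \<le> l" "cdist v (b j) < real j * w + real (2 * j + 1) * g" for j
  proof -
    have "cdist v (b j) + 1 - r + g \<le> 1" using jl[OF that(1)] that(2) by (simp add: algebra_simps)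
    moreover have "0 \<le> cdist v (b j) + 1 - r" using cdist_range[of v "b j"] r by linarith
    ultimately show "a j \<in> X" "cdist v (b j) + 1 - r < cdist v (a j)" "cdist v (a j) < cdist v (b j) + 1 - r + g"
      using pk[of "cdist v (b j) + 1 - r"] by (auto simp: a_def)
  qed
  have B': "cdist v (a j) - r < cdist v (b (Suc j)) \<and> cdist v (b (Suc j)) < cdist v (a j) - r + g \<and> b (Suc j) \<in> X"
    if "j \<le> l" "cdist v (b j) < real j * w + real (2 * j + 1) * g" for j
  proof -
    have "0 \<le> cdist v (a j) - r" using A(2)[OF that] cdist_range[of v "b j"] r by linarith
    moreover have "cdist v (a j) - r + g \<le> 1" using cdist_range[of v "a j"] \<open>2 * g \<le> r\<close> g by linarith
    ultimately show ?thesis using pk[of "cdist v (a j) - r"] by (auto simp: bS)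
  qed
  have B: "b j \<in> X \<and> cdist v (b j) < real j * w + real (2 * j + 1) * g" if "j \<le> l" for j
    using that
  proof (induction j)
    case 0
    then show ?case using pk[of 0] \<open>2 * g \<le> r\<close> r g by (auto simp: b0)
  next
    case (Suc j)
    then have IH: "j \<le> l" "cdist v (b j) < real j * w + real (2 * j + 1) * g" by auto
    have "cdist v (b (Suc j)) < cdist v (b j) + w + 2 * g"
      using B'[OF IH] A(3)[OF IH] by (simp add: w_def)
    also have "\<dots> < real (Suc j) * w + real (2 * Suc j + 1) * g"
      using IH(2) by (simp add: algebra_simps)
    finally show ?case using B'[OF IH] by auto
  qed
  show "\<exists>b a. (\<forall>j\<le>l. b j \<in> X \<and> a j \<in> X \<and> cdist v (b j) < r \<and> cdist (a j) v < r \<and>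
                cdist v (b j) < r - cdist (a j) v) \<and>
            (\<forall>j<l. r - cdist (a j) v + (1 - 2 * r) < cdist v (b (Suc j)))"
  proof (rule exI[of _ b], rule exI[of _ a], intro conjI allI impI)
    fix j assume j: "j \<le> l"
    note Bj = B[OF j]
    note Aj = A[OF j conjunct2[OF Bj]]
    show "b j \<in> X" using Bj by auto
    show "a j \<in> X" using Aj by auto
    show "cdist v (b j) < r" using Bj jl[OF j] g by (simp add: algebra_simps)
    show "cdist (a j) v < r" using Aj av[OF Aj(1)] cdist_range[of v "b j"] by simp
    show "cdist v (b j) < r - cdist (a j) v" using Aj av[OF Aj(1)] by simp
  next
    fix j assume "j < l"
    then have j: "j \<le> l" by simp
    note Bj = B[OF j]
    show "r - cdist (a j) v + (1 - 2 * r) < cdist v (b (Suc j))"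
      using B'[OF j conjunct2[OF Bj]] av[OF A(1)[OF j conjunct2[OF Bj]]] by simp
  qed
qed

section \<open>Regular polygons as test configurations\<close>

definition polygon :: "nat \<Rightarrow> real set" where
  "polygon m = (\<lambda>i. real i / real m) ` {..<m}"

lemma polygon_subset: "finite (polygon m)" "polygon m \<subseteq> {0..<1}"
  by (auto simp: polygon_def)

lemma polygon_mod: "0 < m \<Longrightarrow> real (q mod m) / real m \<in> polygon m"
  by (auto simp: polygon_def)

lemma real_mod_div: "0 < m \<Longrightarrow> real (q mod m) / real m = real q / real m - real (q div m)"
proof -
  assume "0 < m"
  have "real q = real (q mod m) + real m * real (q div m)"
    by (metis mod_mult_div_eq of_nat_add of_nat_mult)
  then show ?thesis using \<open>0 < m\<close> by (simp add: field_simps)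
qed

lemma polygon_floor:
  assumes "v \<in> {0..<1}" "0 < m"
  obtains k where "k < m" "real k / real m \<le> v" "v < real k / real m + 1 / real m"
proof -
  define k where "k = nat \<lfloor>v * real m\<rfloor>"
  have "0 \<le> v * real m" using assms by auto
  then have k: "real k \<le> v * real m" "v * real m < real k + 1" unfolding k_def by linarith+
  have "v * real m < real m" using assms by auto
  then have "k < m" using k by linarith
  moreover have "real k / real m \<le> v" "v < real k / real m + 1 / real m"
    using k assms by (simp_all add: field_simps)
  ultimately show ?thesis using that by blast
qed

lemma circle_dense_polygon:
  assumes "2 \<le> m" "1 / real m < g"
  shows "circle_dense g (polygon m)"
  unfolding circle_dense_def
proof
  fix p :: real assume p: "p \<in> {0..<1}"
  obtain k where k: "k < m" "real k / real m \<le> p" "p < real k / real m + 1 / real m"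
    using polygon_floor[OF p, of m] assms by auto
  let ?x = "real ((k + 1) mod m) / real m"
  have "1 / real m \<le> 1 / 2" using assms by (simp add: field_simps)
  have "cdist p ?x = real (k + 1) / real m - p"
  proof (rule cdist_unique)
    show "?x - p = real (k + 1) / real m - p + of_int (- int ((k + 1) div m))"
      using real_mod_div[of m "k + 1"] assms by simp
  next
    show "0 \<le> real (k + 1) / real m - p" using k by (simp add: add_divide_distrib)
    have "real (k + 1) / real m - p \<le> 1 / real m" using k by (simp add: add_divide_distrib)
    then show "real (k + 1) / real m - p < 1" using \<open>1 / real m \<le> 1 / 2\<close> by linarith
  qed
  then have "0 < cdist p ?x" "cdist p ?x < g" using k assms by (auto simp: add_divide_distrib)
  then show "\<exists>x\<in>polygon m. 0 < cdist p x \<and> cdist p x < g"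
    using polygon_mod[of m "k + 1"] assms by (intro bexI[of _ ?x]) auto
qed

text \<open>For \<open>v\<close> at offset \<theta> after vertex \<open>k\<close> and
  \<open>h = 1 / m\<close>, the coordinate of \<open>b j\<close> is
  \<open>(2 * j + 1) * h - \<theta>\<close> and that of \<open>a j\<close> is larger by
  \<open>e\<close>. The window has width \<open>2 * h - 2 * e\<close>, so \<open>b (Suc j)\<close>
  lies beyond the window of \<open>a j\<close> by \<open>e\<close>.\<close>

lemma polygon_filled:
  assumes m: "m = 4 * l + 4" and e: "0 < e" "real (2 * l + 3) * e \<le> 1 / real m"
    and r: "r = real (2 * l + 1) / real m + e"
  shows "filled l r (polygon m)"
  unfolding filled_def
proof (intro ballI impI)
  fix v :: real assume v: "v \<in> {0..<1}" "v \<notin> polygon m"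
  have m0: "0 < m" using m by simp
  obtain k where k: "k < m" "real k / real m \<le> v" "v < real k / real m + 1 / real m"
    using polygon_floor[OF v(1) m0] .
  define \<theta> where "\<theta> = v - real k / real m"
  define h where "h = 1 / real m"
  have "v \<noteq> real k / real m" using v(2) k(1) by (auto simp: polygon_def)
  then have \<theta>: "0 < \<theta>" "\<theta> < h" using k by (auto simp: \<theta>_def h_def)
  have h1: "real (4 * l + 4) * h = 1" using m m0 by (simp add: h_def)
  have h0: "0 < h" using m0 by (simp add: h_def)
  have rh: "r = real (2 * l + 1) * h + e" by (simp add: r h_def)
  define b where "b j = real ((k + 2 * j + 1) mod m) / real m" for j
  \<comment> \<open>Vertex \<open>k - 2 * l + 2 * j\<close> modulo \<open>m\<close>; the added
    \<open>m\<close> keeps the natural subtraction from truncating.\<close>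
  define a where "a j = real ((k + m - 2 * l + 2 * j) mod m) / real m" for j
  have bX: "b j \<in> polygon m" "a j \<in> polygon m" for j
    unfolding a_def b_def by (rule polygon_mod[OF m0])+
  have cb: "cdist v (b j) = real (2 * j + 1) * h - \<theta>" if "j \<le> l" for j
  proof (rule cdist_unique)
    show "b j - v = real (2 * j + 1) * h - \<theta> + of_int (- int ((k + 2 * j + 1) div m))"
      unfolding b_def using real_mod_div[OF m0, of "k + 2 * j + 1"] by (simp add: \<theta>_def h_def add_divide_distrib)
    have "1 * h \<le> real (2 * j + 1) * h" using h0 by (intro mult_right_mono) auto
    then show "0 \<le> real (2 * j + 1) * h - \<theta>" using \<theta> by linarith
    have "real (2 * j + 1) * h \<le> real (4 * l + 4) * h" using that h0 by (intro mult_right_mono) auto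
    then show "real (2 * j + 1) * h - \<theta> < 1" using h1 \<theta> by linarith
  qed
  have ca: "cdist (a j) v = \<theta> + real (2 * l - 2 * j) * h" if "j \<le> l" for j
  proof (rule cdist_unique)
    have "k + m - 2 * l + 2 * j + (2 * l - 2 * j) = k + m" using m that by simp
    then have "real (k + m - 2 * l + 2 * j) = real k + real m - real (2 * l - 2 * j)"
      by (metis add_diff_cancel_right' of_nat_add)
    then have "real (k + m - 2 * l + 2 * j) / real m = real k / real m + 1 - real (2 * l - 2 * j) / real m"
      using m0 by (simp add: add_divide_distrib diff_divide_distrib)
    then show "v - a j = \<theta> + real (2 * l - 2 * j) * h + of_int (int ((k + m - 2 * l + 2 * j) div m) - 1)"
      unfolding a_def using real_mod_div[OF m0, of "k + m - 2 * l + 2 * j"] by (simp add: \<theta>_def h_def)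
    show "0 \<le> \<theta> + real (2 * l - 2 * j) * h" using \<theta> h0 by simp
    have "real (2 * l - 2 * j) * h \<le> real (4 * l + 3) * h" using h0 by (intro mult_right_mono) auto
    then show "\<theta> + real (2 * l - 2 * j) * h < 1" using h1 \<theta> by (simp add: algebra_simps)
  qed
  show "\<exists>b a. (\<forall>j\<le>l. b j \<in> polygon m \<and> a j \<in> polygon m \<and> cdist v (b j) < r \<and> cdist (a j) v < r \<and>
                cdist v (b j) < r - cdist (a j) v) \<and>
            (\<forall>j<l. r - cdist (a j) v + (1 - 2 * r) < cdist v (b (Suc j)))"
  proof (rule exI[of _ b], rule exI[of _ a], intro conjI allI impI bX)
    fix j assume j: "j \<le> l"
    have jl: "real (2 * l - 2 * j) = 2 * real l - 2 * real j" using j by (simp add: of_nat_diff)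
    have jh: "real j * h \<le> real l * h" "0 \<le> real j * h" using j h0 by (auto intro: mult_right_mono)
    have jx: "real (2 * j + 1) * h = 2 * (real j * h) + h" "real (2 * l + 1) * h = 2 * (real l * h) + h"
      "(2 * real l - 2 * real j) * h = 2 * (real l * h) - 2 * (real j * h)" by (simp_all add: algebra_simps)
    show "cdist v (b j) < r" unfolding cb[OF j] rh jx(1,2) using jh \<theta> e(1) by linarith
    show "cdist (a j) v < r" unfolding ca[OF j] rh jl jx(2,3) using jh \<theta> e(1) by linarith
    show "cdist v (b j) < r - cdist (a j) v" unfolding ca[OF j] cb[OF j] rh jl using e by (simp add: algebra_simps)
  next
    fix j assume j: "j < l"
    have jl: "real (2 * l - 2 * j) = 2 * real l - 2 * real j" using j by (simp add: of_nat_diff)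
    show "r - cdist (a j) v + (1 - 2 * r) < cdist v (b (Suc j))"
      unfolding ca[OF less_imp_le[OF j]] cb[OF Suc_leI[OF j]] rh jl using e h1 by (simp add: algebra_simps)
  qed
qed

text \<open>\<open>P i\<close> and \<open>Q i\<close> are opposite vertices of a cross-polytope. One
  of \<open>f (P i)\<close>, \<open>f (Q i)\<close> vanishes, so the signed values
  \<open>f (P i) - f (Q i)\<close> identify the complex with the unit sphere of the 1-norm.
  Rescaling by the 2-norm gives the round sphere; positive and negative parts over the 1-norm give
  the inverse.\<close>

lemma cross_polytope_sphere:
  fixes P Q :: "nat \<Rightarrow> 'a"
  assumes P: "inj_on P {..n}" and Q: "inj_on Q {..n}" and PQ: "\<And>i j. i \<le> n \<Longrightarrow> j \<le> n \<Longrightarrow> P i \<noteq> Q j"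
    and V: "V = P ` {..n} \<union> Q ` {..n}"
    and E: "\<And>x y. x \<in> V \<Longrightarrow> y \<in> V \<Longrightarrow> E x y \<longleftrightarrow> \<not> (\<exists>i\<le>n. x = P i \<and> y = Q i \<or> x = Q i \<and> y = P i)"
  shows "clq_top E V homeomorphic_space nsphere n"
proof -
  define d where "d f i = f (P i) - f (Q i)" for f :: "'a \<Rightarrow> real" and i
  define N where "N f = sqrt (\<Sum>j\<le>n. (d f j)\<^sup>2)" for f
  define \<phi> where "\<phi> f i = (if i \<le> n then d f i / N f else 0)" for f i
  define S where "S x = (\<Sum>i\<le>n. \<bar>x i\<bar>)" for x :: "nat \<Rightarrow> real"
  define \<psi> where "\<psi> x u = (\<Sum>i\<le>n. (if u = P i then max 0 (x i) else 0) + (if u = Q i then max 0 (- x i) else 0)) / S x"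
    for x :: "nat \<Rightarrow> real" and u
  have sumV: "sum f V = (\<Sum>i\<le>n. f (P i) + f (Q i))" for f :: "'a \<Rightarrow> real"
  proof -
    have "sum f V = sum f (P ` {..n}) + sum f (Q ` {..n})"
      unfolding V by (rule sum.union_disjoint) (use PQ in auto)
    then show ?thesis using P Q by (simp add: sum.reindex sum.distrib)
  qed
  have PQ0: "f (P i) = 0 \<or> f (Q i) = 0" if "f \<in> clq E V" "i \<le> n" for f i
    using clqD(3)[OF that(1), of "P i" "Q i"] E[of "P i" "Q i"] that(2) unfolding V by blast
  have absd: "\<bar>d f i\<bar> = f (P i) + f (Q i)" if "f \<in> clq E V" "i \<le> n" for f i
    using PQ0[OF that] clqD(1)[OF that(1)] by (auto simp: d_def)
  have sumd: "(\<Sum>i\<le>n. \<bar>d f i\<bar>) = 1" if "f \<in> clq E V" for f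
    using clqD(4)[OF that] absd[OF that] by (simp add: sumV)
  have Npos: "N f > 0" if "f \<in> clq E V" for f
  proof -
    have "\<exists>i\<le>n. d f i \<noteq> 0"
    proof (rule ccontr)
      assume "\<not> (\<exists>i\<le>n. d f i \<noteq> 0)"
      then have "(\<Sum>i\<le>n. \<bar>d f i\<bar>) = 0" by simp
      then show False using sumd[OF that] by simp
    qed
    then obtain i where "i \<le> n" "d f i \<noteq> 0" by blast
    then have "0 < (\<Sum>j\<le>n. (d f j)\<^sup>2)" by (intro sum_pos2[of _ i]) auto
    then show ?thesis by (simp add: N_def)
  qed
  have Spos: "S x > 0" if "(\<Sum>i\<le>n. (x i)\<^sup>2) = 1" for x
  proof -
    have "\<exists>i\<le>n. x i \<noteq> 0"
    proof (rule ccontr)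
      assume "\<not> (\<exists>i\<le>n. x i \<noteq> 0)"
      then have "(\<Sum>i\<le>n. (x i)\<^sup>2) = 0" by simp
      then show False using that by simp
    qed
    then obtain i where "i \<le> n" "x i \<noteq> 0" by blast
    then show ?thesis unfolding S_def by (intro sum_pos2[of _ i]) auto
  qed
  have \<psi>P: "\<psi> x (P i) = max 0 (x i) / S x" if "i \<le> n" for x i
  proof -
    have "(\<Sum>j\<le>n. (if P i = P j then max 0 (x j) else 0) + (if P i = Q j then max 0 (- x j) else 0))
        = (\<Sum>j\<le>n. (if j = i then max 0 (x j) else 0))"
      using that PQ inj_onD[OF P] by (intro sum.cong) auto
    then show ?thesis using that by (simp add: \<psi>_def)
  qed
  have \<psi>Q: "\<psi> x (Q i) = max 0 (- x i) / S x" if "i \<le> n" for x i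
  proof -
    have "(\<Sum>j\<le>n. (if Q i = P j then max 0 (x j) else 0) + (if Q i = Q j then max 0 (- x j) else 0))
        = (\<Sum>j\<le>n. (if j = i then max 0 (- x j) else 0))"
      using that PQ[symmetric] inj_onD[OF Q] by (intro sum.cong) auto
    then show ?thesis using that by (simp add: \<psi>_def)
  qed
  have \<psi>0: "\<psi> x u = 0" if "u \<notin> V" for x u
  proof -
    have "(\<Sum>i\<le>n. (if u = P i then max 0 (x i) else 0) + (if u = Q i then max 0 (- x i) else 0)) = 0"
      using that unfolding V by (intro sum.neutral) auto
    then show ?thesis by (simp add: \<psi>_def)
  qed
  have \<phi>in: "\<phi> f \<in> {x. (\<Sum>i\<le>n. (x i)\<^sup>2) = 1 \<and> (\<forall>i>n. x i = 0)}" if "f \<in> clq E V" for f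
  proof -
    have "(\<Sum>i\<le>n. (\<phi> f i)\<^sup>2) = (\<Sum>i\<le>n. (d f i)\<^sup>2) / (N f)\<^sup>2"
      by (simp add: \<phi>_def power_divide sum_divide_distrib)
    also have "(N f)\<^sup>2 = (\<Sum>i\<le>n. (d f i)\<^sup>2)" unfolding N_def by (simp add: sum_nonneg)
    finally show ?thesis using Npos[OF that] by (auto simp: \<phi>_def N_def)
  qed
  have \<psi>in: "\<psi> x \<in> clq E V" if x: "(\<Sum>i\<le>n. (x i)\<^sup>2) = 1" for x
  proof -
    note S = Spos[OF x]
    have "0 \<le> \<psi> x u" for u
      unfolding \<psi>_def using S by (intro divide_nonneg_pos sum_nonneg) auto
    moreover have "E u u'" if u: "\<psi> x u \<noteq> 0" "\<psi> x u' \<noteq> 0" for u u'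
    proof -
      have V': "u \<in> V" "u' \<in> V" using u \<psi>0 by blast+
      show ?thesis unfolding E[OF V']
      proof
        assume "\<exists>i\<le>n. u = P i \<and> u' = Q i \<or> u = Q i \<and> u' = P i"
        then obtain i where "i \<le> n" "u = P i \<and> u' = Q i \<or> u = Q i \<and> u' = P i" by blast
        then show False using u \<psi>P[of i x] \<psi>Q[of i x] by (auto simp: max_def split: if_splits)
      qed
    qed
    moreover have "sum (\<psi> x) V = 1"
    proof -
      have "sum (\<psi> x) V = (\<Sum>i\<le>n. \<bar>x i\<bar> / S x)"
        unfolding sumV by (intro sum.cong) (auto simp: \<psi>P \<psi>Q max_def)
      also have "\<dots> = 1" using S by (simp add: S_def flip: sum_divide_distrib)
      finally show ?thesis .
    qed
    ultimately show ?thesis using \<psi>0 by (auto simp: clq_def)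
  qed
  have "homeomorphic_maps (clq_top E V) (nsphere n) \<phi> \<psi>"
    unfolding homeomorphic_maps_def
  proof (intro conjI ballI)
    show "continuous_map (clq_top E V) (nsphere n) \<phi>"
      unfolding nsphere continuous_map_in_subtopology continuous_map_componentwise_UNIV
    proof (intro conjI allI)
      fix i
      have cd: "continuous_map (clq_top E V) euclideanreal (\<lambda>f. d f j)" for j
        unfolding d_def by (intro continuous_intros continuous_map_clq_coord')
      have cN: "continuous_map (clq_top E V) euclideanreal N"
        unfolding N_def by (intro continuous_intros continuous_map_sum cd continuous_map_real_pow) auto
      show "continuous_map (clq_top E V) euclideanreal (\<lambda>f. \<phi> f i)"
      proof (cases "i \<le> n")
        case True
        have "continuous_map (clq_top E V) euclideanreal (\<lambda>f. d f i / N f)"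
        proof (rule continuous_map_real_divide[OF cd cN])
          fix f assume "f \<in> topspace (clq_top E V)"
          then have "0 < N f" by (intro Npos) simp
          then show "N f \<noteq> 0" by simp
        qed
        then show ?thesis using True by (simp add: \<phi>_def)
      qed (simp add: \<phi>_def)
    qed (use \<phi>in in auto)
    show "continuous_map (nsphere n) (clq_top E V) \<psi>"
      unfolding continuous_map_into_clq
    proof (intro conjI allI ballI)
      fix u
      have c1: "continuous_map (nsphere n) euclideanreal (\<lambda>x. if u = P i then max 0 (x i) else 0)" for i
        by (cases "u = P i") (auto intro!: continuous_map_real_max continuous_map_nsphere_projection)
      have c2: "continuous_map (nsphere n) euclideanreal (\<lambda>x. if u = Q i then max 0 (- x i) else 0)" for i
        by (cases "u = Q i") (auto intro!: continuous_map_real_max continuous_map_minus continuous_map_nsphere_projection)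
      have cS: "continuous_map (nsphere n) euclideanreal S"
        unfolding S_def by (intro continuous_map_sum continuous_map_real_abs continuous_map_nsphere_projection) auto
      show "continuous_map (nsphere n) euclideanreal (\<lambda>x. \<psi> x u)"
        unfolding \<psi>_def
      proof (rule continuous_map_real_divide[OF continuous_map_sum[OF _ continuous_map_add[OF c1 c2]] cS])
        fix x assume "x \<in> topspace (nsphere n)"
        then have "0 < S x" by (intro Spos) (simp add: nsphere)
        then show "S x \<noteq> 0" by simp
      qed simp
    qed (use \<psi>in in \<open>auto simp: nsphere\<close>)
    show "\<psi> (\<phi> f) = f" if "f \<in> topspace (clq_top E V)" for f
    proof
      fix u
      have f: "f \<in> clq E V" using that by simp
      note N = Npos[OF f]
      have "S (\<phi> f) = (\<Sum>i\<le>n. \<bar>d f i\<bar>) / N f"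
        using N by (simp add: S_def \<phi>_def sum_divide_distrib)
      then have S: "S (\<phi> f) = 1 / N f" using sumd[OF f] by simp
      show "\<psi> (\<phi> f) u = f u"
      proof (cases "u \<in> V")
        case True
        then obtain i where i: "i \<le> n" "u = P i \<or> u = Q i" unfolding V by auto
        have m: "max 0 (y / N f) = max 0 y / N f" "max 0 (- (y / N f)) = max 0 (- y) / N f" for y
          using N by (auto simp: max_def field_simps)
        have "max 0 (d f i) = f (P i)" "max 0 (- d f i) = f (Q i)"
          using PQ0[OF f i(1)] clqD(1)[OF f] by (auto simp: d_def)
        then show ?thesis using i N \<psi>P[OF i(1), of "\<phi> f"] \<psi>Q[OF i(1), of "\<phi> f"] S m
          by (auto simp: \<phi>_def)
      qed (use \<psi>0 clqD(2)[OF f] in auto)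
    qed
    show "\<phi> (\<psi> x) = x" if "x \<in> topspace (nsphere n)" for x
    proof
      fix i
      have x: "(\<Sum>i\<le>n. (x i)\<^sup>2) = 1" "\<And>i. i > n \<Longrightarrow> x i = 0" using that by (auto simp: nsphere)
      note S = Spos[OF x(1)]
      have d: "d (\<psi> x) i = x i / S x" if "i \<le> n" for i
        using that \<psi>P[OF that, of x] \<psi>Q[OF that, of x] by (auto simp: d_def max_def diff_divide_distrib)
      have "(\<Sum>j\<le>n. (d (\<psi> x) j)\<^sup>2) = (\<Sum>j\<le>n. (x j)\<^sup>2) / (S x)\<^sup>2"
        by (simp add: d power_divide sum_divide_distrib)
      then have "N (\<psi> x) = 1 / S x" using x S by (simp add: N_def real_sqrt_divide)
      then show "\<phi> (\<psi> x) i = x i" using S d[of i] x(2)[of i] by (auto simp: \<phi>_def)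
    qed
  qed
  then show ?thesis unfolding homeomorphic_space_def by blast
qed

lemma gdist_polygon:
  assumes "0 < m" "i < m" "j < m"
  shows "gdist (real i / real m) (real j / real m)
    = real (min (nat \<bar>int i - int j\<bar>) (m - nat \<bar>int i - int j\<bar>)) / real m"
proof -
  have i: "real i / real m \<in> {0..<1}" and j: "real j / real m \<in> {0..<1}" using assms by auto
  consider "i < j" | "i = j" | "j < i" by linarith
  then show ?thesis
  proof cases
    case 1
    then have "nat \<bar>int i - int j\<bar> = j - i" by simp
    moreover have "real i / real m < real j / real m" using 1 assms by (simp add: divide_strict_right_mono)
    ultimately show ?thesis
      unfolding gdist_def cdist_eq[OF i j] cdist_eq[OF j i] using 1 assms
      by (simp add: of_nat_diff of_nat_min min_divide_distrib_right diff_divide_distrib add_divide_distrib)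
  next
    case 2
    then show ?thesis by (simp add: gdist_def cdist_def)
  next
    case 3
    then have "nat \<bar>int i - int j\<bar> = i - j" by simp
    moreover have "real j / real m < real i / real m" using 3 assms by (simp add: divide_strict_right_mono)
    ultimately show ?thesis
      unfolding gdist_def cdist_eq[OF i j] cdist_eq[OF j i] using 3 assms
      by (simp add: of_nat_diff of_nat_min min_divide_distrib_right diff_divide_distrib add_divide_distrib min.commute)
  qed
qed

text \<open>The radius lies between \<open>2 * l + 1\<close> and \<open>2 * l + 2\<close> polygon
  steps, so a vertex is adjacent to all others except its antipode.\<close>

lemma polygon_sphere:
  assumes m: "m = 4 * l + 4" and e: "0 < e" "e < 1 / real m"
    and r: "r = real (2 * l + 1) / real m + e"
  shows "clq_top (near r) (polygon m) homotopy_equivalent_space nsphere (2 * l + 1)"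
proof (rule homeomorphic_imp_homotopy_equivalent_space, rule cross_polytope_sphere)
  let ?P = "\<lambda>i. real i / real m" and ?Q = "\<lambda>i. real (i + 2 * l + 2) / real m"
  have m0: "0 < m" using m by simp
  show "inj_on ?P {..2 * l + 1}" "inj_on ?Q {..2 * l + 1}" using m0 by (auto intro!: inj_onI)
  show "?P i \<noteq> ?Q j" if "i \<le> 2 * l + 1" "j \<le> 2 * l + 1" for i j
    using that m0 by (simp add: divide_eq_eq)
  have "{..<m} = {..2 * l + 1} \<union> (\<lambda>i. i + 2 * l + 2) ` {..2 * l + 1}"
  proof (intro equalityI subsetI)
    fix i assume "i \<in> {..<m}"
    then have "i \<le> 2 * l + 1 \<or> i = (i - (2 * l + 2)) + 2 * l + 2 \<and> i - (2 * l + 2) \<le> 2 * l + 1"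
      using m by auto
    then show "i \<in> {..2 * l + 1} \<union> (\<lambda>i. i + 2 * l + 2) ` {..2 * l + 1}" by (auto simp: image_iff)
  qed (use m in auto)
  then show "polygon m = ?P ` {..2 * l + 1} \<union> ?Q ` {..2 * l + 1}"
    unfolding polygon_def by (simp add: image_Un image_image)
  fix x y assume "x \<in> polygon m" "y \<in> polygon m"
  then obtain i j where ij: "i < m" "j < m" "x = ?P i" "y = ?P j" by (auto simp: polygon_def)
  define D where "D = min (nat \<bar>int i - int j\<bar>) (m - nat \<bar>int i - int j\<bar>)"
  have rm: "r * real m = real (2 * l + 1) + e * real m" using r m0 by (simp add: field_simps)
  have em: "0 < e * real m" "e * real m < 1" using e m0 by (simp_all add: field_simps)
  have "near r x y \<longleftrightarrow> real D < r * real m"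
    unfolding near_def ij gdist_polygon[OF m0 ij(1,2)] D_def using m0 by (simp add: pos_divide_less_eq)
  also have "\<dots> \<longleftrightarrow> D \<le> 2 * l + 1" unfolding rm using em by linarith
  also have "\<dots> \<longleftrightarrow> \<not> (i + 2 * l + 2 = j \<or> j + 2 * l + 2 = i)"
  proof -
    define dd where "dd = nat \<bar>int i - int j\<bar>"
    have dd: "dd = (if i \<le> j then j - i else i - j)" by (auto simp: dd_def)
    have "D \<le> 2 * l + 1 \<longleftrightarrow> dd \<noteq> 2 * l + 2"
      unfolding D_def dd_def[symmetric] using m by (auto simp: min_def)
    also have "\<dots> \<longleftrightarrow> \<not> (i + 2 * l + 2 = j \<or> j + 2 * l + 2 = i)"
      unfolding dd by (cases "i \<le> j") auto
    finally show ?thesis .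
  qed
  also have "\<dots> \<longleftrightarrow> \<not> (\<exists>k\<le>2 * l + 1. x = ?P k \<and> y = ?Q k \<or> x = ?Q k \<and> y = ?P k)"
  proof -
    have eqs: "x = ?P k \<longleftrightarrow> i = k" "y = ?P k \<longleftrightarrow> j = k" "x = ?Q k \<longleftrightarrow> i = k + 2 * l + 2" "y = ?Q k \<longleftrightarrow> j = k + 2 * l + 2" for k
      unfolding ij using m0 by (simp_all only: divide_cancel_right of_nat_eq_iff) auto
    have "i \<le> 2 * l + 1" if "i + 2 * l + 2 = j" using that ij(2) m by simp
    moreover have "j \<le> 2 * l + 1" if "j + 2 * l + 2 = i" using that ij(1) m by simp
    ultimately show ?thesis unfolding eqs by blast
  qed
  finally show "near r x y \<longleftrightarrow> \<not> (\<exists>k\<le>2 * l + 1. x = ?P k \<and> y = ?Q k \<or> x = ?Q k \<and> y = ?P k)" .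
qed

text \<open>Quantified over all filled sets so that it depends on the radius alone; in the range of
  radii considered one filled set decides it.\<close>

definition sphere_at :: "nat \<Rightarrow> real \<Rightarrow> bool" where
  "sphere_at l r \<longleftrightarrow> (\<forall>X. finite X \<longrightarrow> X \<subseteq> {0..<1} \<longrightarrow> filled l r X \<longrightarrow>
     clq_top (near r) X homotopy_equivalent_space nsphere (2 * l + 1))"

lemma sphere_atI:
  assumes "finite X" "X \<subseteq> {0..<1}" "filled l r X" "clq_top (near r) X homotopy_equivalent_space nsphere (2 * l + 1)"
    "0 < r" "r \<le> real (l + 1) * (1 - 2 * r)"
  shows "sphere_at l r"
  unfolding sphere_at_def
  using filled_equivalent[OF _ _ _ assms(1-3,5,6)] assms(4) homotopy_eqv_trans by blast

section \<open>Varying the radius\<close>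

lemma radius_bounds:
  assumes "real l / real (2 * l + 1) < r" "r < real (l + 1) / real (2 * l + 3)"
  shows "0 < r" "r < 1/2" "r \<le> real (l + 1) * (1 - 2 * r)" "real l < real (2 * l + 1) * r"
proof -
  have "0 \<le> real l / real (2 * l + 1)" by simp
  then show "0 < r" using assms by linarith
  have *: "r * real (2 * l + 3) < real (l + 1)" using assms(2) by (simp add: pos_less_divide_eq)
  then show "r \<le> real (l + 1) * (1 - 2 * r)" by (simp add: algebra_simps)
  have "real (l + 1) / real (2 * l + 3) < 1 / 2" by (simp add: field_simps)
  then show "r < 1/2" using assms(2) by linarith
  show "real l < real (2 * l + 1) * r" using assms(1) by (simp add: pos_divide_less_eq mult.commute)
qed

text \<open>If \<open>r * k\<close> and \<open>r * (k + 1)\<close> were both integers, so would be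
  \<open>r\<close>. A non-integral \<open>r * m\<close> means that no distance in the polygon equals
  \<open>r\<close>, so its graph does not change for nearby radii.\<close>

lemma polygon_generic:
  assumes r: "0 < r" "r < 1" and g: "0 < g"
  obtains m where "2 \<le> m" "1 / real m < g" "r * real m \<notin> \<int>"
proof -
  obtain n where n: "n \<noteq> 0" "inverse (real n) < g" using reals_Archimedean[OF g] by (metis Suc_neq_Zero)
  define k where "k = max n 2"
  have k: "2 \<le> k" "1 / real k < g" "1 / real (k + 1) < g"
  proof -
    have "1 / real k \<le> 1 / real n" using n by (intro divide_left_mono) (auto simp: k_def)
    then show "1 / real k < g" using n by (simp add: inverse_eq_divide)
    moreover have "1 / real (k + 1) \<le> 1 / real k" by (intro divide_left_mono) (auto simp: k_def)
    ultimately show "1 / real (k + 1) < g" by linarith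
  qed (simp add: k_def)
  have "r * real k \<notin> \<int> \<or> r * real (k + 1) \<notin> \<int>"
  proof (rule ccontr)
    assume "\<not> ?thesis"
    then have "r * real (k + 1) - r * real k \<in> \<int>" by (intro Ints_diff) auto
    then have "r \<in> \<int>" by (simp add: algebra_simps)
    then show False using r by (auto elim!: Ints_cases)
  qed
  then show ?thesis using that[of k] that[of "k + 1"] k by auto
qed

text \<open>The property is locally constant in the radius, because near any radius one fine generic
  polygon stays filled and keeps its graph. The range of radii is connected, so it suffices to treat
  \<open>r0\<close>, just above \<open>(2 * l + 1) / (4 * l + 4)\<close>, where the polygon is a
  cross-polytope.\<close>

lemma sphere_at_all:
  assumes r: "real l / real (2 * l + 1) < r" "r < real (l + 1) / real (2 * l + 3)"
  shows "sphere_at l r"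
proof -
  let ?S = "{real l / real (2 * l + 1)<..<real (l + 1) / real (2 * l + 3)}"
  define m where "m = 4 * l + 4"
  \<comment> \<open>Chosen below \<open>1 / ((2 * l + 3) * m)\<close>, which is what keeps
    \<open>r0\<close> below the upper end of the range.\<close>
  define e where "e = 1 / (real m * real (2 * l + 4))"
  define r0 where "r0 = real (2 * l + 1) / real m + e"
  have m0: "0 < real m" by (simp add: m_def)
  have e: "0 < e" "real (2 * l + 3) * e \<le> 1 / real m" "e < 1 / real m"
  proof -
    have e': "e = 1 / real m * (1 / real (2 * l + 4))" by (simp add: e_def)
    show "0 < e" using m0 by (simp add: e_def)
    have "real (2 * l + 3) * e = 1 / real m * (real (2 * l + 3) / real (2 * l + 4))" by (simp add: e')
    also have "\<dots> \<le> 1 / real m * 1" using m0 by (intro mult_left_mono) auto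
    finally show "real (2 * l + 3) * e \<le> 1 / real m" by simp
    have "1 / real m * (1 / real (2 * l + 4)) < 1 / real m * 1"
      using m0 by (intro mult_strict_left_mono) auto
    then show "e < 1 / real m" by (simp add: e')
  qed
  have "real l / real (2 * l + 1) < real (2 * l + 1) / real m"
    using m0 by (simp add: m_def field_simps)
  then have r0a: "real l / real (2 * l + 1) < r0" using e by (simp add: r0_def)
  have "r0 * real m = real (2 * l + 1) + 1 / real (2 * l + 4)"
  proof -
    have "real (2 * l + 1) / real m * real m = real (2 * l + 1)" "e * real m = 1 / real (2 * l + 4)"
      using m0 by (simp_all add: e_def)
    then show ?thesis unfolding r0_def distrib_right by simp
  qed
  note r0m = this
  have "(r0 * real (2 * l + 3)) * real m = real (2 * l + 3) * (r0 * real m)" by (simp only: mult_ac)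
  also have "\<dots> = real (2 * l + 3) * real (2 * l + 1) + real (2 * l + 3) / real (2 * l + 4)"
    unfolding r0m distrib_left by simp
  also have "\<dots> < real (2 * l + 3) * real (2 * l + 1) + 1" by simp
  also have "\<dots> = real (l + 1) * real m" by (simp add: m_def algebra_simps)
  finally have "r0 * real (2 * l + 3) < real (l + 1)" using m0 by (simp only: mult_less_cancel_right_pos)
  then have r0b: "r0 < real (l + 1) / real (2 * l + 3)" by (simp add: pos_less_divide_eq)
  have r0: "r0 \<in> ?S" using r0a r0b by simp
  have base: "sphere_at l r0"
    by (rule sphere_atI[OF polygon_subset[of m] polygon_filled[OF m_def e(1,2) r0_def]
          polygon_sphere[OF m_def e(1,3) r0_def] radius_bounds(1,3)[OF r0a r0b]])
  have loc: "\<exists>T. openin (top_of_set ?S) T \<and> a \<in> T \<and> (\<forall>x\<in>T. sphere_at l a = sphere_at l x)" if a: "a \<in> ?S" for a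
  proof -
    have ab: "real l / real (2 * l + 1) < a" "a < real (l + 1) / real (2 * l + 3)" using a by auto
    note ra = radius_bounds[OF ab]
    \<comment> \<open>\<open>s\<close> is the slack in \<open>l < (2 * l + 1) * a\<close>. The mesh
      \<open>g\<close> spends half of it, so every radius with slack above \<open>s / 2\<close>
      meets the density condition.\<close>
    define s where "s = real (2 * l + 1) * a - real l"
    define g where "g = s / (2 * real (2 * l + 2))"
    have s: "0 < s" "0 < g" using ra by (simp_all add: s_def g_def)
    obtain N where N: "2 \<le> N" "1 / real N < g" "a * real N \<notin> \<int>"
      using polygon_generic[OF ra(1) _ s(2)] ra(2) by auto
    define k where "k = \<lfloor>a * real N\<rfloor>"
    have "of_int k \<noteq> a * real N" using N(3) by (metis Ints_of_int)
    moreover have "of_int k \<le> a * real N" "a * real N < of_int k + 1" unfolding k_def by linarith+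
    ultimately have k: "of_int k < a * real N" "a * real N < of_int k + 1" by linarith+
    \<comment> \<open>Apart from the slack, \<open>x * N\<close> is confined between consecutive
      integers, so polygon distances compare with \<open>x\<close> as they do with
      \<open>a\<close>.\<close>
    define T where "T = ?S \<inter> {x. real (2 * l + 1) * x - real l > s / 2} \<inter> {x. of_int k < x * real N} \<inter> {x. x * real N < of_int k + 1}"
    have "open ({x. real (2 * l + 1) * x - real l > s / 2} \<inter> {x. of_int k < x * real N} \<inter> {x. x * real N < of_int k + 1})"
      by (intro open_Int open_Collect_less continuous_intros)
    then have "openin (top_of_set ?S) T" unfolding T_def Int_assoc by (simp add: openin_open_Int)
    moreover have "s / 2 < real (2 * l + 1) * a - real l" unfolding s_def[symmetric] using s(1) by simp
    then have aT: "a \<in> T" unfolding T_def using a k by (intro IntI CollectI)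
    moreover have key: "filled l x (polygon N) \<and> clq_top (near x) (polygon N) = clq_top (near a) (polygon N)" if x: "x \<in> T" for x
    proof
      have xb: "real l / real (2 * l + 1) < x" "x < real (l + 1) / real (2 * l + 3)"
        "s / 2 < real (2 * l + 1) * x - real l" "of_int k < x * real N" "x * real N < of_int k + 1"
        using x by (auto simp: T_def)
      note rx = radius_bounds[OF xb(1,2)]
      have "c * (s / (2 * c)) = s / 2" if "0 < c" for c :: real using that by (simp add: field_simps)
      from this[of "real (2 * l + 2)"] have "real (2 * l + 2) * g = s / 2" by (simp only: g_def)
      then have "real (2 * l + 2) * g + real l * (1 - 2 * x) \<le> x" using xb(3) by (simp add: algebra_simps)
      then show "filled l x (polygon N)"
        by (intro circle_dense_filled[OF circle_dense_polygon[OF N(1,2)] polygon_subset(2) s(2) rx(1,2)])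
      show "clq_top (near x) (polygon N) = clq_top (near a) (polygon N)"
      proof (rule clq_cong)
        fix p q assume "p \<in> polygon N" "q \<in> polygon N"
        then obtain i j where ij: "i < N" "j < N" "p = real i / real N" "q = real j / real N" by (auto simp: polygon_def)
        obtain D :: nat where D: "gdist p q = real D / real N"
          using gdist_polygon[OF _ ij(1,2)] N(1) unfolding ij by (metis gr0I not_less_zero ij(1))
        have N0: "0 < real N" using N(1) by simp
        have "near x p q \<longleftrightarrow> real D < x * real N" "near a p q \<longleftrightarrow> real D < a * real N"
          unfolding near_def D using N0 by (simp_all add: pos_divide_less_eq)
        moreover have "real D < x * real N \<longleftrightarrow> int D \<le> k" using xb(4,5) by linarith
        moreover have "real D < a * real N \<longleftrightarrow> int D \<le> k" using k by linarith
        ultimately show "near x p q \<longleftrightarrow> near a p q" by simp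
      qed
    qed
    moreover have "sphere_at l a = sphere_at l x" if x: "x \<in> T" for x
    proof -
      have xb: "real l / real (2 * l + 1) < x" "x < real (l + 1) / real (2 * l + 3)" using x by (auto simp: T_def)
      note rx = radius_bounds[OF xb]
      have imp: "sphere_at l y" if "sphere_at l z" "filled l z (polygon N)" "filled l y (polygon N)"
          "clq_top (near y) (polygon N) = clq_top (near z) (polygon N)" "0 < y" "y \<le> real (l + 1) * (1 - 2 * y)" for y z
      proof (rule sphere_atI[OF polygon_subset[of N] that(3) _ that(5,6)])
        show "clq_top (near y) (polygon N) homotopy_equivalent_space nsphere (2 * l + 1)"
          unfolding that(4) using that(1,2) polygon_subset[of N] unfolding sphere_at_def by blast
      qed
      show ?thesis using imp[of a x] imp[of x a] key[OF x] key[OF aT] rx(1,3) ra(1,3) by auto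
    qed
    ultimately show ?thesis by blast
  qed
  have "sphere_at l r0 = sphere_at l r"
  proof (rule connected_equivalence_relation[where S = ?S and R = "\<lambda>x y. sphere_at l x = sphere_at l y"])
    show "connected ?S" by simp
    show "r0 \<in> ?S" by (rule r0)
    show "r \<in> ?S" using r by simp
    show "sphere_at l y = sphere_at l x" if "sphere_at l x = sphere_at l y" for x y using that by (rule sym)
    show "sphere_at l x = sphere_at l z" if "sphere_at l x = sphere_at l y" "sphere_at l y = sphere_at l z" for x y z
      using that by (rule trans)
    show "\<exists>T. openin (top_of_set ?S) T \<and> a \<in> T \<and> (\<forall>x\<in>T. sphere_at l a = sphere_at l x)" if "a \<in> ?S" for a
      using that by (rule loc)
  qed
  then show ?thesis using base by simp
qed

lemma dense_sphere:
  assumes "real l / real (2 * l + 1) < r" "r < real (l + 1) / real (2 * l + 3)"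
    and "finite X" "X \<subseteq> {0..<1}" "circle_dense g X" "0 < g" "real (2 * l + 2) * g + real l * (1 - 2 * r) \<le> r"
  shows "clq_top (near r) X homotopy_equivalent_space nsphere (2 * l + 1)"
proof -
  have "filled l r X"
    by (rule circle_dense_filled[OF assms(5,4,6) radius_bounds(1,2)[OF assms(1,2)] assms(7)])
  moreover have "sphere_at l r" using assms(1,2) by (rule sphere_at_all)
  ultimately show ?thesis using assms(3,4) unfolding sphere_at_def by (elim allE[of _ X] impE)
qed

section \<open>Winding fractions\<close>

lemma mod_offset: "a < n \<Longrightarrow> j < n \<Longrightarrow> ((a + j) mod n + n - a) mod (n::nat) = j"
proof -
  assume a: "a < n" "j < n"
  show ?thesis
  proof (cases "a + j < n")
    case True
    then show ?thesis using a by simp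
  next
    case False
    then have "(a + j) mod n = a + j - n" using a by (simp add: mod_if)
    then show ?thesis using a False by simp
  qed
qed

lemma mod_diff_cases: "a < m \<Longrightarrow> b < m \<Longrightarrow> (b + m - a) mod (m::nat) = (if a \<le> b then b - a else b + m - a)"
proof -
  assume ab: "a < m" "b < m"
  show ?thesis
  proof (cases "a \<le> b")
    case True
    then have "b + m - a = (b - a) + m" by simp
    then have "(b + m - a) mod m = (b - a) mod m" by (simp only: mod_add_self2)
    also have "\<dots> = b - a" using ab by simp
    finally show ?thesis using True by simp
  qed (use ab in auto)
qed

lemma cyc_btw_iff:
  "cyc_btw m a b c \<longleftrightarrow> a < m \<and> b < m \<and> c < m \<and> (a < b \<and> b < c \<or> b < c \<and> c < a \<or> c < a \<and> a < b)"
proof (cases "a < m \<and> b < m \<and> c < m")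
  case True
  then show ?thesis unfolding cyc_btw_def by (simp add: mod_diff_cases) auto
qed (auto simp: cyc_btw_def)

section \<open>Lifting cyclic homomorphisms to the line, and upper bounds for the winding\<close>

lemma Cnk_step:
  assumes "1 \<le> t" "t \<le> k" "2 * k < n"
  shows "Cnk n k (i mod n) ((i + t) mod n)"
proof -
  have n: "0 < n" "t < n" using assms by auto
  have "(i + t) mod n = (i mod n + t) mod n" by (simp add: mod_add_left_eq)
  then have "((i + t) mod n + n - i mod n) mod n = t" using mod_offset[of "i mod n" n t] n by simp
  then show ?thesis using n assms by (simp add: Cnk_def)
qed

lemma Cnk_cycle:
  assumes "1 \<le> k" "2 * k < n"
  shows "\<exists>v<n. (\<lambda>a b. a < n \<and> b < n \<and> Cnk n k a b)\<^sup>+\<^sup>+ v v"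
proof -
  let ?R = "\<lambda>a b. a < n \<and> b < n \<and> Cnk n k a b"
  have n: "0 < n" using assms by simp
  have step: "?R (i mod n) (Suc i mod n)" for i
    using Cnk_step[of 1 k n i] assms n by simp
  have "?R\<^sup>+\<^sup>+ (0 mod n) (Suc i mod n)" for i
  proof (induction i)
    case 0
    show ?case using step[of 0] by (rule tranclp.r_into_trancl)
  next
    case (Suc i)
    show ?case using Suc step[of "Suc i"] by (rule tranclp.trancl_into_trancl)
  qed
  from this[of "n - 1"] show ?thesis using n by auto
qed

text \<open>Indexed from the start of the fibre of its smallest value, the map is monotone over one
  turn; adding the number of completed turns gives a nondecreasing \<Phi> of degree 1. Edges control
  distances only modulo 1, which is why the step bound needs an induction.\<close>

lemma hom_lift:
  assumes X: "finite X" "X \<subseteq> {0..<1}" and r: "0 < r" "r < 1/2"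
    and hom: "cyclic_hom n (Cnk n k) (card X) (vr_edge True X r) f" and k: "1 \<le> k" "2 * k < n"
  obtains \<Phi> :: "nat \<Rightarrow> real" where "\<And>i j. i \<le> j \<Longrightarrow> \<Phi> i \<le> \<Phi> j" "\<And>i. \<Phi> (i + n) = \<Phi> i + 1"
    "\<And>i. \<Phi> (i + k) < \<Phi> i + r" "\<And>i. \<exists>x\<in>X. \<exists>z::nat. \<Phi> i = x + real z"
    "\<And>i. real (i div n) \<le> \<Phi> i" "\<Phi> 0 < 1"
proof -
  define xs where "xs = sorted_list_of_set X"
  define m where "m = card X"
  have len: "length xs = m" and set_xs: "set xs = X" using X by (simp_all add: xs_def m_def)
  have fm: "f v < m" if "v < n" for v using hom that by (simp add: cyclic_hom_def m_def)
  have fE: "f v = f w \<or> vr_edge True X r (f v) (f w)" if "v < n" "w < n" "Cnk n k v w" for v w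
    using hom that by (simp add: cyclic_hom_def)
  have fint: "cyc_interval n {v. v < n \<and> f v = y}" for y using hom by (simp add: cyclic_hom_def)
  have fbtw: "cyc_btw n s s' s''" if "s < n" "s' < n" "s'' < n" "cyc_btw m (f s) (f s') (f s'')" for s s' s''
    using hom that by (simp add: cyclic_hom_def m_def)
  have nc: "\<not> (\<exists>c. \<forall>v<n. f v = c)"
    using hom Cnk_cycle[OF k] by (simp add: cyclic_hom_def)
  have n0: "0 < n" using k by simp
  have xs01: "xs ! i \<in> X" "0 \<le> xs ! i" "xs ! i < 1" if "i < m" for i
  proof -
    show "xs ! i \<in> X" using that nth_mem[of i xs] len set_xs by simp
    then show "0 \<le> xs ! i" "xs ! i < 1" using X(2) by auto
  qed
  have xs_mono: "xs ! i \<le> xs ! j" if "i \<le> j" "j < m" for i j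
    using that len sorted_nth_mono[of xs i j] by (simp add: xs_def)
  define y where "y = Min (f ` {..<n})"
  have ymin: "y \<le> f v" if "v < n" for v using that by (simp add: y_def)
  have "y \<in> f ` {..<n}" unfolding y_def using n0 by (intro Min_in) auto
  then obtain v0 where v0: "v0 < n" "f v0 = y" by auto
  obtain a len' where a: "a < n" "len' \<le> n" and F: "{v. v < n \<and> f v = y} = {(a + i) mod n |i. i < len'}"
    using fint[of y] v0 unfolding cyc_interval_def by blast
  have len'0: "0 < len'"
  proof (rule ccontr)
    assume "\<not> 0 < len'"
    then have "{v. v < n \<and> f v = y} = {}" using F by simp
    then show False using v0 by blast
  qed
  define g where "g i = f ((a + i) mod n)" for i
  have g_mod: "g (i mod n) = g i" for i by (simp add: g_def mod_add_right_eq)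
  have gm: "g i < m" for i using fm n0 by (simp add: g_def)
  have g_y: "g i = y \<longleftrightarrow> i < len'" if "i < n" for i
  proof
    assume "i < len'"
    then have "(a + i) mod n \<in> {v. v < n \<and> f v = y}" unfolding F by blast
    then show "g i = y" by (simp add: g_def)
  next
    assume "g i = y"
    then have "(a + i) mod n \<in> {v. v < n \<and> f v = y}" using n0 by (simp add: g_def)
    then obtain i' where i': "(a + i) mod n = (a + i') mod n" "i' < len'" unfolding F by blast
    have "i' < n" using i'(2) a(2) by simp
    have "i = ((a + i) mod n + n - a) mod n" using mod_offset[OF a(1) that] by (rule sym)
    also have "\<dots> = i'" unfolding i'(1) by (rule mod_offset[OF a(1) \<open>i' < n\<close>])
    finally have "i = i'" .
    then show "i < len'" using i' by simp
  qed
  \<comment> \<open>If the order were reversed, \<open>y\<close>, \<open>g j\<close>,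
    \<open>g i\<close> would be in cyclic order, and cyclic monotonicity would place
    \<open>a + j\<close> before \<open>a + i\<close> as seen from \<open>a\<close>.\<close>
  have g_mono: "g i \<le> g j" if ij: "i \<le> j" "j < n" for i j
  proof (rule ccontr)
    assume "\<not> g i \<le> g j"
    then have lt: "g j < g i" by simp
    have yj: "y < g j"
    proof (rule ccontr)
      assume "\<not> y < g j"
      moreover have "y \<le> g j" using ymin n0 by (simp add: g_def)
      ultimately have "g j = y" by simp
      then have "j < len'" using g_y ij by simp
      then have "g i = y" using g_y ij by simp
      then show False using lt \<open>g j = y\<close> by simp
    qed
    have ga: "f a = y" using g_y[of 0] len'0 n0 a(1) by (simp add: g_def)
    have "cyc_btw m (f a) (f ((a + j) mod n)) (f ((a + i) mod n))"
      unfolding cyc_btw_iff using lt yj ga gm[of i] gm[of j] fm[OF a(1)] by (simp add: g_def)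
    then have "cyc_btw n a ((a + j) mod n) ((a + i) mod n)"
      by (rule fbtw[rotated 3]) (use a(1) n0 in simp_all)
    then have "((a + j) mod n + n - a) mod n < ((a + i) mod n + n - a) mod n"
      unfolding cyc_btw_def by (elim conjE)
    then have "j < i" unfolding mod_offset[OF a(1) ij(2)] mod_offset[OF a(1) le_less_trans[OF ij]] .
    then show False using ij by simp
  qed
  define \<Phi> where "\<Phi> i = xs ! (g i) + real (i div n)" for i
  have \<Phi>_mono: "\<Phi> i \<le> \<Phi> j" if "i \<le> j" for i j
  proof (cases "i div n = j div n")
    case True
    have "i mod n \<le> j mod n"
      using that True by (metis add_le_cancel_left div_mult_mod_eq)
    then have "g (i mod n) \<le> g (j mod n)" using n0 by (intro g_mono) auto
    then have "xs ! (g i) \<le> xs ! (g j)" using xs_mono gm by (simp add: g_mod)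
    then show ?thesis using True by (simp add: \<Phi>_def)
  next
    case False
    then have "Suc (i div n) \<le> j div n" using div_le_mono[OF that, of n] by simp
    then have "real (i div n) + 1 \<le> real (j div n)" by linarith
    then show ?thesis using xs01(3)[OF gm[of i]] xs01(2)[OF gm[of j]] by (simp add: \<Phi>_def)
  qed
  have \<Phi>_n: "\<Phi> (i + n) = \<Phi> i + 1" for i
  proof -
    have "g (i + n) = g i" using g_mod[of "i + n"] g_mod[of i] by simp
    then show ?thesis using n0 by (simp add: \<Phi>_def)
  qed
  have edge: "cdist (xs ! (g i)) (xs ! (g (i + t))) < r" if "1 \<le> t" "t \<le> k" for i t
  proof -
    have "Cnk n k ((a + i) mod n) ((a + i + t) mod n)" by (rule Cnk_step[OF that k(2)])
    then have "g i = g (i + t) \<or> vr_edge True X r (g i) (g (i + t))"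
      using fE[of "(a + i) mod n" "(a + i + t) mod n"] n0 by (simp add: g_def add.assoc)
    then show ?thesis
    proof
      assume "g i = g (i + t)"
      then show ?thesis using r by (simp add: cdist_def)
    qed (simp add: vr_edge_def Let_def xs_def)
  qed
  have cd: "cdist (xs ! (g i)) (xs ! (g (i + t))) = \<Phi> (i + t) - \<Phi> i" if "\<Phi> (i + t) - \<Phi> i < 1" for i t
  proof (rule cdist_unique)
    show "xs ! g (i + t) - xs ! g i = \<Phi> (i + t) - \<Phi> i + of_int (int (i div n) - int ((i + t) div n))"
      by (simp add: \<Phi>_def)
    show "0 \<le> \<Phi> (i + t) - \<Phi> i" using \<Phi>_mono[of i "i + t"] by simp
  qed (rule that)
  \<comment> \<open>A jump by a full turn would make \<open>f\<close> constant over the following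
    \<open>n\<close> indices, which is excluded because the source has a directed cycle.\<close>
  have unit: "\<Phi> (i + 1) - \<Phi> i < 1" for i
  proof (rule ccontr)
    assume "\<not> \<Phi> (i + 1) - \<Phi> i < 1"
    then have ge: "\<Phi> i + 1 \<le> \<Phi> (i + 1)" by simp
    have eq: "\<Phi> (i + 1 + j) = \<Phi> i + 1" if "j < n" for j
      using \<Phi>_mono[of "i + 1" "i + 1 + j"] \<Phi>_mono[of "i + 1 + j" "i + n"] \<Phi>_n[of i] ge that by simp
    have dist: "distinct xs" by (simp add: xs_def)
    have gc: "g (i + 1 + j) = g i" if "j < n" for j
    proof -
      have "xs ! g (i + 1 + j) + real ((i + 1 + j) div n) = xs ! g i + real (i div n) + 1"
        using eq[OF that] by (simp add: \<Phi>_def)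
      then have A: "xs ! g (i + 1 + j) + real ((i + 1 + j) div n) = xs ! g i + real (i div n) + 1" .
      have "(i + 1 + j) div n = i div n \<or> (i + 1 + j) div n = i div n + 1"
      proof -
        have "i div n \<le> (i + 1 + j) div n" by (rule div_le_mono) simp
        moreover have "(i + 1 + j) div n \<le> (i + n) div n" using that by (intro div_le_mono) simp
        moreover have "(i + n) div n = i div n + 1" using n0 by simp
        ultimately show ?thesis by linarith
      qed
      then have "real ((i + 1 + j) div n) = real (i div n) \<or> real ((i + 1 + j) div n) = real (i div n) + 1"
        by (metis of_nat_1 of_nat_add)
      then have "xs ! g (i + 1 + j) = xs ! g i"
        using A xs01(2,3)[OF gm[of i]] xs01(2,3)[OF gm[of "i + 1 + j"]] by linarith
      then show ?thesis using nth_eq_iff_index_eq[OF dist] gm len by simp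
    qed
    have "f v = g i" if "v < n" for v
    proof -
      define j where "j = (v + n * (a + i + 1) - (a + i + 1)) mod n"
      have "1 * (a + i + 1) \<le> n * (a + i + 1)" using n0 by (intro mult_le_mono1) simp
      then have "v + n * (a + i + 1) \<ge> a + i + 1" by (simp only: mult_1 trans_le_add2)
      then have "(a + (i + 1 + j)) mod n = (v + n * (a + i + 1)) mod n"
        unfolding j_def by (metis add.assoc le_add_diff_inverse mod_add_right_eq)
      also have "\<dots> = v" unfolding mod_mult_self2 using that by simp
      finally have "(a + (i + 1 + j)) mod n = v" .
      then have "g (i + 1 + j) = f v" unfolding g_def by (rule arg_cong)
      moreover have "j < n" unfolding j_def using n0 by (rule mod_less_divisor)
      then have "g (i + 1 + j) = g i" by (rule gc)
      ultimately show ?thesis by (rule trans[OF sym])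
    qed
    then have "\<exists>c. \<forall>v<n. f v = c" by (intro exI[of _ "g i"] allI impI)
    then show False using nc by (rule notE[rotated])
  qed
  \<comment> \<open>The first \<open>t\<close> indices advance by less than \<open>r\<close> and the
    next one by less than \<open>r\<close>, together less than \<open>2 * r < 1\<close>. So the
    lifted difference is the clockwise distance itself, and the edge bounds it by
    \<open>r\<close>.\<close>
  have main: "\<Phi> (i + t) - \<Phi> i < r" if "t \<le> k" for i t
    using that
  proof (induction t)
    case 0
    then show ?case using r by simp
  next
    case (Suc t)
    have tk: "t \<le> k" using Suc.prems by (rule Suc_leD)
    have IH: "\<Phi> (i + t) - \<Phi> i < r" using tk by (rule Suc.IH)
    have c1: "cdist (xs ! g (i + t)) (xs ! g (i + t + 1)) = \<Phi> (i + t + 1) - \<Phi> (i + t)"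
      by (rule cd, rule unit)
    have e1: "cdist (xs ! g (i + t)) (xs ! g (i + t + 1)) < r"
      by (rule edge, rule le_refl, rule k(1))
    have s1: "i + Suc t = i + t + 1" by simp
    have lt1: "\<Phi> (i + Suc t) - \<Phi> i < 1" unfolding s1 using IH r(2) e1 c1 by linarith
    have c2: "cdist (xs ! g i) (xs ! g (i + Suc t)) = \<Phi> (i + Suc t) - \<Phi> i"
      using lt1 by (rule cd)
    have e2: "cdist (xs ! g i) (xs ! g (i + Suc t)) < r"
      by (rule edge[OF _ Suc.prems]) simp
    show ?case using e2 unfolding c2 .
  qed
  show ?thesis
  proof (rule that[of \<Phi>])
    show "\<Phi> i \<le> \<Phi> j" if "i \<le> j" for i j using that by (rule \<Phi>_mono)
    show "\<Phi> (i + n) = \<Phi> i + 1" for i by (rule \<Phi>_n)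
    show "\<Phi> (i + k) < \<Phi> i + r" for i using main[of k i] by simp
    show "\<exists>x\<in>X. \<exists>z::nat. \<Phi> i = x + real z" for i using xs01(1)[OF gm[of i]] unfolding \<Phi>_def by blast
    show "real (i div n) \<le> \<Phi> i" for i using xs01(2)[OF gm[of i]] by (simp add: \<Phi>_def)
    show "\<Phi> 0 < 1" using xs01(3)[OF gm[of 0]] by (simp add: \<Phi>_def)
  qed
qed

definition wind_set :: "real set \<Rightarrow> real \<Rightarrow> real set" where
  "wind_set X r = {real k / real n | n k. 1 \<le> n \<and> 2 * k < n \<and> (\<exists>f. cyclic_hom n (Cnk n k) (card X) (vr_edge True X r) f)}"

lemma wf_eq_Sup: "wf True X r = Sup (wind_set X r)"
  by (simp add: wf_def winding_fraction_def wind_set_def)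

lemma wind_set_bdd: "bdd_above (wind_set X r)"
proof (rule bdd_aboveI[of _ 1])
  fix q assume "q \<in> wind_set X r"
  then obtain n k where "q = real k / real n" "1 \<le> n" "2 * k < n" by (auto simp: wind_set_def)
  then show "q \<le> 1" by simp
qed

lemma periodic_lift:
  fixes \<Phi> :: "nat \<Rightarrow> real"
  assumes "\<And>i. \<Phi> (i + n) = \<Phi> i + 1"
  shows "\<Phi> (i + q * n) = \<Phi> i + real q"
proof (induction q)
  case (Suc q)
  have "\<Phi> (i + Suc q * n) = \<Phi> ((i + q * n) + n)" by (simp add: algebra_simps)
  then show ?case using assms Suc by simp
qed simp

lemma steps_less:
  fixes \<Phi> :: "nat \<Rightarrow> real"
  assumes "\<And>i. \<Phi> (i + k) < \<Phi> i + r"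
  shows "\<Phi> (i + q * k) \<le> \<Phi> i + real q * r"
proof (induction q)
  case (Suc q)
  have "\<Phi> (i + Suc q * k) = \<Phi> ((i + q * k) + k)" by (simp add: algebra_simps)
  also have "\<dots> < \<Phi> (i + q * k) + r" by (rule assms)
  finally show ?case using Suc by (simp add: algebra_simps)
qed simp

text \<open>The one-vertex graph with \<open>k = 0\<close> has no directed cycle, so the constant
  map is admissible; this keeps the supremum over a nonempty set.\<close>

lemma const_hom:
  assumes "finite X" "X \<noteq> {}"
  shows "0 \<in> wind_set X r"
proof -
  have c: "0 < card X" using assms by (simp add: card_gt_0_iff)
  have R: "\<not> (\<lambda>a b. a < 1 \<and> b < 1 \<and> Cnk 1 0 a b)\<^sup>+\<^sup>+ v v" for v
  proof
    assume "(\<lambda>a b. a < 1 \<and> b < 1 \<and> Cnk 1 0 a b)\<^sup>+\<^sup>+ v v"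
    then show False by (induction rule: tranclp.induct) (auto simp: Cnk_def)
  qed
  have "cyc_interval 1 {v. v < 1 \<and> 0 = (y::nat)}" for y
  proof (cases "y = 0")
    case True
    have "{v. v < 1 \<and> 0 = y} = {(0 + i) mod 1 | i. i < (1::nat)}" using True by auto
    then show ?thesis unfolding cyc_interval_def by (intro disjI2 exI[of _ 0]) auto
  qed (simp add: cyc_interval_def)
  then have "cyclic_hom 1 (Cnk 1 0) (card X) (vr_edge True X r) (\<lambda>_. 0)"
    unfolding cyclic_hom_def using c R by (auto simp: cyc_btw_def)
  then show ?thesis unfolding wind_set_def by (intro CollectI exI[of _ 1] exI[of _ 0]) auto
qed

text \<open>Let \<open>i\<close> be the last index with \<open>\<Phi> i \<le> p + 1\<close>. After
  \<open>(2 * l + 1) * k\<close> more indices \<Phi> is still below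
  \<open>p + 1 + l + \<gamma>\<close>, hence at most \<open>p + 1 + l\<close>, since the gap
  contains no value. If \<open>(2 * l + 1) * k > l * n\<close>, going back \<open>l\<close> turns
  gives a later index that still satisfies the bound.\<close>

lemma wf_le_of_gap:
  assumes X: "finite X" "X \<subseteq> {0..<1}" "X \<noteq> {}" and r: "0 < r" "r < 1/2"
    and p: "p \<in> {0..<1}" and gap: "\<And>x. x \<in> X \<Longrightarrow> \<not> (0 < cdist p x \<and> cdist p x < \<gamma>)"
    and \<gamma>: "\<gamma> \<le> 1" "real (2 * l + 1) * r < real l + \<gamma>"
  shows "wf True X r \<le> real l / real (2 * l + 1)"
  unfolding wf_eq_Sup
proof (rule cSup_least)
  show "wind_set X r \<noteq> {}" using const_hom[OF X(1,3)] by blast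
  fix q assume "q \<in> wind_set X r"
  then obtain n k f where q: "q = real k / real n" and n: "1 \<le> n" "2 * k < n"
    and hom: "cyclic_hom n (Cnk n k) (card X) (vr_edge True X r) f" by (auto simp: wind_set_def)
  show "q \<le> real l / real (2 * l + 1)"
  proof (cases "k = 0")
    case False
    then have k: "1 \<le> k" by simp
    obtain \<Phi> where \<Phi>: "\<And>i j. i \<le> j \<Longrightarrow> \<Phi> i \<le> \<Phi> j" "\<And>i. \<Phi> (i + n) = \<Phi> i + 1"
      "\<And>i. \<Phi> (i + k) < \<Phi> i + r" "\<And>i. \<exists>x\<in>X. \<exists>z::nat. \<Phi> i = x + real z"
      "\<And>i. real (i div n) \<le> \<Phi> i" "\<Phi> 0 < 1"
      using hom_lift[OF X(1,2) r hom k n(2)] by metis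
    have "(2 * l + 1) * k \<le> l * n"
    proof (rule ccontr)
      assume c: "\<not> (2 * l + 1) * k \<le> l * n"
      \<comment> \<open>The threshold is \<open>p + 1\<close> rather than \<open>p\<close>, so that
        index 0 qualifies for every \<open>p\<close>.\<close>
      define I where "I = {i. \<Phi> i \<le> p + 1}"
      have "I \<subseteq> {..<3 * n}"
      proof
        fix i assume "i \<in> I"
        then have "real (i div n) \<le> p + 1" using \<Phi>(5)[of i] by (simp add: I_def)
        then have "i div n < 2" using p by simp
        then show "i \<in> {..<3 * n}" using n by (simp add: div_less_iff_less_mult)
      qed
      then have fin: "finite I" using finite_subset by blast
      have "0 \<in> I" using \<Phi>(6) p by (simp add: I_def)
      define i where "i = Max I"
      have iI: "i \<in> I" unfolding i_def using fin \<open>0 \<in> I\<close> by (intro Max_in) auto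
      define i' where "i' = i + (2 * l + 1) * k - l * n"
      have i': "i' + l * n = i + (2 * l + 1) * k" "i < i'" using c by (simp_all add: i'_def)
      obtain x z where xz: "x \<in> X" "\<Phi> (i + (2 * l + 1) * k) = x + real (z::nat)" using \<Phi>(4) by blast
      have "\<Phi> (i + (2 * l + 1) * k) \<le> p + 1 + real (2 * l + 1) * r"
        using steps_less[of \<Phi> k r i "2 * l + 1", OF \<Phi>(3)] iI by (simp add: I_def)
      then have ub: "x + real z < p + 1 + real l + \<gamma>" using \<gamma>(2) xz(2) by linarith
      have "x + real z \<le> p + 1 + real l"
      proof (rule ccontr)
        assume n': "\<not> x + real z \<le> p + 1 + real l"
        have "cdist p x = x + real z - (p + 1 + real l)"
        proof (rule cdist_unique)
          show "x - p = x + real z - (p + 1 + real l) + of_int (1 + int l - int z)" by simp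
        qed (use n' ub \<gamma>(1) in linarith)+
        then show False using gap[OF xz(1)] n' ub by simp
      qed
      then have "\<Phi> i' \<le> p + 1" using periodic_lift[of \<Phi> n i' l, OF \<Phi>(2)] i'(1) xz(2) by simp
      then have "i' \<in> I" by (simp add: I_def)
      then show False using i'(2) fin unfolding i_def by (simp add: leD)
    qed
    then have "real (2 * l + 1) * real k \<le> real l * real n" by (metis of_nat_le_iff of_nat_mult)
    then show ?thesis unfolding q using n by (simp add: field_simps)
  qed (simp add: q)
qed

text \<open>Some block of \<open>2 * l + 1\<close> steps must advance by nearly \<open>l\<close>
  turns. As every step is shorter than \<open>r\<close>, none can fall far behind, and the visited
  points are pinned near the vertices of a regular polygon.\<close>

lemma wf_ge_tuple:
  assumes X: "finite X" "X \<subseteq> {0..<1}" "X \<noteq> {}" and r: "0 < r" "r < 1/2"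
    and \<delta>: "r = real l / real (2 * l + 1) + \<delta>" "0 < \<delta>" "\<delta> < real l / real (2 * l + 1)"
    and wf: "real l / real (2 * l + 1) \<le> wf True X r"
  shows "\<exists>x. \<forall>j\<le>2 * l. x j \<in> X \<and> (\<exists>z::int. \<bar>x j - x 0 - real j * (real l / real (2 * l + 1)) + of_int z\<bar> \<le> real (4 * l + 2) * \<delta>)"
proof -
  define a where "a = real l / real (2 * l + 1)"
  define L where "L = real (2 * l + 1)"
  have L0: "0 < L" and aL: "L * a = real l" by (simp_all add: a_def L_def)
  \<comment> \<open>The supremum need not be attained, so a ratio above \<open>a - \<delta>\<close>
    is used. Against steps of length up to \<open>a + \<delta>\<close> this loses
    \<open>2 * \<delta>\<close> per step, which is the constant \<open>4 * l + 2\<close>.\<close>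
  have "a - \<delta> < Sup (wind_set X r)" using wf \<delta> by (simp add: wf_eq_Sup a_def)
  then obtain q where "q \<in> wind_set X r" and qa: "a - \<delta> < q"
    using less_cSupD[of "wind_set X r"] const_hom[OF X(1,3), of r] by blast
  then obtain n k f where q: "q = real k / real n" and n: "1 \<le> n" "2 * k < n"
    and hom: "cyclic_hom n (Cnk n k) (card X) (vr_edge True X r) f" by (auto simp: wind_set_def)
  have "\<delta> < a" unfolding a_def by (rule \<delta>(3))
  have "k \<noteq> 0"
  proof
    assume "k = 0"
    then have "q = 0" using q by simp
    then show False using qa \<open>\<delta> < a\<close> by linarith
  qed
  then have k: "1 \<le> k" by simp
  obtain \<Phi> where \<Phi>: "\<And>i j. i \<le> j \<Longrightarrow> \<Phi> i \<le> \<Phi> j" "\<And>i. \<Phi> (i + n) = \<Phi> i + 1"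
    "\<And>i. \<Phi> (i + k) < \<Phi> i + r" "\<And>i. \<exists>x\<in>X. \<exists>z::nat. \<Phi> i = x + real z"
    using hom_lift[OF X(1,2) r hom k n(2)] by metis
  define K where "K = (2 * l + 1) * k"
  \<comment> \<open>Averaging: \<open>n\<close> consecutive blocks of \<open>K\<close> indices make
    \<open>K\<close> full turns, so not all of them can advance by less than
    \<open>K / n = L * q\<close>.\<close>
  have "\<exists>i. \<Phi> i + L * q \<le> \<Phi> (i + K)"
  proof (rule ccontr)
    assume "\<not> ?thesis"
    then have lt: "\<Phi> (i + K) < \<Phi> i + L * q" for i by (simp add: not_le)
    have step: "\<Phi> (0 + Suc j * K) < \<Phi> 0 + real (Suc j) * (L * q)" for j
    proof (induction j)
      case (Suc j)
      have "\<Phi> (0 + Suc (Suc j) * K) = \<Phi> (Suc j * K + K)" by (simp add: algebra_simps)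
      also have "\<dots> < \<Phi> (Suc j * K) + L * q" by (rule lt)
      finally show ?case using Suc by (simp add: algebra_simps)
    qed (use lt[of 0] in simp)
    have "\<Phi> (0 + n * K) < \<Phi> 0 + real n * (L * q)" using step[of "n - 1"] n by simp
    moreover have "real n * (L * q) = real K" using n by (simp add: q K_def L_def algebra_simps)
    moreover have "\<Phi> (0 + K * n) = \<Phi> 0 + real K" using periodic_lift[of \<Phi> n 0 K, OF \<Phi>(2)] .
    ultimately show False by (simp add: mult.commute)
  qed
  then obtain i where i: "\<Phi> i + L * q \<le> \<Phi> (i + K)" by blast
  have "\<forall>j. \<exists>x. x \<in> X \<and> (\<exists>z::nat. \<Phi> (i + j * k) = x + real z)" using \<Phi>(4) by blast
  then obtain x where x: "\<And>j. x j \<in> X" "\<And>j. \<exists>z::nat. \<Phi> (i + j * k) = x j + real z" by metis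
  show ?thesis
  proof (intro exI[of _ x] allI impI conjI x(1))
    fix j assume j: "j \<le> 2 * l"
    obtain z where z: "\<Phi> (i + j * k) = x j + real (z::nat)" using x(2) by blast
    obtain z0 where z0: "\<Phi> i = x 0 + real (z0::nat)" using x(2)[of 0] by auto
    have u: "\<Phi> (i + j * k) \<le> \<Phi> i + real j * r" by (rule steps_less[of \<Phi> k r, OF \<Phi>(3)])
    have "j + (2 * l + 1 - j) = 2 * l + 1" using j by simp
    then have "i + j * k + (2 * l + 1 - j) * k = i + K" unfolding K_def by (metis add.assoc add_mult_distrib)
    then have "\<Phi> (i + K) \<le> \<Phi> (i + j * k) + real (2 * l + 1 - j) * r"
      using steps_less[of \<Phi> k r "i + j * k" "2 * l + 1 - j", OF \<Phi>(3)] by (simp only:)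
    moreover have "real (2 * l + 1 - j) * r = L * r - real j * r"
      using j by (simp add: L_def of_nat_diff algebra_simps)
    ultimately have lo: "\<Phi> i + L * q - L * r + real j * r \<le> \<Phi> (i + j * k)" using i by linarith
    have r': "r = a + \<delta>" using \<delta>(1) by (simp add: a_def)
    have "L * (a - \<delta>) \<le> L * q" using qa L0 by (intro mult_left_mono) auto
    then have "L * q - L * r \<ge> - (2 * L * \<delta>)" by (simp add: r' algebra_simps)
    then have lo': "\<Phi> i + real j * a - 2 * L * \<delta> \<le> \<Phi> (i + j * k)"
    proof -
      have "real j * a \<le> real j * r" unfolding r' using \<delta>(2) by (intro mult_left_mono) auto
      then show ?thesis using lo \<open>L * q - L * r \<ge> - (2 * L * \<delta>)\<close> by linarith
    qed
    have "real j * \<delta> \<le> 2 * L * \<delta>" using j \<delta>(2) by (intro mult_right_mono) (auto simp: L_def)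
    then have up': "\<Phi> (i + j * k) \<le> \<Phi> i + real j * a + 2 * L * \<delta>"
      using u by (simp add: r' algebra_simps)
    have LL: "2 * L = real (4 * l + 2)" by (simp add: L_def)
    show "\<exists>z::int. \<bar>x j - x 0 - real j * (real l / real (2 * l + 1)) + of_int z\<bar> \<le> real (4 * l + 2) * \<delta>"
      unfolding LL[symmetric] a_def[symmetric]
      by (rule exI[of _ "int z - int z0"]) (use lo' up' z z0 in auto)
  qed
qed

section \<open>Lower bounds for the winding by constructing homomorphisms\<close>

lemma cyc_interval_segment:
  assumes "a \<le> b" "b < n"
  shows "cyc_interval n {a..b}"
proof -
  have "{a..b} = {(a + i) mod n |i. i < b - a + 1}"
  proof (intro equalityI subsetI)
    fix v assume "v \<in> {a..b}"
    then have "v = (a + (v - a)) mod n" "v - a < b - a + 1" using assms by auto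
    then show "v \<in> {(a + i) mod n |i. i < b - a + 1}" by blast
  next
    fix v assume "v \<in> {(a + i) mod n |i. i < b - a + 1}"
    then obtain i where i: "v = (a + i) mod n" "i < b - a + 1" by blast
    then have "v = a + i" using assms by simp
    then show "v \<in> {a..b}" using i assms by simp
  qed
  then show ?thesis unfolding cyc_interval_def using assms
    by (intro disjI2 exI[of _ a] conjI exI[of _ "b - a + 1"]) auto
qed

text \<open>Converse to \<open>hom_lift\<close>: a monotone choice of points whose lift advances by
  less than \<open>r\<close> over \<open>k\<close> indices is a cyclic homomorphism. By monotonicity
  it is enough to control the longest edges.\<close>

lemma wf_ge_of_monotone:
  assumes X: "finite X" "X \<subseteq> {0..<1}" and r: "0 < r" "r < 1" and n: "1 \<le> n" "2 * k < n"
    and pX: "\<And>i. i < n \<Longrightarrow> p i \<in> X" and mono: "\<And>i j. i \<le> j \<Longrightarrow> j < n \<Longrightarrow> p i \<le> p j"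
    and step: "\<And>i. i < n \<Longrightarrow> p ((i + k) mod n) + real ((i + k) div n) < p i + r"
    and nonconst: "1 \<le> k \<Longrightarrow> \<exists>i<n. \<exists>j<n. p i \<noteq> p j"
  shows "real k / real n \<le> wf True X r"
proof -
  define xs where "xs = sorted_list_of_set X"
  define m where "m = card X"
  have len: "length xs = m" and set_xs: "set xs = X" using X by (simp_all add: xs_def m_def)
  define f where "f i = (SOME j. j < m \<and> xs ! j = p i)" for i
  have f: "f i < m" "xs ! f i = p i" if "i < n" for i
  proof -
    have "\<exists>j. j < m \<and> xs ! j = p i" using pX[OF that] set_xs len by (metis in_set_conv_nth)
    from someI_ex[OF this] show "f i < m" "xs ! f i = p i" by (auto simp: f_def)
  qed
  have strict: "xs ! i < xs ! j" if "i < j" "j < m" for i j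
    using that len sorted_wrt_nth_less[of "(<)" xs i j] by (simp add: xs_def)
  have f_mono: "f i \<le> f j" if "i \<le> j" "j < n" for i j
  proof (rule ccontr)
    assume "\<not> f i \<le> f j"
    then have "xs ! f j < xs ! f i" using f(1)[of i] that by (intro strict) auto
    then show False using mono[OF that] f(2)[of i] f(2)[of j] that by simp
  qed
  have p01: "p i \<in> {0..<1}" if "i < n" for i using pX[OF that] X by blast
  have "cyclic_hom n (Cnk n k) m (vr_edge True X r) f"
    unfolding cyclic_hom_def
  proof (intro conjI allI impI)
    show "f v < m" if "v < n" for v using f(1)[OF that] .
  next
    fix v w assume v: "v < n" and w: "w < n" and E: "Cnk n k v w"
    define t where "t = (w + n - v) mod n"
    have t: "0 < t" "t \<le> k" using E by (auto simp: Cnk_def t_def)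
    have wt: "w = (v + t) mod n"
    proof -
      have "(v + t) mod n = (v + (w + n - v)) mod n" by (simp add: t_def mod_add_right_eq)
      also have "v + (w + n - v) = w + n" using v by simp
      finally show ?thesis using w by simp
    qed
    have P_mono: "p ((v + t) mod n) + real ((v + t) div n) \<le> p ((v + k) mod n) + real ((v + k) div n)"
    proof (cases "(v + t) div n = (v + k) div n")
      case True
      have "(v + t) mod n \<le> (v + k) mod n"
        using t(2) True by (metis add_le_cancel_left div_mult_mod_eq)
      then show ?thesis using True mono[of "(v + t) mod n" "(v + k) mod n"] n by simp
    next
      case False
      then have "Suc ((v + t) div n) \<le> (v + k) div n" using div_le_mono[of "v + t" "v + k" n] t(2) by simp
      then have "real ((v + t) div n) + 1 \<le> real ((v + k) div n)" by linarith
      moreover have "p ((v + t) mod n) < 1" "0 \<le> p ((v + k) mod n)"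
        using p01[of "(v + t) mod n"] p01[of "(v + k) mod n"] n by auto
      ultimately show ?thesis by linarith
    qed
    have lo: "p v \<le> p ((v + t) mod n) + real ((v + t) div n)"
    proof (cases "v + t < n")
      case True
      then show ?thesis using mono[of v "v + t"] by simp
    next
      case False
      then have "1 \<le> (v + t) div n" using n by (simp add: div_greater_zero_iff Suc_le_eq)
      then have "1 \<le> real ((v + t) div n)" by simp
      moreover have "p v < 1" "0 \<le> p ((v + t) mod n)"
        using p01[OF v] p01[of "(v + t) mod n"] n by auto
      ultimately show ?thesis by linarith
    qed
    have cd: "cdist (p v) (p w) = p ((v + t) mod n) + real ((v + t) div n) - p v"
    proof (rule cdist_unique)
      show "p w - p v = p ((v + t) mod n) + real ((v + t) div n) - p v + of_int (- int ((v + t) div n))"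
        by (simp add: wt)
    qed (use lo P_mono step[OF v] r in linarith)+
    then have cr: "cdist (p v) (p w) < r" using P_mono step[OF v] by linarith
    show "f v = f w \<or> vr_edge True X r (f v) (f w)"
    proof (cases "p v = p w")
      case True
      then show ?thesis by (simp add: f_def)
    next
      case False
      then have "0 < cdist (p v) (p w)" using cdist_eq[OF p01[OF v] p01[OF w]] p01[OF v] p01[OF w] by auto
      then show ?thesis using cr f[OF v] f[OF w] len by (simp add: vr_edge_def Let_def xs_def)
    qed
  next
    fix y
    show "cyc_interval n {v. v < n \<and> f v = y}"
    proof (cases "{v. v < n \<and> f v = y} = {}")
      case False
      let ?F = "{v. v < n \<and> f v = y}"
      have fin: "finite ?F" by simp
      have mM: "Min ?F \<in> ?F" "Max ?F \<in> ?F" using Min_in[OF fin False] Max_in[OF fin False] by auto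
      have "?F = {Min ?F..Max ?F}"
      proof (intro equalityI subsetI)
        fix v assume "v \<in> ?F"
        then show "v \<in> {Min ?F..Max ?F}" using fin by (simp add: Min_le Max_ge)
      next
        fix v assume v: "v \<in> {Min ?F..Max ?F}"
        then have "v < n" using mM(2) by (simp add: le_less_trans)
        moreover have "f (Min ?F) \<le> f v" by (rule f_mono) (use v \<open>v < n\<close> in auto)
        moreover have "f v \<le> f (Max ?F)" by (rule f_mono) (use v mM(2) in auto)
        ultimately show "v \<in> ?F" using mM by simp
      qed
      moreover have "Min ?F \<le> Max ?F" using fin mM(2) by (intro Min_le) auto
      ultimately show ?thesis using cyc_interval_segment[of "Min ?F" "Max ?F" n] mM(2) by simp
    qed (simp add: cyc_interval_def)
  next
    fix s s' s'' assume s: "s < n" "s' < n" "s'' < n" and c: "cyc_btw m (f s) (f s') (f s'')"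
    have lt: "u < v" if "f u < f v" "u < n" "v < n" for u v
      using f_mono[of v u] that by (meson leD leI)
    show "cyc_btw n s s' s''"
      using c s lt unfolding cyc_btw_iff by blast
  next
    assume cyc: "\<exists>v<n. (\<lambda>a b. a < n \<and> b < n \<and> Cnk n k a b)\<^sup>+\<^sup>+ v v"
    have k1: "1 \<le> k"
    proof (rule ccontr)
      assume "\<not> 1 \<le> k"
      then have "k = 0" by simp
      have no: "\<not> Cnk n k a b" for a b
      proof
        assume "Cnk n k a b"
        then have "0 < (b + n - a) mod n" "(b + n - a) mod n \<le> k" unfolding Cnk_def by blast+
        then have "0 < k" by (rule less_le_trans)
        then show False using \<open>k = 0\<close> by simp
      qed
      obtain v where "(\<lambda>a b. a < n \<and> b < n \<and> Cnk n k a b)\<^sup>+\<^sup>+ v v" using cyc by blast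
      then show False by (cases rule: tranclp.cases) (use no in auto)
    qed
    then obtain i j where ij: "i < n" "j < n" "p i \<noteq> p j" using nonconst by blast
    then have "f i \<noteq> f j" using f(2)[of i] f(2)[of j] by auto
    then show "\<not> (\<exists>c. \<forall>v<n. f v = c)" using ij by metis
  qed
  then have "real k / real n \<in> wind_set X r" unfolding wind_set_def m_def using n by blast
  then show ?thesis unfolding wf_eq_Sup by (rule cSup_upper[OF _ wind_set_bdd])
qed

text \<open>A rational \<open>k / n\<close> between \<open>a\<close> and \<open>r - g\<close> is
  realised by rounding the equally spaced points \<open>x0 + i / n\<close> down to points of
  \<open>X\<close>. Density keeps the rounding error below \<open>g\<close>, so \<open>k\<close>
  indices advance by less than \<open>k / n + g < r\<close>.\<close>

lemma wf_gt_of_dense: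
  assumes X: "finite X" "X \<subseteq> {0..<1}" "circle_dense g X" and r: "r < 1/2" and a: "0 \<le> a" "a + g < r" and g: "0 < g"
  shows "a < wf True X r"
proof -
  obtain q where q: "q \<in> \<rat>" "a < q" "q < r - g" using Rats_dense_in_real[of a "r - g"] a by auto
  then have q0: "0 < q" using a by simp
  obtain k n where kn: "n \<noteq> 0" "q = real k / real n"
    using q(1) q0 by (metis Rats_abs_nat_div_natE abs_of_pos)
  have n1: "1 \<le> n" using kn by simp
  have k1: "1 \<le> k" using q0 kn by (cases k) auto
  have "real k / real n < 1/2" using q r g kn by linarith
  then have kn2: "2 * k < n" using n1 by (simp add: field_simps)
  have Xne: "X \<noteq> {}" using X(3) by (force simp: circle_dense_def)
  \<comment> \<open>Starting at the smallest point keeps the sets whose maxima are taken below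
    nonempty.\<close>
  define x0 where "x0 = Min X"
  have x0: "x0 \<in> X" "\<And>x. x \<in> X \<Longrightarrow> x0 \<le> x" using X Xne by (auto simp: x0_def)
  define p where "p i = Max {x \<in> X. x \<le> x0 + real i / real n}" for i
  have fin: "finite {x \<in> X. x \<le> x0 + real i / real n}" for i using X by simp
  have ne: "x0 \<in> {x \<in> X. x \<le> x0 + real i / real n}" for i using x0 by simp
  have "p i \<in> {x \<in> X. x \<le> x0 + real i / real n}" for i
    unfolding p_def by (rule Max_in[OF fin]) (use ne in blast)
  then have p: "p i \<in> X" "p i \<le> x0 + real i / real n" for i by auto
  have p_max: "x \<le> p i" if "x \<in> X" "x \<le> x0 + real i / real n" for x i
    unfolding p_def using that fin by (intro Max_ge) auto
  have lower: "x0 + real i / real n - g < p i" if i: "i < n" for i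
  proof (rule ccontr)
    assume c: "\<not> x0 + real i / real n - g < p i"
    have p01: "p i \<in> {0..<1}" using p(1) X by blast
    obtain x where x: "x \<in> X" "0 < cdist (p i) x" "cdist (p i) x < g"
      using X(3) p01 unfolding circle_dense_def by blast
    have x01: "x \<in> {0..<1}" using x X by blast
    have i1: "real i / real n < 1" using i by simp
    show False
    proof (cases "p i \<le> x")
      case True
      then have "cdist (p i) x = x - p i" using cdist_eq[OF p01 x01] by simp
      then show False using x c p_max[of x i] by simp
    next
      case False
      then have "cdist (p i) x = x - p i + 1" using cdist_eq[OF p01 x01] by simp
      then show False using x c x0(2)[OF x(1)] i1 by simp
    qed
  qed
  have "real k / real n \<le> wf True X r"
  proof (rule wf_ge_of_monotone[OF X(1,2) _ _ n1 kn2])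
    show "0 < r" "r < 1" using a g r by linarith+
    show "p i \<in> X" for i by (rule p)
    show "p i \<le> p j" if "i \<le> j" "j < n" for i j
    proof (rule p_max[OF p(1)])
      have "real i / real n \<le> real j / real n" using that by (simp add: divide_right_mono)
      then show "p i \<le> x0 + real j / real n" using p(2)[of i] by linarith
    qed
    show "p ((i + k) mod n) + real ((i + k) div n) < p i + r" if i: "i < n" for i
    proof -
      have "real ((i + k) mod n) / real n = real (i + k) / real n - real ((i + k) div n)"
        by (rule real_mod_div) (use n1 in simp)
      then have "p ((i + k) mod n) + real ((i + k) div n) \<le> x0 + real (i + k) / real n"
        using p(2)[of "(i + k) mod n"] by linarith
      also have "\<dots> = x0 + real i / real n + q" by (simp add: kn add_divide_distrib)
      also have "\<dots> < p i + r" using lower[OF i] q by linarith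
      finally show ?thesis .
    qed
    show "\<exists>i<n. \<exists>j<n. p i \<noteq> p j"
    proof -
      have x001: "x0 \<in> {0..<1}" using x0 X by blast
      obtain x where x: "x \<in> X" "0 < cdist x0 x" "cdist x0 x < g"
        using X(3) x001 unfolding circle_dense_def by blast
      have "x \<in> {0..<1}" using x X by blast
      then have cx: "cdist x0 x = x - x0" using cdist_eq[OF x001] x0(2)[OF x(1)] by simp
      have "p 0 \<le> x0" using p(2)[of 0] by simp
      have n2: "2 \<le> n" using kn2 k1 by simp
      have "1/2 \<le> real (n - 1) / real n" using n2 by (simp add: field_simps of_nat_diff)
      then have "x \<le> x0 + real (n - 1) / real n" using x cx a r by linarith
      then have "x \<le> p (n - 1)" using x by (intro p_max) auto
      then have "p 0 \<noteq> p (n - 1)" using x cx \<open>p 0 \<le> x0\<close> by linarith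
      then show ?thesis using n1 by (intro exI[of _ 0] conjI exI[of _ "n - 1"]) auto
    qed
  qed
  then show ?thesis using q kn by simp
qed

text \<open>With one point in each of \<open>2 * l + 1\<close> equally spaced cells, advancing by
  \<open>l\<close> indices moves \<open>l / (2 * l + 1)\<close> of a turn up to an error below one
  cell width.\<close>

lemma wf_ge_of_cells:
  assumes X: "finite X" "X \<subseteq> {0..<1}" and r: "0 < r" "r < 1" and M: "0 < M"
    and p: "\<And>s. s < 2 * l + 1 \<Longrightarrow> p s \<in> X \<and> real (s * M + c) / real ((2 * l + 1) * M) \<le> p s \<and>
      p s < real (s * M + c + 1) / real ((2 * l + 1) * M)"
    and cM: "real l / real (2 * l + 1) + 1 / real ((2 * l + 1) * M) \<le> r"
  shows "real l / real (2 * l + 1) \<le> wf True X r"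
proof (rule wf_ge_of_monotone[OF X r])
  let ?n = "2 * l + 1"
  define D where "D = real (?n * M)"
  have D0: "0 < D" unfolding D_def of_nat_0_less_iff using M by simp
  have lo: "real (s * M + c) / D \<le> p s" and hi: "p s < real (s * M + c + 1) / D" if "s < ?n" for s
    using p[OF that] by (simp_all add: D_def)
  show "p i \<in> X" if "i < ?n" for i using p[OF that] by blast
  have less: "p i < p j" if "i < j" "j < ?n" for i j
  proof -
    have "i * M + c + 1 \<le> j * M + c"
    proof -
      have "(i + 1) * M \<le> j * M" using that by (intro mult_le_mono1) simp
      then show ?thesis using M by (simp add: algebra_simps)
    qed
    then have "real (i * M + c + 1) / D \<le> real (j * M + c) / D"
      using D0 by (intro divide_right_mono) (simp_all only: of_nat_le_iff less_imp_le)
    then show ?thesis using hi[of i] lo[of j] that by linarith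
  qed
  show "p i \<le> p j" if "i \<le> j" "j < ?n" for i j using less[of i j] that by (cases "i = j") auto
  show "p ((i + l) mod ?n) + real ((i + l) div ?n) < p i + r" if i: "i < ?n" for i
  proof -
    let ?q = "(i + l) mod ?n" and ?d = "(i + l) div ?n"
    have "?q < ?n" by simp
    from hi[OF this] have 1: "p ?q < real (?q * M + c + 1) / D" .
    have "?q * M + ?d * (?n * M) = (i + l) * M"
      by (metis add.commute add_mult_distrib div_mult_mod_eq mult.assoc)
    then have "real (?q * M + c + 1) + real ?d * D = real (i * M + c) + real (l * M) + 1"
      unfolding D_def by (metis (no_types, opaque_lifting) ab_semigroup_add_class.add_ac(1) add.commute add_mult_distrib of_nat_1 of_nat_add of_nat_mult)
    then have "real (?q * M + c + 1) / D + real ?d = real (i * M + c) / D + (real (l * M) / D + 1 / D)"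
      using D0 by (simp add: field_simps)
    moreover have "real (l * M) / D = real l / real ?n" 
      unfolding D_def of_nat_mult by (rule mult_divide_mult_cancel_right) (use M in simp)
    ultimately show ?thesis using 1 lo[OF i] cM unfolding D_def by linarith
  qed
  show "\<exists>i<?n. \<exists>j<?n. p i \<noteq> p j" if "1 \<le> l"
    using less[of 0 1] that by (intro exI[of _ 0] conjI exI[of _ 1]) auto
qed auto

section \<open>Hitting times of the random process\<close>

abbreviation unif :: "real measure" where
  "unif \<equiv> uniform_measure lborel {0..<1}"

lemma prob_space_unif: "prob_space unif"
  by (rule prob_space_uniform_measure) auto

interpretation circ: product_prob_space "\<lambda>_::nat. unif" UNIV
  by (intro product_prob_spaceI prob_space_unif)

lemma space_circle [simp]: "space circle_process = UNIV"
  by (simp add: circle_process_def space_PiM)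

lemma prob_space_circle: "prob_space circle_process"
  unfolding circle_process_def by (rule circ.P.prob_space_axioms)

interpretation C: prob_space circle_process
  by (rule prob_space_circle)

lemma sets_unif [simp]: "sets unif = sets borel"
  by simp

lemma sets_coord:
  assumes "i \<in> K" "S \<in> sets borel"
  shows "{y \<in> space (PiM K (\<lambda>_. unif)). y i \<in> S} \<in> sets (PiM K (\<lambda>_. unif))"
  by (rule sets_Collect_single'[OF assms(1)]) (use assms(2) in simp)

lemma sets_circle_coord:
  assumes "S \<in> sets borel"
  shows "{\<omega>. \<omega> i \<in> S} \<in> sets circle_process"
  using sets_coord[of i UNIV S] assms by (simp add: circle_process_def space_PiM)

lemma prob_cylinder:
  assumes "finite J" "\<And>i. i \<in> J \<Longrightarrow> S i \<in> sets borel"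
  shows "C.prob {\<omega>. \<forall>i\<in>J. \<omega> i \<in> S i} = (\<Prod>i\<in>J. measure unif (S i))"
proof -
  have "emeasure (PiM UNIV (\<lambda>_. unif)) {x \<in> space (PiM UNIV (\<lambda>_. unif)). \<forall>i\<in>J. x i \<in> S i} = (\<Prod>i\<in>J. emeasure unif (S i))"
    by (rule circ.emeasure_PiM_Collect) (use assms in auto)
  then have "emeasure circle_process {\<omega>. \<forall>i\<in>J. \<omega> i \<in> S i} = (\<Prod>i\<in>J. emeasure unif (S i))"
    by (simp add: circle_process_def space_PiM)
  also have "\<dots> = ennreal (\<Prod>i\<in>J. measure unif (S i))"
    by (simp add: circ.M.emeasure_eq_measure prod_ennreal)
  finally show ?thesis by (simp add: measure_def prod_nonneg)
qed

lemma AE_circle: "AE \<omega> in circle_process. \<forall>i. \<omega> i \<in> {0..<1}"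
proof -
  have "AE \<omega> in circle_process. \<omega> i \<in> {0..<1}" for i
  proof -
    have "measure unif {0..<1::real} = 1" by (subst measure_uniform_measure) auto
    then have "C.prob {\<omega>. \<omega> i \<in> {0..<1}} = 1"
      using prob_cylinder[of "{i}" "\<lambda>_. {0..<1}"] by simp
    from C.AE_prob_1[OF this] show ?thesis by simp
  qed
  then show ?thesis by (simp add: AE_all_countable)
qed

section \<open>Equal cells and the event of missing them\<close>

definition cell :: "nat \<Rightarrow> nat \<Rightarrow> real set" where
  "cell D c = {real c / real D ..< real (c + 1) / real D}"

lemma cell_borel [measurable, simp]: "cell D c \<in> sets borel"
  by (simp add: cell_def)

lemma cell_disjoint:
  assumes "c \<noteq> c'" "0 < D"
  shows "cell D c \<inter> cell D c' = {}"
proof -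
  have "cell D c \<inter> cell D c' = {}" if "c < c'" for c c'
  proof -
    have "real (c + 1) / real D \<le> real c' / real D" using that by (intro divide_right_mono) auto
    then show ?thesis by (auto simp: cell_def)
  qed
  then show ?thesis using assms by (metis Int_commute linorder_neqE_nat)
qed

lemma cell_subset: "c < D \<Longrightarrow> cell D c \<subseteq> {0..<1}"
proof
  fix x assume c: "c < D" and x: "x \<in> cell D c"
  have "real (c + 1) / real D \<le> 1" using c by simp
  moreover have "0 \<le> real c / real D" by simp
  ultimately show "x \<in> {0..<1}" using x unfolding cell_def by (metis atLeastLessThan_iff order_less_le_trans order_trans)
qed

lemma cell_cover:
  assumes "x \<in> {0..<1}" "0 < D"
  obtains c where "c < D" "x \<in> cell D c"
proof -
  define c where "c = nat \<lfloor>x * real D\<rfloor>"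
  have "0 \<le> x * real D" using assms by auto
  then have c: "real c \<le> x * real D" "x * real D < real c + 1" unfolding c_def by linarith+
  have "x * real D < real D" using assms by auto
  then have "c < D" using c by linarith
  moreover have "x \<in> cell D c" using c assms by (simp add: cell_def field_simps)
  ultimately show ?thesis using that by blast
qed

lemma measure_cells:
  assumes D: "0 < D" and C: "C \<subseteq> {..<D}"
  shows "measure unif (\<Union>c\<in>C. cell D c) = real (card C) / real D"
proof -
  have fin: "finite C" using C finite_subset by blast
  have 1: "measure unif (cell D c) = 1 / real D" if "c < D" for c
  proof -
    have "{0..<1} \<inter> cell D c = cell D c" using cell_subset[OF that] by blast
    then have "measure unif (cell D c) = measure lborel (cell D c)"
      by (subst measure_uniform_measure) auto
    also have "\<dots> = 1 / real D" unfolding cell_def using D by (simp add: divide_right_mono diff_divide_distrib[symmetric])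
    finally show ?thesis .
  qed
  have "measure unif (\<Union>c\<in>C. cell D c) = (\<Sum>c\<in>C. measure unif (cell D c))"
    by (rule circ.M.finite_measure_finite_Union[OF fin])
      (use cell_disjoint D in \<open>auto simp: disjoint_family_on_def\<close>)
  also have "\<dots> = (\<Sum>c\<in>C. 1 / real D)" by (intro sum.cong refl, rule 1) (use C in blast)
  finally show ?thesis by simp
qed

definition avoids :: "nat \<Rightarrow> nat set \<Rightarrow> nat set \<Rightarrow> (nat \<Rightarrow> real) \<Rightarrow> bool" where
  "avoids D J C \<omega> \<longleftrightarrow> (\<forall>i\<in>J. \<omega> i \<notin> (\<Union>c\<in>C. cell D c))"

lemma avoids_sets:
  assumes "finite J" "J \<subseteq> K" "finite C"
  shows "{y \<in> space (PiM K (\<lambda>_. unif)). avoids D J C y} \<in> sets (PiM K (\<lambda>_. unif))"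
  unfolding avoids_def
proof (intro sets.sets_Collect_finite_All sets.sets_Collect_neg assms)
  fix i assume "i \<in> J"
  then show "{x \<in> space (PiM K (\<lambda>_. unif)). x i \<in> (\<Union>c\<in>C. cell D c)} \<in> sets (PiM K (\<lambda>_. unif))"
    using assms by (intro sets_coord) auto
qed

lemma avoids_circle_sets [measurable]:
  "finite J \<Longrightarrow> finite C \<Longrightarrow> {\<omega>. avoids D J C \<omega>} \<in> sets circle_process"
  using avoids_sets[of J UNIV C D] by (simp add: circle_process_def space_PiM)

lemma prob_avoids:
  assumes "0 < D" "finite J" "C \<subseteq> {..<D}"
  shows "C.prob {\<omega>. avoids D J C \<omega>} = (1 - real (card C) / real D) ^ card J"
proof -
  let ?S = "- (\<Union>c\<in>C. cell D c)"
  have fin: "finite C" using assms finite_subset by blast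
  have U: "(\<Union>c\<in>C. cell D c) \<in> sets unif" using fin by auto
  have "measure unif ?S = 1 - real (card C) / real D"
    using circ.M.prob_compl[OF U] measure_cells[OF assms(1,3)] by (simp add: Compl_eq_Diff_UNIV)
  moreover have S: "?S \<in> sets borel" using U unfolding sets_unif by (rule borel_comp)
  have "{\<omega>. avoids D J C \<omega>} = {\<omega>. \<forall>i\<in>J. \<omega> i \<in> ?S}" by (auto simp: avoids_def)
  then have "C.prob {\<omega>. avoids D J C \<omega>} = (\<Prod>i\<in>J. measure unif ?S)"
    using prob_cylinder[of J "\<lambda>_. ?S", OF assms(2) S] by (simp only:)
  ultimately show ?thesis by simp
qed

text \<open>If \<open>W\<close> counts the events \<open>A c\<close> that occur, the indicator of
  \<open>B\<close> is at most \<open>(1 - t * W) ^ 2\<close>, because \<open>W\<close> vanishes on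
  \<open>B\<close>. The value \<open>t = 1 / (1 + \<mu>)\<close> minimises the resulting bound; the
  correlations enter only pairwise.\<close>

lemma (in prob_space) second_moment:
  assumes fin: "finite I" and A: "\<And>c. c \<in> I \<Longrightarrow> A c \<in> events"
    and p: "\<And>c. c \<in> I \<Longrightarrow> prob (A c) = p"
    and p2: "\<And>c c'. c \<in> I \<Longrightarrow> c' \<in> I \<Longrightarrow> c \<noteq> c' \<Longrightarrow> prob (A c \<inter> A c') \<le> p\<^sup>2"
    and B: "B \<in> events" "B \<inter> (\<Union>c\<in>I. A c) = {}" and p0: "0 \<le> p"
  shows "prob B \<le> 1 / (1 + real (card I) * p)"
proof -
  define \<mu> where "\<mu> = real (card I) * p"
  have \<mu>: "0 \<le> \<mu>" using p0 by (simp add: \<mu>_def)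
  define t where "t = 1 / (1 + \<mu>)"
  define W where "W x = (\<Sum>c\<in>I. indicat_real (A c) x)" for x
  have intI: "integrable M (indicat_real E)" if "E \<in> events" for E
    using that by (simp add: emeasure_eq_measure)
  have intW: "integrable M W" unfolding W_def using A intI by (intro Bochner_Integration.integrable_sum) auto
  have EW: "(\<integral>x. W x \<partial>M) = \<mu>"
    unfolding W_def using A intI p by (subst Bochner_Integration.integral_sum) (auto simp: \<mu>_def)
  have W2: "(W x)\<^sup>2 = (\<Sum>c\<in>I. \<Sum>c'\<in>I. indicat_real (A c \<inter> A c') x)" for x
    unfolding W_def power2_eq_square sum_product by (simp add: indicator_inter_arith)
  have intW2: "integrable M (\<lambda>x. (W x)\<^sup>2)"
    unfolding W2 using A intI by (intro Bochner_Integration.integrable_sum) auto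
  have "(\<integral>x. (W x)\<^sup>2 \<partial>M) = (\<Sum>c\<in>I. \<Sum>c'\<in>I. prob (A c \<inter> A c'))"
    unfolding W2 using A intI by (simp add: Bochner_Integration.integral_sum Bochner_Integration.integrable_sum sets.Int)
  also have "\<dots> \<le> (\<Sum>c\<in>I. \<Sum>c'\<in>I. (if c = c' then p else 0) + p\<^sup>2)"
    using p p2 p0 by (intro sum_mono) (auto intro!: add_nonneg_nonneg)
  also have "\<dots> = \<mu> + \<mu>\<^sup>2"
    using fin by (simp add: sum.distrib \<mu>_def power2_eq_square algebra_simps)
  finally have EW2: "(\<integral>x. (W x)\<^sup>2 \<partial>M) \<le> \<mu> + \<mu>\<^sup>2" .
  have "prob B = (\<integral>x. indicat_real B x \<partial>M)" using B by simp
  also have "\<dots> \<le> (\<integral>x. 1 - 2 * t * W x + t\<^sup>2 * (W x)\<^sup>2 \<partial>M)"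
  proof (rule integral_mono)
    fix x assume "x \<in> space M"
    have sq: "1 - 2 * t * W x + t\<^sup>2 * (W x)\<^sup>2 = (1 - t * W x)\<^sup>2" by (simp add: power2_eq_square algebra_simps)
    show "indicat_real B x \<le> 1 - 2 * t * W x + t\<^sup>2 * (W x)\<^sup>2"
    proof (cases "x \<in> B")
      case True
      then have "indicat_real (A c) x = 0" if "c \<in> I" for c using B(2) that by (auto simp: indicator_def)
      then have "W x = 0" by (simp add: W_def)
      then show ?thesis using True by simp
    next
      case False
      then show ?thesis unfolding sq by simp
    qed
  qed (use intI[OF B(1)] intW intW2 in auto)
  also have "\<dots> = 1 - 2 * t * \<mu> + t\<^sup>2 * (\<integral>x. (W x)\<^sup>2 \<partial>M)"
    using intW intW2 EW by (simp add: prob_space)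
  also have "\<dots> \<le> 1 - 2 * t * \<mu> + t\<^sup>2 * (\<mu> + \<mu>\<^sup>2)" using EW2 by (simp add: mult_left_mono)
  also have "t\<^sup>2 * (\<mu> + \<mu>\<^sup>2) = t * \<mu>"
  proof -
    have "t * (1 + \<mu>) = 1" using \<mu> by (simp add: t_def)
    moreover have "t\<^sup>2 * (\<mu> + \<mu>\<^sup>2) = t * \<mu> * (t * (1 + \<mu>))" by (simp add: power2_eq_square algebra_simps)
    ultimately show ?thesis by simp
  qed
  also have "1 - 2 * t * \<mu> + t * \<mu> = 1 / (1 + \<mu>)" using \<mu> by (simp add: t_def field_simps)
  finally show ?thesis by (simp add: \<mu>_def)
qed

section \<open>Expected hitting times from tail bounds\<close>

lemma hit_time_le:
  assumes "1 \<le> n" "Pr (Xn \<omega> n)"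
  shows "hit_time Pr \<omega> \<le> of_nat n"
proof -
  have "\<exists>n\<ge>1. Pr (Xn \<omega> n)" using assms by blast
  moreover have "(LEAST n. n \<ge> 1 \<and> Pr (Xn \<omega> n)) \<le> n" using assms by (intro Least_le) auto
  ultimately show ?thesis by (simp add: hit_time_def)
qed

lemma hit_time_ge:
  assumes "\<And>n. 1 \<le> n \<Longrightarrow> n \<le> N \<Longrightarrow> \<not> Pr (Xn \<omega> n)"
  shows "of_nat (N + 1) \<le> hit_time Pr \<omega>"
proof (cases "\<exists>n\<ge>1. Pr (Xn \<omega> n)")
  case True
  then have "(LEAST n. n \<ge> 1 \<and> Pr (Xn \<omega> n)) \<ge> 1 \<and> Pr (Xn \<omega> (LEAST n. n \<ge> 1 \<and> Pr (Xn \<omega> n)))"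
    by (metis (mono_tags, lifting) LeastI_ex)
  then have "N + 1 \<le> (LEAST n. n \<ge> 1 \<and> Pr (Xn \<omega> n))" using assms by (metis Suc_eq_plus1 not_less_eq_eq)
  then show ?thesis using True unfolding hit_time_def by (simp only: if_True of_nat_le_iff)
next
  case False
  then show ?thesis unfolding hit_time_def by (simp only: if_False infinity_ennreal_def top_greatest)
qed

lemma expected_hit_lower:
  assumes G: "G \<in> sets circle_process" "1/2 \<le> C.prob G"
    and none: "AE \<omega> in circle_process. \<omega> \<in> G \<longrightarrow> (\<forall>n. 1 \<le> n \<and> n \<le> N \<longrightarrow> \<not> Pr (Xn \<omega> n))"
  shows "ennreal (real (N + 1) / 2) \<le> expected_hit Pr"
proof -
  have "ennreal (real (N + 1) / 2) \<le> ennreal (real (N + 1) * C.prob G)"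
  proof (rule ennreal_leI)
    have "real (N + 1) * (1/2) \<le> real (N + 1) * C.prob G" using G(2) by (intro mult_left_mono) auto
    then show "real (N + 1) / 2 \<le> real (N + 1) * C.prob G" by simp
  qed
  also have "\<dots> = of_nat (N + 1) * emeasure circle_process G"
    by (simp add: C.emeasure_eq_measure ennreal_mult ennreal_of_nat_eq_real_of_nat del: of_nat_add)
  also have "\<dots> = (\<integral>\<^sup>+ \<omega>. of_nat (N + 1) * indicator G \<omega> \<partial>circle_process)"
    using G(1) by (simp add: nn_integral_cmult_indicator)
  also have "\<dots> \<le> (\<integral>\<^sup>+ \<omega>. hit_time Pr \<omega> \<partial>circle_process)"
  proof (rule nn_integral_mono_AE)
    show "AE \<omega> in circle_process. of_nat (N + 1) * indicator G \<omega> \<le> hit_time Pr \<omega>"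
      using none
    proof eventually_elim
      case (elim \<omega>)
      show ?case
      proof (cases "\<omega> \<in> G")
        case True
        then have "of_nat (N + 1) \<le> hit_time Pr \<omega>" using elim by (intro hit_time_ge) auto
        then show ?thesis using True by simp
      qed simp
    qed
  qed
  finally show ?thesis by (simp add: expected_hit_def)
qed

text \<open>If \<open>J\<close> is the first index with \<open>\<omega> \<notin> B J\<close>, the
  hitting time is at most \<open>(J + 1) * T\<close>, and \<open>J\<close> is at most the number of
  events \<open>B j\<close> that occur. Integrating this count gives a geometric series; where all
  \<open>B j\<close> occur the count is infinite and the bound trivial.\<close>

lemma expected_hit_upper:
  fixes q :: real
  assumes T: "1 \<le> T" and q: "0 \<le> q" "q < 1"
    and B: "\<And>j. B j \<in> sets circle_process" "\<And>j. C.prob (B j) \<le> q ^ Suc j"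
    and hit: "AE \<omega> in circle_process. \<forall>j. \<omega> \<notin> B j \<longrightarrow> (\<exists>n. 1 \<le> n \<and> n \<le> Suc j * T \<and> Pr (Xn \<omega> n))"
  shows "expected_hit Pr \<le> ennreal (real T / (1 - q))"
proof -
  let ?S = "\<lambda>\<omega>. suminf (\<lambda>j. indicator (B j) \<omega> :: ennreal)"
  have pt: "hit_time Pr \<omega> \<le> of_nat T * (1 + ?S \<omega>)"
    if h: "\<forall>j. \<omega> \<notin> B j \<longrightarrow> (\<exists>n. 1 \<le> n \<and> n \<le> Suc j * T \<and> Pr (Xn \<omega> n))" for \<omega>
  proof (cases "\<exists>j. \<omega> \<notin> B j")
    case False
    have "of_nat m \<le> ?S \<omega>" for m
    proof -
      have "(of_nat m :: ennreal) = (\<Sum>j<m. indicator (B j) \<omega>)" using False by simp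
      also have "\<dots> \<le> ?S \<omega>" by (rule sum_le_suminf) auto
      finally show ?thesis .
    qed
    then have "?S \<omega> = \<infinity>" by (metis ennreal_Ex_less_of_nat infinity_ennreal_def leD top.not_eq_extremum)
    then have "of_nat T * (1 + ?S \<omega>) = \<infinity>" using T by (simp add: ennreal_mult_eq_top_iff)
    then show ?thesis by simp
  next
    case True
    define J where "J = (LEAST j. \<omega> \<notin> B j)"
    have J: "\<omega> \<notin> B J" using True unfolding J_def by (metis LeastI)
    have less: "\<omega> \<in> B j" if "j < J" for j using that not_less_Least unfolding J_def by blast
    obtain n where n: "1 \<le> n" "n \<le> Suc J * T" "Pr (Xn \<omega> n)" using h J by blast
    have "(of_nat J :: ennreal) = (\<Sum>j<J. indicator (B j) \<omega>)" using less by simp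
    also have "\<dots> \<le> ?S \<omega>" by (rule sum_le_suminf) auto
    finally have J': "of_nat J \<le> ?S \<omega>" .
    have "hit_time Pr \<omega> \<le> of_nat n" using n by (intro hit_time_le)
    also have "\<dots> \<le> of_nat (Suc J * T)" using n(2) by (simp only: of_nat_le_iff)
    also have "\<dots> = of_nat T * (1 + of_nat J)" by (simp add: distrib_left mult.commute)
    also have "\<dots> \<le> of_nat T * (1 + ?S \<omega>)" using J' by (intro mult_left_mono add_left_mono) auto
    finally show ?thesis .
  qed
  have "expected_hit Pr \<le> (\<integral>\<^sup>+ \<omega>. of_nat T * (1 + ?S \<omega>) \<partial>circle_process)"
    unfolding expected_hit_def using hit by (intro nn_integral_mono_AE) (auto elim!: eventually_mono intro: pt)
  also have "\<dots> = of_nat T * (1 + (\<integral>\<^sup>+ \<omega>. ?S \<omega> \<partial>circle_process))"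
    using B(1) by (simp add: nn_integral_cmult nn_integral_add C.emeasure_space_1[unfolded space_circle])
  also have "(\<integral>\<^sup>+ \<omega>. ?S \<omega> \<partial>circle_process) = suminf (\<lambda>j. emeasure circle_process (B j))"
    using B(1) by (subst nn_integral_suminf) auto
  also have "\<dots> \<le> suminf (\<lambda>j. ennreal (q ^ Suc j))"
  proof (rule suminf_le)
    show "emeasure circle_process (B j) \<le> ennreal (q ^ Suc j)" for j
      unfolding C.emeasure_eq_measure by (rule ennreal_leI) (rule B(2))
  qed auto
  also have "\<dots> = ennreal (q / (1 - q))"
  proof -
    have "(\<lambda>j. q * q ^ j) sums (q * (1 / (1 - q)))" using q by (intro sums_mult geometric_sums) auto
    then show ?thesis using q by (intro suminf_ennreal_eq) (auto simp: field_simps)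
  qed
  finally have "expected_hit Pr \<le> of_nat T * (1 + ennreal (q / (1 - q)))"
    by (simp add: add_left_mono mult_left_mono)
  also have "\<dots> = ennreal (real T * (1 + q / (1 - q)))"
    using q by (simp add: ennreal_of_nat_eq_real_of_nat ennreal_mult ennreal_plus flip: ennreal_1)
  also have "real T * (1 + q / (1 - q)) = real T / (1 - q)" using q by (simp add: field_simps)
  finally show ?thesis .
qed

section \<open>Independence of disjoint blocks of draws, coupon collecting and tuples of
  cells\<close>

lemma indep_coord: "C.indep_vars (\<lambda>_. unif) (\<lambda>i \<omega>. \<omega> i) (UNIV :: nat set)"
proof (subst C.indep_vars_iff_distr_eq_PiM)
  show "(UNIV :: nat set) \<noteq> {}" by simp
  show rv: "C.random_variable unif (\<lambda>\<omega>. \<omega> i)" for i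
    unfolding circle_process_def by (rule measurable_component_singleton) simp
  have 1: "distr circle_process unif (\<lambda>\<omega>. \<omega> i) = unif" for i
    unfolding circle_process_def by (rule circ.PiM_component) simp
  show "distr circle_process (Pi\<^sub>M UNIV (\<lambda>_. unif)) (\<lambda>x. \<lambda>i\<in>UNIV. x i) = Pi\<^sub>M UNIV (\<lambda>i. distr circle_process unif (\<lambda>\<omega>. \<omega> i))"
  proof -
    have "(\<lambda>x::nat \<Rightarrow> real. \<lambda>i\<in>UNIV. x i) = (\<lambda>x. x)" by (simp add: restrict_def)
    then show ?thesis unfolding 1 by (simp add: circle_process_def)
  qed
qed

text \<open>Measurability over the coordinates \<open>K g\<close> together with invariance under
  restriction expresses that \<open>Q g\<close> depends on these coordinates only.\<close>

lemma block_indep: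
  fixes K :: "'i \<Rightarrow> nat set"
  assumes J: "finite J" "J \<noteq> {}" "disjoint_family_on K J"
    and meas: "\<And>g. g \<in> J \<Longrightarrow> {y \<in> space (PiM (K g) (\<lambda>_. unif)). Q g y} \<in> sets (PiM (K g) (\<lambda>_. unif))"
    and loc: "\<And>g \<omega>. g \<in> J \<Longrightarrow> Q g (restrict \<omega> (K g)) \<longleftrightarrow> Q g \<omega>"
  shows "C.prob {\<omega>. \<forall>g\<in>J. Q g \<omega>} = (\<Prod>g\<in>J. C.prob {\<omega>. Q g \<omega>})"
proof -
  have R: "C.indep_vars (\<lambda>g. PiM (K g) (\<lambda>_. unif)) (\<lambda>g \<omega>. restrict (\<lambda>i. \<omega> i) (K g)) J"
    by (rule C.indep_vars_restrict[OF indep_coord]) (use J in auto)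
  let ?A = "\<lambda>g. {y \<in> space (PiM (K g) (\<lambda>_. unif)). Q g y}"
  have eq: "(\<lambda>\<omega>. restrict (\<lambda>i. \<omega> i) (K g)) -` ?A g \<inter> space circle_process = {\<omega>. Q g \<omega>}" if "g \<in> J" for g
    using loc[OF that] by (auto simp: space_PiM)
  have "C.prob (\<Inter>g\<in>J. (\<lambda>\<omega>. restrict (\<lambda>i. \<omega> i) (K g)) -` ?A g \<inter> space circle_process)
      = (\<Prod>g\<in>J. C.prob ((\<lambda>\<omega>. restrict (\<lambda>i. \<omega> i) (K g)) -` ?A g \<inter> space circle_process))"
    by (rule C.indep_varsD_finite[OF R J(2,1)]) (rule meas)
  moreover have "(\<Inter>g\<in>J. (\<lambda>\<omega>. restrict (\<lambda>i. \<omega> i) (K g)) -` ?A g \<inter> space circle_process) = {\<omega>. \<forall>g\<in>J. Q g \<omega>}"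
    using eq by auto
  ultimately show ?thesis using eq by simp
qed

lemma avoids_restrict: "J \<subseteq> K \<Longrightarrow> avoids D J C (restrict \<omega> K) \<longleftrightarrow> avoids D J C \<omega>"
  unfolding avoids_def by (auto simp: subset_iff)

lemma avoids_mono: "avoids D J C \<omega> \<Longrightarrow> J' \<subseteq> J \<Longrightarrow> avoids D J' C \<omega>"
  unfolding avoids_def by blast

lemma one_minus_power_le_exp:
  assumes "0 < D"
  shows "(1 - 1 / real D) ^ n \<le> exp (- (real n / real D))"
proof -
  have "1 - 1 / real D \<le> exp (- (1 / real D))" using exp_ge_add_one_self[of "- (1 / real D)"] by simp
  moreover have "0 \<le> 1 - 1 / real D" using assms by simp
  ultimately have "(1 - 1 / real D) ^ n \<le> exp (- (1 / real D)) ^ n" by (rule power_mono)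
  also have "\<dots> = exp (- (real n / real D))" by (simp flip: exp_of_nat_mult)
  finally show ?thesis .
qed

text \<open>The union bound for an empty cell after \<open>n\<close> draws is
  \<open>D * exp (- (n / D))\<close>. For \<open>n = (j + 1) * T\<close> the choice of
  \<open>T\<close> makes it at most \<open>exp (- (j + 1))\<close>, and \<open>exp 1 \<ge> 2\<close>
  gives a geometric tail.\<close>

lemma expected_hit_cover:
  assumes D: "1 \<le> D" and T: "1 \<le> T" "real D * (ln (real D) + 1) \<le> real T"
    and hit: "AE \<omega> in circle_process. \<forall>n. 1 \<le> n \<and> (\<forall>c<D. \<not> avoids D {..<n} {c} \<omega>) \<longrightarrow> Pr (Xn \<omega> n)"
  shows "expected_hit Pr \<le> ennreal (2 * real T)"
proof -
  define B where "B j = {\<omega>. \<exists>c\<in>{..<D}. avoids D {..<Suc j * T} {c} \<omega>}" for j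
  have Beq: "B j = (\<Union>c\<in>{..<D}. {\<omega>. avoids D {..<Suc j * T} {c} \<omega>})" for j by (auto simp: B_def)
  have "expected_hit Pr \<le> ennreal (real T / (1 - 1/2))"
  proof (rule expected_hit_upper[OF T(1)])
    show "B j \<in> sets circle_process" for j unfolding Beq by (intro sets.finite_UN avoids_circle_sets) auto
    show "C.prob (B j) \<le> (1/2) ^ Suc j" for j
    proof -
      let ?n = "Suc j * T"
      have "C.prob (B j) \<le> (\<Sum>c\<in>{..<D}. C.prob {\<omega>. avoids D {..<?n} {c} \<omega>})"
        unfolding Beq by (rule C.finite_measure_subadditive_finite) (auto intro!: avoids_circle_sets)
      also have "\<dots> = (\<Sum>c\<in>{..<D}. (1 - 1 / real D) ^ ?n)"
        using D by (intro sum.cong refl, subst prob_avoids) auto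
      also have "\<dots> = real D * (1 - 1 / real D) ^ ?n" by simp
      also have "\<dots> \<le> real D * exp (- (real ?n / real D))"
        using D by (intro mult_left_mono one_minus_power_le_exp) auto
      also have "\<dots> = exp (ln (real D) - real ?n / real D)"
        unfolding diff_conv_add_uminus exp_add using D by simp
      also have "\<dots> \<le> exp (- real (Suc j))"
      proof -
        have "ln (real D) + 1 \<le> real T / real D" using T(2) D by (simp add: field_simps)
        then have "real (Suc j) * (ln (real D) + 1) \<le> real (Suc j) * (real T / real D)"
          by (intro mult_left_mono) auto
        moreover have "real (Suc j) * (real T / real D) = real ?n / real D" by (simp add: algebra_simps)
        moreover have "real (Suc j) * (ln (real D) + 1) = ln (real D) + real j * ln (real D) + real (Suc j)"
          by (simp add: algebra_simps)
        moreover have "0 \<le> real j * ln (real D)" using D by simp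
        ultimately have "ln (real D) - real ?n / real D \<le> - real (Suc j)" by linarith
        then show ?thesis by simp
      qed
      also have "\<dots> = exp (- 1) ^ Suc j" using exp_of_nat_mult[of "Suc j" "-1::real"] by simp
      also have "\<dots> \<le> (1/2) ^ Suc j"
      proof (rule power_mono)
        have "2 \<le> exp (1::real)" using exp_ge_add_one_self[of 1] by simp
        then show "exp (- 1) \<le> (1/2::real)" by (simp add: exp_minus field_simps)
      qed simp
      finally show ?thesis .
    qed
    show "AE \<omega> in circle_process. \<forall>j. \<omega> \<notin> B j \<longrightarrow> (\<exists>n. 1 \<le> n \<and> n \<le> Suc j * T \<and> Pr (Xn \<omega> n))"
      using hit
    proof eventually_elim
      case (elim \<omega>)
      show ?case
      proof (intro allI impI)
        fix j assume "\<omega> \<notin> B j"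
        moreover have "1 \<le> Suc j * T" using T(1) by simp
        ultimately show "\<exists>n. 1 \<le> n \<and> n \<le> Suc j * T \<and> Pr (Xn \<omega> n)"
          using elim by (intro exI[of _ "Suc j * T"]) (auto simp: B_def)
      qed
    qed
  qed auto
  then show ?thesis by (simp add: mult.commute)
qed

text \<open>On this range \<open>(1 - x) * (1 + 2 * x) \<ge> 1\<close>, and
  \<open>1 + 2 * x \<le> exp (2 * x)\<close>.\<close>

lemma one_minus_ge_exp:
  fixes x :: real
  assumes "0 \<le> x" "x \<le> 1/2"
  shows "exp (- (2 * x)) \<le> 1 - x"
proof -
  have "1 \<le> (1 - x) * (1 + 2 * x)"
  proof -
    have "0 \<le> x * (1 - 2 * x)" using assms by (intro mult_nonneg_nonneg) auto
    then show ?thesis by (simp add: algebra_simps)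
  qed
  also have "\<dots> \<le> (1 - x) * exp (2 * x)" using assms exp_ge_add_one_self[of "2 * x"] by (intro mult_left_mono) auto
  finally have "exp (- (2 * x)) * 1 \<le> exp (- (2 * x)) * ((1 - x) * exp (2 * x))" by (intro mult_left_mono) auto
  also have "\<dots> = 1 - x" by (simp add: exp_minus field_simps)
  finally show ?thesis by simp
qed

text \<open>Two cells are empty with negative correlation, as
  \<open>1 - 2 / m \<le> (1 - 1 / m) ^ 2\<close>. Up to \<open>m / 2 * ln m\<close> draws the mean
  number of empty cells is at least 1, so the second moment bound leaves one empty with probability
  at least 1/2.\<close>

lemma expected_hit_empty_cell:
  assumes m: "2 \<le> m" and n: "real n \<le> real m / 2 * ln (real m)"
    and none: "AE \<omega> in circle_process. \<forall>k c. 1 \<le> k \<and> c < m \<and> avoids m {..<k} {c} \<omega> \<longrightarrow> \<not> Pr (Xn \<omega> k)"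
  shows "ennreal (real (n + 1) / 2) \<le> expected_hit Pr"
proof -
  define A where "A c = {\<omega>. avoids m {..<n} {c} \<omega>}" for c
  define G where "G = (\<Union>c\<in>{..<m}. A c)"
  have A: "A c \<in> sets circle_process" for c unfolding A_def by (intro avoids_circle_sets) auto
  have G: "G \<in> sets circle_process" unfolding G_def using A by (intro sets.finite_UN) auto
  define p where "p = (1 - 1 / real m) ^ n"
  have m1: "1 / real m \<le> 1/2" using m by (simp add: field_simps)
  have "C.prob (space circle_process - G) \<le> 1 / (1 + real (card {..<m}) * p)"
  proof (rule C.second_moment)
    show "C.prob (A c) = p" if "c \<in> {..<m}" for c
      unfolding A_def p_def using that m by (subst prob_avoids) auto
    show "C.prob (A c \<inter> A c') \<le> p\<^sup>2" if c: "c \<in> {..<m}" "c' \<in> {..<m}" "c \<noteq> c'" for c c'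
    proof -
      have "A c \<inter> A c' = {\<omega>. avoids m {..<n} {c, c'} \<omega>}" unfolding A_def avoids_def by auto
      then have "C.prob (A c \<inter> A c') = (1 - 2 / real m) ^ n" using c m by (simp add: prob_avoids)
      also have "\<dots> \<le> ((1 - 1 / real m)\<^sup>2) ^ n"
      proof (rule power_mono)
        show "1 - 2 / real m \<le> (1 - 1 / real m)\<^sup>2" by (simp add: power2_eq_square algebra_simps)
        show "0 \<le> 1 - 2 / real m" using m by simp
      qed
      also have "\<dots> = p\<^sup>2" unfolding p_def power_mult[symmetric] by (simp only: mult.commute)
      finally show ?thesis .
    qed
    show "0 \<le> p" using m1 by (simp add: p_def)
    show "space circle_process - G \<in> C.events" by (rule sets.compl_sets[OF G])
    show "(space circle_process - G) \<inter> \<Union> (A ` {..<m}) = {}" by (auto simp: G_def)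
  qed (use A in auto)
  also have "\<dots> \<le> 1/2"
  proof -
    have "real n * (2 / real m) \<le> ln (real m)" using n m by (simp add: field_simps)
    then have "exp (- ln (real m)) \<le> exp (- (real n * (2 / real m)))" by simp
    also have "\<dots> = exp (- (2 * (1 / real m))) ^ n" by (simp flip: exp_of_nat_mult)
    also have "\<dots> \<le> p" unfolding p_def using m1 by (intro power_mono one_minus_ge_exp) auto
    finally have "1 / real m \<le> p" using m by (simp add: exp_minus inverse_eq_divide)
    then have "1 \<le> real m * p" using m by (simp add: field_simps)
    then show ?thesis by (simp add: field_simps)
  qed
  finally have "1/2 \<le> C.prob G" using C.prob_compl[OF G] by simp
  then show ?thesis
  proof (rule expected_hit_lower[OF G])
    show "AE \<omega> in circle_process. \<omega> \<in> G \<longrightarrow> (\<forall>k. 1 \<le> k \<and> k \<le> n \<longrightarrow> \<not> Pr (Xn \<omega> k))"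
      using none
    proof eventually_elim
      case (elim \<omega>)
      show ?case
      proof (intro impI allI)
        fix k assume "\<omega> \<in> G" "1 \<le> k \<and> k \<le> n"
        then obtain c where c: "c < m" "avoids m {..<n} {c} \<omega>" by (auto simp: G_def A_def)
        have "avoids m {..<k} {c} \<omega>" by (rule avoids_mono[OF c(2)]) (use \<open>1 \<le> k \<and> k \<le> n\<close> in auto)
        then show "\<not> Pr (Xn \<omega> k)" using elim \<open>c < m\<close> \<open>1 \<le> k \<and> k \<le> n\<close> by blast
      qed
    qed
  qed
qed

text \<open>Inclusion-exclusion carries negative correlation over from missing the two cells to
  hitting them.\<close>

lemma prob_hits_both:
  assumes D: "0 < D" and J: "finite J" and c: "c < D" "c' < D" "c \<noteq> c'"
  shows "C.prob {\<omega>. \<not> avoids D J {c} \<omega> \<and> \<not> avoids D J {c'} \<omega>} \<le> (1 - (1 - 1 / real D) ^ card J)\<^sup>2"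
proof -
  let ?x = "(1 - 1 / real D) ^ card J"
  define A where "A = {\<omega>. avoids D J {c} \<omega>}"
  define A' where "A' = {\<omega>. avoids D J {c'} \<omega>}"
  have meas: "A \<in> C.events" "A' \<in> C.events" unfolding A_def A'_def using J by (intro avoids_circle_sets; simp)+
  have "A \<inter> A' = {\<omega>. avoids D J {c, c'} \<omega>}" unfolding A_def A'_def avoids_def by auto
  then have AA: "C.prob (A \<inter> A') = (1 - 2 / real D) ^ card J" using c D J by (simp add: prob_avoids)
  have P: "C.prob A = ?x" "C.prob A' = ?x"
    unfolding A_def A'_def using D J c by (subst prob_avoids; simp)+
  have D2: "2 \<le> D" using c by linarith
  have "(1 - 2 / real D) ^ card J \<le> ((1 - 1 / real D)\<^sup>2) ^ card J"
  proof (rule power_mono)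
    show "1 - 2 / real D \<le> (1 - 1 / real D)\<^sup>2" by (simp add: power2_eq_square algebra_simps)
    show "0 \<le> 1 - 2 / real D" using D2 by simp
  qed
  also have "\<dots> = ?x\<^sup>2" unfolding power_mult[symmetric] by (simp only: mult.commute)
  finally have le: "C.prob (A \<inter> A') \<le> ?x\<^sup>2" using AA by simp
  have "{\<omega>. \<not> avoids D J {c} \<omega> \<and> \<not> avoids D J {c'} \<omega>} = space circle_process - (A \<union> A')"
    by (auto simp: A_def A'_def)
  then have "C.prob {\<omega>. \<not> avoids D J {c} \<omega> \<and> \<not> avoids D J {c'} \<omega>} = 1 - C.prob (A \<union> A')"
    using meas by (simp only:) (rule C.prob_compl, auto)
  also have "C.prob (A \<union> A') = 2 * ?x - C.prob (A \<inter> A')"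
    using C.finite_measure_Union'[OF meas] C.finite_measure_Diff'[OF meas(2,1)] P by (simp add: Int_commute)
  also have "1 - (2 * ?x - C.prob (A \<inter> A')) \<le> 1 - 2 * ?x + ?x\<^sup>2" using le by simp
  also have "\<dots> = (1 - ?x)\<^sup>2" by (simp add: power2_eq_square algebra_simps)
  finally show ?thesis .
qed

text \<open>The draws are cut into rounds of \<open>L * n\<close> and each round into
  \<open>L\<close> groups of \<open>n\<close>; group \<open>s\<close> alone is asked to hit cell
  \<open>s * M + c\<close>. This makes the \<open>L\<close> requirements independent at the cost of
  a constant factor. The number of successful offsets \<open>c\<close> in a round has mean at least
  1 by \<open>mu\<close>, so rounds fail independently with probability at most 1/2.\<close>

lemma expected_hit_block:
  fixes L M n :: nat
  assumes L: "1 \<le> L" and M: "1 \<le> M" and n: "1 \<le> n"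
  defines "D \<equiv> L * M" and "Gp \<equiv> \<lambda>g. {g * n..<(g + 1) * n}"
  assumes mu: "1 \<le> real M * (1 - (1 - 1 / real D) ^ n) ^ L"
    and hit: "AE \<omega> in circle_process. \<forall>j c. c < M \<and> (\<forall>s<L. \<not> avoids D (Gp (j * L + s)) {s * M + c} \<omega>) \<longrightarrow>
      Pr (Xn \<omega> (Suc j * (L * n)))"
  shows "expected_hit Pr \<le> ennreal (2 * real (L * n))"
proof -
  have D: "0 < D" using L M by (simp add: D_def)
  have Lne: "{..<L} \<noteq> {}" using L by (simp add: lessThan_empty_iff)
  have cD: "s * M + c < D" if "s < L" "c < M" for s c
  proof -
    have "s * M + c < (s + 1) * M" using that by simp
    also have "\<dots> \<le> D" unfolding D_def using that by (intro mult_le_mono1) simp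
    finally show ?thesis .
  qed
  define F where "F j \<omega> \<longleftrightarrow> (\<forall>c\<in>{..<M}. \<exists>s\<in>{..<L}. avoids D (Gp (j * L + s)) {s * M + c} \<omega>)" for j \<omega>
  define K where "K j = {j * (L * n)..<(j + 1) * (L * n)}" for j
  have GpK: "Gp (j * L + s) \<subseteq> K j" if "s < L" for j s
  proof -
    have "(j * L + s + 1) * n \<le> (j * L + L) * n" using that by (intro mult_le_mono1) simp
    moreover have "(j * L + L) * n = (j + 1) * (L * n)" by (simp add: algebra_simps)
    moreover have "j * (L * n) \<le> (j * L + s) * n" by (simp add: algebra_simps)
    ultimately show ?thesis unfolding Gp_def K_def by auto
  qed
  have Fmeas: "{y \<in> space (PiM (K j) (\<lambda>_. unif)). F j y} \<in> sets (PiM (K j) (\<lambda>_. unif))" for j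
    unfolding F_def
    by (intro sets.sets_Collect_finite_All sets.sets_Collect_finite_Ex avoids_sets)
       (use GpK in \<open>auto simp: Gp_def\<close>)
  have Floc: "F j (restrict \<omega> (K j)) \<longleftrightarrow> F j \<omega>" for j \<omega>
    unfolding F_def using GpK by (simp add: avoids_restrict)
  have Fsets: "{\<omega>. F j \<omega>} \<in> C.events" for j
  proof -
    have "{\<omega> \<in> space circle_process. F j \<omega>} \<in> C.events"
      unfolding F_def
      by (intro sets.sets_Collect_finite_All sets.sets_Collect_finite_Ex) (auto simp: Gp_def)
    then show ?thesis by simp
  qed
  have disjK: "disjoint_family_on K UNIV"
    unfolding disjoint_family_on_def
  proof (intro ballI impI)
    fix i j :: nat assume "i \<noteq> j"
    have *: "K i \<inter> K j = {}" if "i < j" for i j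
    proof -
      have "(i + 1) * (L * n) \<le> j * (L * n)" using that by (intro mult_le_mono1) simp
      then show ?thesis by (auto simp: K_def)
    qed
    show "K i \<inter> K j = {}" using *[of i j] *[of j i] \<open>i \<noteq> j\<close> by (auto simp: Int_commute linorder_neq_iff)
  qed
  have disjG: "disjoint_family_on (\<lambda>s. Gp (j * L + s)) {..<L}" for j
    unfolding disjoint_family_on_def
  proof (intro ballI impI)
    fix s t :: nat assume "s \<noteq> t"
    have *: "Gp a \<inter> Gp b = {}" if "a < b" for a b
    proof -
      have "(a + 1) * n \<le> b * n" using that by (intro mult_le_mono1) simp
      then show ?thesis by (auto simp: Gp_def)
    qed
    have "j * L + s < j * L + t \<or> j * L + t < j * L + s" using \<open>s \<noteq> t\<close> by auto
    then show "Gp (j * L + s) \<inter> Gp (j * L + t) = {}" using *[of "j * L + s" "j * L + t"] *[of "j * L + t" "j * L + s"] by blast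
  qed
  have Gp: "finite (Gp g)" "card (Gp g) = n" for g by (simp_all add: Gp_def)
  define p where "p = 1 - (1 - 1 / real D) ^ n"
  have p0: "0 \<le> p" using D by (simp add: p_def power_le_one)
  have Fle: "C.prob {\<omega>. F j \<omega>} \<le> 1/2" for j
  proof -
    define A where "A c = {\<omega>. \<forall>s\<in>{..<L}. \<not> avoids D (Gp (j * L + s)) {s * M + c} \<omega>}" for c
    have msets: "{y \<in> space (PiM (Gp g) (\<lambda>_. unif)). \<not> avoids D (Gp g) {c} y} \<in> sets (PiM (Gp g) (\<lambda>_. unif))" for g c
      by (intro sets.sets_Collect_neg avoids_sets) (auto simp: Gp)
    have notav: "C.prob {\<omega>. \<not> avoids D (Gp g) {c} \<omega>} = p" if c: "c < D" for g c
    proof -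
      have m: "{\<omega>. avoids D (Gp g) {c} \<omega>} \<in> C.events" by (rule avoids_circle_sets) (simp_all add: Gp)
      have e: "{\<omega>. \<not> avoids D (Gp g) {c} \<omega>} = space circle_process - {\<omega>. avoids D (Gp g) {c} \<omega>}" by auto
      have c': "{c} \<subseteq> {..<D}" using c by simp
      show ?thesis unfolding e C.prob_compl[OF m] prob_avoids[OF D Gp(1) c'] p_def Gp(2) by simp
    qed
    have Am: "A c \<in> C.events" for c
    proof -
      have "A c = (\<Inter>s\<in>{..<L}. space circle_process - {\<omega>. avoids D (Gp (j * L + s)) {s * M + c} \<omega>})"
        by (auto simp: A_def)
      moreover have "\<dots> \<in> C.events"
        by (intro sets.finite_INT sets.compl_sets avoids_circle_sets) (use Lne in \<open>simp_all add: Gp\<close>)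
      ultimately show ?thesis by simp
    qed
    have Ap: "C.prob (A c) = p ^ L" if c: "c < M" for c
    proof -
      have "C.prob (A c) = (\<Prod>s\<in>{..<L}. C.prob {\<omega>. \<not> avoids D (Gp (j * L + s)) {s * M + c} \<omega>})"
        unfolding A_def
      proof (rule block_indep[OF finite_lessThan Lne disjG[of j]])
        show "{y \<in> space (PiM (Gp (j * L + s)) (\<lambda>_. unif)). \<not> avoids D (Gp (j * L + s)) {s * M + c} y} \<in> sets (PiM (Gp (j * L + s)) (\<lambda>_. unif))" for s
          by (rule msets)
        show "(\<not> avoids D (Gp (j * L + s)) {s * M + c} (restrict \<omega> (Gp (j * L + s)))) \<longleftrightarrow> (\<not> avoids D (Gp (j * L + s)) {s * M + c} \<omega>)" for s \<omega>
          by (simp only: avoids_restrict[OF subset_refl])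
      qed
      also have "\<dots> = (\<Prod>s\<in>{..<L}. p)"
        by (rule prod.cong[OF refl], rule notav, rule cD) (use c in auto)
      finally show ?thesis by simp
    qed
    \<comment> \<open>Groups are independent of each other; inside a group the two hits are
      negatively correlated.\<close>
    have Ap2: "C.prob (A c \<inter> A c') \<le> (p ^ L)\<^sup>2" if c: "c < M" "c' < M" "c \<noteq> c'" for c c'
    proof -
      let ?Q = "\<lambda>s \<omega>. \<not> avoids D (Gp (j * L + s)) {s * M + c} \<omega> \<and> \<not> avoids D (Gp (j * L + s)) {s * M + c'} \<omega>"
      have e: "A c \<inter> A c' = {\<omega>. \<forall>s\<in>{..<L}. ?Q s \<omega>}" unfolding A_def by blast
      have "C.prob (A c \<inter> A c') = (\<Prod>s\<in>{..<L}. C.prob {\<omega>. ?Q s \<omega>})"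
        unfolding e
      proof (rule block_indep[OF finite_lessThan Lne disjG[of j]])
        show "{y \<in> space (PiM (Gp (j * L + s)) (\<lambda>_. unif)). ?Q s y} \<in> sets (PiM (Gp (j * L + s)) (\<lambda>_. unif))" for s
          by (rule sets.sets_Collect_conj[OF msets msets])
        show "?Q s (restrict \<omega> (Gp (j * L + s))) \<longleftrightarrow> ?Q s \<omega>" for s \<omega>
          by (simp only: avoids_restrict[OF subset_refl])
      qed
      also have "\<dots> \<le> (\<Prod>s\<in>{..<L}. p\<^sup>2)"
      proof (rule prod_mono, intro conjI)
        fix s assume "s \<in> {..<L}"
        then have "s * M + c < D" "s * M + c' < D" "s * M + c \<noteq> s * M + c'" using cD c by auto
        from prob_hits_both[OF D Gp(1)[of "j * L + s"] this]
        show "C.prob {\<omega>. ?Q s \<omega>} \<le> p\<^sup>2" unfolding p_def Gp(2) .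
      qed simp
      also have "\<dots> = (p ^ L)\<^sup>2" unfolding prod_constant card_lessThan power_mult[symmetric] by (simp only: mult.commute)
      finally show ?thesis .
    qed
    have pL: "0 \<le> p ^ L" using p0 by simp
    have FA: "{\<omega>. F j \<omega>} \<inter> \<Union> (A ` {..<M}) = {}" by (auto simp: F_def A_def)
    have "C.prob {\<omega>. F j \<omega>} \<le> 1 / (1 + real (card {..<M}) * p ^ L)"
    proof (rule C.second_moment[OF finite_lessThan Am _ _ Fsets FA pL])
      show "C.prob (A c) = p ^ L" if "c \<in> {..<M}" for c using that by (intro Ap) simp
      show "C.prob (A c \<inter> A c') \<le> (p ^ L)\<^sup>2" if "c \<in> {..<M}" "c' \<in> {..<M}" "c \<noteq> c'" for c c'
        using that by (intro Ap2) simp_all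
    qed
    also have "\<dots> \<le> 1/2"
    proof -
      have "1 \<le> real M * p ^ L" using mu by (simp only: p_def)
      then show ?thesis by (simp add: field_simps)
    qed
    finally show ?thesis .
  qed
  define B where "B j = {\<omega>. \<forall>i\<in>{..j}. F i \<omega>}" for j
  have "expected_hit Pr \<le> ennreal (real (L * n) / (1 - 1/2))"
  proof (rule expected_hit_upper)
    show "1 \<le> L * n" using L n by simp
    show "B j \<in> C.events" for j
    proof -
      have "B j = (\<Inter>i\<in>{..j}. {\<omega>. F i \<omega>})" by (auto simp: B_def)
      then show ?thesis using Fsets by (simp add: sets.finite_INT)
    qed
    show "C.prob (B j) \<le> (1/2) ^ Suc j" for j
    proof -
      have "C.prob (B j) = (\<Prod>i\<in>{..j}. C.prob {\<omega>. F i \<omega>})"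
        unfolding B_def
        by (rule block_indep[where K = K]) (use Fmeas Floc disjK in \<open>auto simp: disjoint_family_on_def\<close>)
      also have "\<dots> \<le> (\<Prod>i\<in>{..j}. 1/2)" using Fle by (intro prod_mono) auto
      finally show ?thesis by simp
    qed
    show "AE \<omega> in circle_process. \<forall>j. \<omega> \<notin> B j \<longrightarrow> (\<exists>N. 1 \<le> N \<and> N \<le> Suc j * (L * n) \<and> Pr (Xn \<omega> N))"
      using hit
    proof eventually_elim
      case (elim \<omega>)
      show ?case
      proof (intro allI impI)
        fix j assume "\<omega> \<notin> B j"
        then obtain i where i: "i \<le> j" "\<not> F i \<omega>" by (auto simp: B_def)
        then obtain c where "c < M" "\<forall>s<L. \<not> avoids D (Gp (i * L + s)) {s * M + c} \<omega>" by (auto simp: F_def)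
        then have "Pr (Xn \<omega> (Suc i * (L * n)))" using elim by blast
        moreover have "0 < L * n" using L n by simp
        then have "1 \<le> Suc i * (L * n)" by (simp add: Suc_le_eq)
        moreover have "Suc i * (L * n) \<le> Suc j * (L * n)" using i by (intro mult_le_mono1) simp
        ultimately show "\<exists>N. 1 \<le> N \<and> N \<le> Suc j * (L * n) \<and> Pr (Xn \<omega> N)" by blast
      qed
    qed
  qed auto
  then show ?thesis by (simp add: mult.commute)
qed

text \<open>Union bound over cell tuples and injective index tuples. Injectivity makes the
  coordinates involved independent, so each combination has probability
  \<open>(1 / D) ^ (k + 1)\<close>.\<close>

lemma expected_hit_tuple:
  assumes D: "0 < D" and F: "finite F" "\<And>\<tau> j. \<tau> \<in> F \<Longrightarrow> j \<le> k \<Longrightarrow> \<tau> j < D"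
    and small: "2 * (real (card F) * real N ^ Suc k) \<le> real D ^ Suc k"
    and none: "AE \<omega> in circle_process. \<forall>n. 1 \<le> n \<and> n \<le> N \<and> Pr (Xn \<omega> n) \<longrightarrow>
      (\<exists>\<tau>\<in>F. \<exists>\<iota>. inj_on \<iota> {..k} \<and> (\<forall>j\<le>k. \<iota> j < n \<and> \<omega> (\<iota> j) \<in> cell D (\<tau> j)))"
  shows "ennreal (real (N + 1) / 2) \<le> expected_hit Pr"
proof -
  define I where "I = {\<iota> \<in> PiE {..k} (\<lambda>_. {..<N}). inj_on \<iota> {..k}}"
  have finI: "finite I" unfolding I_def by (intro finite_Collect_conjI disjI1) (auto intro!: finite_PiE)
  have "card I \<le> card (PiE {..k} (\<lambda>_. {..<N}))" unfolding I_def by (intro card_mono) (auto intro!: finite_PiE)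
  then have cardI: "card I \<le> N ^ Suc k" by (simp add: card_PiE)
  define E where "E \<tau> \<iota> = {\<omega>. \<forall>j\<in>{..k}. \<omega> (\<iota> j) \<in> cell D (\<tau> j)}" for \<tau> \<iota> :: "nat \<Rightarrow> nat"
  have Em: "E \<tau> \<iota> \<in> C.events" for \<tau> \<iota>
  proof -
    have "E \<tau> \<iota> = (\<Inter>j\<in>{..k}. {\<omega>. \<omega> (\<iota> j) \<in> cell D (\<tau> j)})" by (auto simp: E_def)
    then show ?thesis using sets_circle_coord[OF cell_borel] by (simp add: sets.finite_INT)
  qed
  have Ep: "C.prob (E \<tau> \<iota>) = (1 / real D) ^ Suc k" if "\<tau> \<in> F" "\<iota> \<in> I" for \<tau> \<iota>
  proof -
    have inj: "inj_on \<iota> {..k}" using that by (simp add: I_def)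
    \<comment> \<open>The condition on draw \<open>\<iota> j\<close> re-indexed by the draw itself,
      so that the event becomes a cylinder.\<close>
    define S where "S i = cell D (\<tau> (the_inv_into {..k} \<iota> i))" for i
    have S: "S (\<iota> j) = cell D (\<tau> j)" if "j \<le> k" for j using the_inv_into_f_f[OF inj] that by (simp add: S_def)
    have "E \<tau> \<iota> = {\<omega>. \<forall>i\<in>\<iota> ` {..k}. \<omega> i \<in> S i}" using S by (auto simp: E_def)
    then have "C.prob (E \<tau> \<iota>) = (\<Prod>i\<in>\<iota> ` {..k}. measure unif (S i))"
      using prob_cylinder[of "\<iota> ` {..k}" S] by (simp add: S_def)
    also have "\<dots> = (\<Prod>j\<in>{..k}. measure unif (S (\<iota> j)))" by (rule prod.reindex_cong[OF inj refl refl])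
    also have "\<dots> = (\<Prod>j\<in>{..k}. 1 / real D)"
    proof (rule prod.cong[OF refl])
      fix j assume "j \<in> {..k}"
      then show "measure unif (S (\<iota> j)) = 1 / real D"
        using S[of j] measure_cells[OF D, of "{\<tau> j}"] F(2)[OF that(1), of j] by simp
    qed
    finally show ?thesis by simp
  qed
  define Bd where "Bd = (\<Union>x\<in>F \<times> I. E (fst x) (snd x))"
  have Bm: "Bd \<in> C.events" unfolding Bd_def using F(1) finI Em by (intro sets.finite_UN) auto
  have "C.prob Bd \<le> (\<Sum>x\<in>F \<times> I. C.prob (E (fst x) (snd x)))"
    unfolding Bd_def using F(1) finI Em by (intro C.finite_measure_subadditive_finite) auto
  also have "\<dots> = (\<Sum>x\<in>F \<times> I. (1 / real D) ^ Suc k)" by (intro sum.cong refl Ep) auto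
  also have "\<dots> = real (card F) * real (card I) * (1 / real D) ^ Suc k" by (simp add: card_cartesian_product)
  also have "\<dots> \<le> real (card F) * real N ^ Suc k * (1 / real D) ^ Suc k"
  proof -
    have "real (card I) \<le> real N ^ Suc k" using cardI by (metis of_nat_le_iff of_nat_power)
    then show ?thesis by (intro mult_right_mono mult_left_mono) auto
  qed
  also have "\<dots> = real (card F) * real N ^ Suc k / real D ^ Suc k"
    by (simp only: power_divide power_one times_divide_eq_right mult_1_right)
  also have "\<dots> \<le> 1/2"
  proof -
    have "0 < real D ^ Suc k" using D by simp
    then show ?thesis using small by (simp only: pos_divide_le_eq)
  qed
  finally have "C.prob Bd \<le> 1/2" .
  then have G: "1/2 \<le> C.prob (space circle_process - Bd)" using C.prob_compl[OF Bm] by simp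
  show ?thesis
  proof (rule expected_hit_lower[OF sets.compl_sets[OF Bm] G])
    show "AE \<omega> in circle_process. \<omega> \<in> space circle_process - Bd \<longrightarrow> (\<forall>n. 1 \<le> n \<and> n \<le> N \<longrightarrow> \<not> Pr (Xn \<omega> n))"
      using none
    proof eventually_elim
      case (elim \<omega>)
      show ?case
      proof (intro impI allI notI)
        fix n assume w: "\<omega> \<in> space circle_process - Bd" and n: "1 \<le> n \<and> n \<le> N" and Pr: "Pr (Xn \<omega> n)"
        obtain \<tau> \<iota> where t: "\<tau> \<in> F" "inj_on \<iota> {..k}" "\<And>j. j \<le> k \<Longrightarrow> \<iota> j < n \<and> \<omega> (\<iota> j) \<in> cell D (\<tau> j)"
          using elim n Pr by blast
        have "restrict \<iota> {..k} \<in> I" using t n by (auto simp: I_def inj_on_def intro: less_le_trans)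
        moreover have "\<omega> \<in> E \<tau> (restrict \<iota> {..k})" using t by (auto simp: E_def)
        ultimately have "\<omega> \<in> Bd" using t(1) unfolding Bd_def by force
        then show False using w by blast
      qed
    qed
  qed
qed

section \<open>Asymptotics\<close>

text \<open>Reduces both versions to the strict one. The radius obtained depends on
  \<open>X\<close>; \<open>b\<close> stands for the largest radius that an application
  tolerates.\<close>

lemma effective_radius:
  assumes "finite X" "r < b"
  obtains r' where "r \<le> r'" "r' < b" "wf strict X r = wf True X r'" "VR_top strict X r = clq_top (near r') X"
proof (cases strict)
  case True
  then show ?thesis using that[of r] assms VR_top_strict_eq[OF assms(1)] by simp
next
  case False
  obtain r' where r': "r < r'" "r' < b" "\<And>x y. x \<in> X \<Longrightarrow> y \<in> X \<Longrightarrow> cdist x y \<le> r \<longleftrightarrow> cdist x y < r'"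
    using strict_radius[OF assms] by metis
  have "VR_top False X r = VR_top True X r'" "wf False X r = wf True X r'"
    using vr_strict_radius[OF assms(1) r'(3)] by blast+
  then show ?thesis using that[of r'] r'(1,2) False VR_top_strict_eq[OF assms(1)] by simp
qed

context
  fixes l :: nat and a b :: real
  defines "a \<equiv> real l / real (2 * l + 1)" and "b \<equiv> real (l + 1) / real (2 * l + 3)"
begin

lemma denominator_mult: "real (2 * l + 1) * a = real l"
  by (simp add: a_def)

text \<open>A mesh of at most half of \<open>r - a\<close> suffices: \<open>a + g < r\<close> serves
  the winding fraction, and \<open>2 * l + 2 \<le> 2 * (2 * l + 1)\<close> yields the density
  condition for the sphere.\<close>

lemma dense_hits:
  assumes r: "a < r" "r < b" and X: "finite X" "X \<subseteq> {0..<1}" "circle_dense g X" and g: "0 < g" "2 * g \<le> r - a"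
  shows "a < wf strict X r" "VR_top strict X r homotopy_equivalent_space nsphere (2 * l + 1)"
proof -
  obtain r' where r': "r \<le> r'" "r' < b" "wf strict X r = wf True X r'" "VR_top strict X r = clq_top (near r') X"
    using effective_radius[OF X(1) r(2)] by metis
  have ar': "a < r'" using r r' by linarith
  note rb = radius_bounds[OF ar'[unfolded a_def] r'(2)[unfolded b_def]]
  have "0 \<le> a" by (simp add: a_def)
  then show "a < wf strict X r" unfolding r'(3)
    by (intro wf_gt_of_dense[OF X rb(2)]) (use g r r' in linarith)+
  show "VR_top strict X r homotopy_equivalent_space nsphere (2 * l + 1)"
    unfolding r'(4)
  proof (rule dense_sphere[OF ar'[unfolded a_def] r'(2)[unfolded b_def] X g(1)])
    have "real (2 * l + 2) * g \<le> real (2 * l + 1) * (2 * g)" using g by (simp add: algebra_simps)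
    also have "\<dots> \<le> real (2 * l + 1) * (r' - a)" using g r' by (intro mult_left_mono) auto
    also have "\<dots> = real (2 * l + 1) * r' - real l" using denominator_mult by (simp only: right_diff_distrib)
    finally show "real (2 * l + 2) * g + real l * (1 - 2 * r') \<le> r'" by (simp add: algebra_simps)
  qed
qed

lemma gap_misses:
  assumes r: "a < r" "r < b" and X: "finite X" "X \<subseteq> {0..<1}" "X \<noteq> {}" and p: "p \<in> {0..<1}"
    and gap: "\<And>x. x \<in> X \<Longrightarrow> \<not> (0 < cdist p x \<and> cdist p x < \<gamma>)"
    and \<gamma>: "\<gamma> \<le> 1" "real (2 * l + 1) * (r - a) < \<gamma>"
  shows "\<not> a < wf strict X r" "\<not> VR_top strict X r homotopy_equivalent_space nsphere (2 * l + 1)"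
proof -
  have "real (2 * l + 1) * r < real l + \<gamma>" using \<gamma>(2) denominator_mult by (simp only: right_diff_distrib)
  then have "r < (real l + \<gamma>) / real (2 * l + 1)" by (simp add: pos_less_divide_eq mult.commute)
  \<comment> \<open>The effective radius stays so close to \<open>r\<close> that \<gamma> still
    exceeds the excess of \<open>2 * l + 1\<close> steps over \<open>l\<close> turns.\<close>
  then have "r < min b ((real l + \<gamma>) / real (2 * l + 1))" using r(2) by simp
  from effective_radius[OF X(1) this, of strict] obtain r' where
    r': "r \<le> r'" "r' < min b ((real l + \<gamma>) / real (2 * l + 1))" "wf strict X r = wf True X r'" "VR_top strict X r = clq_top (near r') X"
    by metis
  have ar': "a < r'" "r' < b" "r' < (real l + \<gamma>) / real (2 * l + 1)" using r r' by auto
  note rb = radius_bounds[OF ar'(1)[unfolded a_def] ar'(2)[unfolded b_def]]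
  have r'\<gamma>: "real (2 * l + 1) * r' < real l + \<gamma>" using ar'(3) by (simp add: pos_less_divide_eq mult.commute)
  have "wf True X r' \<le> a"
    unfolding a_def by (rule wf_le_of_gap[OF X rb(1,2) p _ \<gamma>(1) r'\<gamma>]) (use gap in blast)
  then show "\<not> a < wf strict X r" unfolding r'(3) by simp
  have "r' \<le> \<gamma> + real l * (1 - 2 * r')" using r'\<gamma> by (simp add: algebra_simps)
  then have "\<not> clq_top (near r') X homotopy_equivalent_space nsphere (2 * l + 1)"
    using rb(2) gap by (intro gap_not_sphere[OF X(1,2) p _ rb(1)]) auto
  then show "\<not> VR_top strict X r homotopy_equivalent_space nsphere (2 * l + 1)" unfolding r'(4) .
qed

section \<open>Covering all cells: the order
  \<open>(1 / \<delta>) * ln (1 / \<delta>)\<close>\<close>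

lemma Xn_props:
  assumes "\<forall>i. \<omega> i \<in> {0..<1}"
  shows "finite (Xn \<omega> n)" "Xn \<omega> n \<subseteq> {0..<1}" "1 \<le> n \<Longrightarrow> Xn \<omega> n \<noteq> {}"
  using assms by (auto simp: Xn_def lessThan_empty_iff)

lemma cell_iff: "x \<in> cell D c \<longleftrightarrow> real c / real D \<le> x \<and> x < real c / real D + 1 / real D"
  by (simp add: cell_def add_divide_distrib add.commute)

text \<open>A point in the cell following that of \<open>p\<close> comes strictly after
  \<open>p\<close>, by less than two cell widths.\<close>

lemma cover_dense:
  assumes D: "2 \<le> D" "2 / real D \<le> g" and hit: "\<And>c. c < D \<Longrightarrow> \<not> avoids D {..<n} {c} \<omega>"
  shows "circle_dense g (Xn \<omega> n)"
  unfolding circle_dense_def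
proof
  fix p :: real assume p: "p \<in> {0..<1}"
  obtain c where c: "c < D" "p \<in> cell D c" using cell_cover[OF p, of D] D by auto
  let ?c = "(c + 1) mod D"
  have "?c < D" using D by simp
  from hit[OF this] obtain i where i: "i < n" "\<omega> i \<in> cell D ?c" unfolding avoids_def by blast
  have D0: "0 < D" using D by simp
  define q where "q = real ((c + 1) div D)"
  define h where "h = 1 / real D"
  define y where "y = real c / real D"
  have yh: "real (c + 1) / real D = y + h" by (simp add: y_def h_def add_divide_distrib)
  have rm: "real ?c / real D = y + h - q" unfolding real_mod_div[OF D0] yh q_def ..
  have "2 / real D \<le> 1" using D(1) by simp
  moreover have "2 / real D = h + h" by (simp add: h_def)
  ultimately have hh: "h + h \<le> 1" "h + h \<le> g" using D(2) by simp_all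
  have xi: "y + h - q \<le> \<omega> i" "\<omega> i < y + h - q + h" using i(2) unfolding cell_iff rm h_def[symmetric] by blast+
  have px: "y \<le> p" "p < y + h" using c(2) unfolding cell_iff y_def[symmetric] h_def[symmetric] by blast+
  note f = xi px hh
  have cd: "cdist p (\<omega> i) = \<omega> i + q - p"
  proof (rule cdist_unique)
    show "\<omega> i - p = \<omega> i + q - p + of_int (- int ((c + 1) div D))" by (simp add: q_def)
    show "0 \<le> \<omega> i + q - p" using f by linarith
    show "\<omega> i + q - p < 1" using f by linarith
  qed
  have "0 < cdist p (\<omega> i)" "cdist p (\<omega> i) < g" unfolding cd using f by linarith+
  then show "\<exists>x\<in>Xn \<omega> n. 0 < cdist p x \<and> cdist p x < g" using i(1) by (auto simp: Xn_def)
qed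

text \<open>The gap starts at the left end of the empty cell. A point reached by wrapping around 0
  is too far away, since the cell ends at or before 1.\<close>

lemma avoids_gap:
  assumes m: "1 \<le> m" "c < m" and av: "avoids m {..<n} {c} \<omega>" and x: "x \<in> Xn \<omega> n" "x \<in> {0..<1}"
  shows "\<not> (0 < cdist (real c / real m) x \<and> cdist (real c / real m) x < 1 / real m)"
proof
  assume h: "0 < cdist (real c / real m) x \<and> cdist (real c / real m) x < 1 / real m"
  have p: "real c / real m \<in> {0..<1}" using m by simp
  have x': "x \<notin> cell m c" using av x(1) by (auto simp: avoids_def Xn_def)
  define y where "y = real c / real m"
  define d where "d = 1 / real m"
  have cc: "real (c + 1) / real m = y + d" by (simp add: y_def d_def add_divide_distrib)
  have "real (c + 1) / real m \<le> 1" using m by simp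
  then have yd: "y + d \<le> 1" unfolding cc .
  have nx: "\<not> (y \<le> x \<and> x < y + d)" using x' unfolding cell_iff y_def[symmetric] d_def[symmetric] by blast
  have h': "cdist y x < d" using h unfolding y_def d_def by blast
  have py: "y \<in> {0..<1}" using p unfolding y_def .
  show False
  proof (cases "y \<le> x")
    case True
    then have "cdist y x = x - y" using cdist_eq[OF py x(2)] by simp
    then show False using nx True h' by linarith
  next
    case False
    then have "cdist y x = x - y + 1" using cdist_eq[OF py x(2)] by simp
    moreover have "0 \<le> x" using x(2) by simp
    ultimately show False using yd h' by linarith
  qed
qed

text \<open>Cells of width at most \<open>\<delta> / 4\<close> make two neighbouring cells fit into
  the mesh \<open>\<delta> / 2\<close>; \<open>T\<close> is the coupon collecting time for
  them.\<close>

lemma upper_numeric: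
  fixes \<delta> :: real
  assumes \<delta>: "0 < \<delta>" "\<delta> \<le> 1/5"
  defines "D \<equiv> nat \<lceil>4 / \<delta>\<rceil>"
  defines "T \<equiv> nat \<lceil>real D * (ln (real D) + 1)\<rceil>"
  shows "2 \<le> D" "2 / real D \<le> \<delta> / 2" "1 \<le> T" "real D * (ln (real D) + 1) \<le> real T"
    "2 * real T \<le> 32 * ((1 / \<delta>) * ln (1 / \<delta>))"
proof -
  have i: "5 \<le> 1 / \<delta>" using \<delta> by (simp add: field_simps)
  have four: "4 / \<delta> = 4 * (1 / \<delta>)" by simp
  have D1: "4 / \<delta> \<le> real D" "real D < 4 / \<delta> + 1" unfolding D_def using i four by linarith+
  have D2: "real D \<le> 5 * (1 / \<delta>)" using D1 i four by linarith
  have D20: "20 \<le> real D" using D1 i four by linarith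
  then show "2 \<le> D" by linarith
  show "2 / real D \<le> \<delta> / 2"
  proof -
    have "4 \<le> \<delta> * real D" using D1(1) \<delta> by (simp add: field_simps)
    then show ?thesis using D20 by (simp add: field_simps)
  qed
  define L where "L = ln (1 / \<delta>)"
  have "exp 1 \<le> (3::real)" by (rule exp_le)
  then have "exp 1 \<le> 1 / \<delta>" using i by linarith
  then have L1: "1 \<le> L" unfolding L_def using \<delta> by (subst ln_ge_iff) auto
  have "ln (real D) \<le> ln (5 * (1 / \<delta>))" using D2 D20 i \<delta>(1) by (subst ln_le_cancel_iff) auto
  also have "\<dots> = ln 5 + L" unfolding L_def using i \<delta>(1) by (subst ln_mult_pos) auto
  also have "\<dots> \<le> 2 * L"
  proof -
    have "ln 5 \<le> L" unfolding L_def using i \<delta>(1) by (subst ln_le_cancel_iff) auto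
    then show ?thesis by simp
  qed
  finally have lnD: "ln (real D) \<le> 2 * L" .
  have lnD0: "0 \<le> ln (real D)" using D20 by simp
  have pos: "20 \<le> real D * (ln (real D) + 1)"
  proof -
    have "real D * 1 \<le> real D * (ln (real D) + 1)" using lnD0 D20 by (intro mult_left_mono) auto
    then show ?thesis using D20 by linarith
  qed
  have T1: "real D * (ln (real D) + 1) \<le> real T" "real T < real D * (ln (real D) + 1) + 1"
    unfolding T_def using pos by linarith+
  show "real D * (ln (real D) + 1) \<le> real T" by (rule T1)
  have "1 \<le> real T" using T1 pos by linarith
  then show "1 \<le> T" by linarith
  have "real D * (ln (real D) + 1) \<le> (5 * (1 / \<delta>)) * (3 * L)"
    using D2 lnD lnD0 L1 D20 \<delta>(1) by (intro mult_mono) auto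
  then have "real T \<le> 15 * ((1 / \<delta>) * L) + 1" using T1 by (simp add: algebra_simps)
  moreover have "1 \<le> (1 / \<delta>) * L"
  proof -
    have "1 \<le> 1 / \<delta>" using i by linarith
    from mult_mono[OF this L1] have "1 * 1 \<le> (1 / \<delta>) * L" using \<delta>(1) by simp
    then show ?thesis by simp
  qed
  ultimately have "2 * real T \<le> 32 * ((1 / \<delta>) * L)" by linarith
  then show "2 * real T \<le> 32 * ((1 / \<delta>) * ln (1 / \<delta>))" by (simp only: L_def)
qed

text \<open>\<open>m\<close> is the largest number of cells that are still at least
  \<open>K * \<delta>\<close> wide. The bound on \<delta> makes
  \<open>ln (1 / (2 * K * \<delta>))\<close> at least half of \<open>ln (1 / \<delta>)\<close>,
  which absorbs \<open>K\<close> inside the logarithm.\<close>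

lemma lower_numeric:
  fixes \<delta> K :: real
  assumes K: "2 \<le> K" and \<delta>: "0 < \<delta>" "\<delta> \<le> 1 / (2 * K)\<^sup>2"
  defines "m \<equiv> nat \<lfloor>1 / (K * \<delta>)\<rfloor>"
  defines "n \<equiv> nat \<lfloor>real m / 2 * ln (real m)\<rfloor>"
  shows "2 \<le> m" "K * \<delta> \<le> 1 / real m" "real n \<le> real m / 2 * ln (real m)"
    "1 / (16 * K) * ((1 / \<delta>) * ln (1 / \<delta>)) \<le> real (n + 1) / 2"
proof -
  define x where "x = 1 / (K * \<delta>)"
  have i: "(2 * K)\<^sup>2 \<le> 1 / \<delta>" using \<delta> K by (simp add: field_simps)
  have x2: "x / 2 = (1 / \<delta>) / (2 * K)" by (simp add: x_def)
  have "(2 * K)\<^sup>2 / (2 * K) \<le> (1 / \<delta>) / (2 * K)" using i K by (intro divide_right_mono) auto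
  then have x3: "2 * K \<le> x / 2" unfolding x2 using K by (simp add: power2_eq_square)
  have x4: "4 \<le> x / 2" using x3 K by linarith
  have m1: "real m \<le> x" "x < real m + 1" unfolding m_def x_def[symmetric] using x4 by linarith+
  have m2: "x / 2 \<le> real m" using m1 x4 by linarith
  have m4: "4 \<le> real m" using m2 x4 by linarith
  then show "2 \<le> m" by linarith
  show "K * \<delta> \<le> 1 / real m"
  proof -
    have "1 / x \<le> 1 / real m" using m1 m4 by (intro divide_left_mono) auto
    then show ?thesis by (simp add: x_def)
  qed
  have lnm0: "0 \<le> real m / 2 * ln (real m)" using m4 by simp
  show "real n \<le> real m / 2 * ln (real m)" unfolding n_def using lnm0 by linarith
  have n2: "real m / 2 * ln (real m) \<le> real (n + 1)" unfolding n_def using lnm0 by linarith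
  define L where "L = ln (1 / \<delta>)"
  have "ln ((1 / \<delta>) / (2 * K)) \<le> ln (real m)" using m2 x2 x4 m4 K \<delta>(1) by (subst ln_le_cancel_iff) auto
  moreover have "ln ((1 / \<delta>) / (2 * K)) = L - ln (2 * K)" unfolding L_def using \<delta> K by (subst ln_divide_pos) auto
  moreover have "2 * ln (2 * K) \<le> L"
  proof -
    have "ln ((2 * K)\<^sup>2) = real 2 * ln (2 * K)" by (rule ln_realpow)
    then have "2 * ln (2 * K) = ln ((2 * K)\<^sup>2)" by (simp only: of_nat_numeral)
    also have "\<dots> \<le> L" unfolding L_def using i K \<delta>(1) by (subst ln_le_cancel_iff) auto
    finally show ?thesis .
  qed
  ultimately have lnm: "L / 2 \<le> ln (real m)" by linarith
  have L0: "0 \<le> L"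
  proof -
    have "1 \<le> (2 * K)\<^sup>2" using K by (intro one_le_power) linarith
    then have "1 \<le> 1 / \<delta>" using i by linarith
    then show ?thesis unfolding L_def by simp
  qed
  define A where "A = ((1 / \<delta>) / (2 * K)) * (L / 2)"
  have "A \<le> real m * ln (real m)"
    unfolding A_def using m2 x2 lnm L0 m4 K \<delta> by (intro mult_mono) auto
  then have "A / 4 \<le> (real m / 2 * ln (real m)) / 2" by simp
  also have "\<dots> \<le> real (n + 1) / 2" using n2 by simp
  also have "A / 4 = 1 / (16 * K) * ((1 / \<delta>) * L)" by (simp add: A_def)
  finally show "1 / (16 * K) * ((1 / \<delta>) * ln (1 / \<delta>)) \<le> real (n + 1) / 2" by (simp only: L_def)
qed

text \<open>Abstracted over \<open>Pr\<close> because the winding fraction and the homotopy type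
  share the argument: success on dense sets and failure in the presence of a gap decide the
  order.\<close>

lemma Theta_log:
  assumes up: "\<And>r X g. \<lbrakk>a < r; r < b; finite X; X \<subseteq> {0..<1}; circle_dense g X; 0 < g; 2 * g \<le> r - a\<rbrakk> \<Longrightarrow> Pr r X"
    and low: "\<And>r X p \<gamma>. \<lbrakk>a < r; r < b; finite X; X \<subseteq> {0..<1}; X \<noteq> {}; p \<in> {0..<1};
       \<And>x. x \<in> X \<Longrightarrow> \<not> (0 < cdist p x \<and> cdist p x < \<gamma>); \<gamma> \<le> 1; real (2 * l + 1) * (r - a) < \<gamma>\<rbrakk> \<Longrightarrow> \<not> Pr r X"
  shows "Theta_at0 a b (\<lambda>r. expected_hit (Pr r)) (\<lambda>\<delta>. (1 / \<delta>) * ln (1 / \<delta>))"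
proof -
  \<comment> \<open>One more than the factor \<open>2 * l + 1\<close> of the gap condition, which
    has to hold strictly.\<close>
  define K where "K = real (2 * l + 2)"
  have K: "2 \<le> K" by (simp add: K_def)
  define d0 where "d0 = min (1/5) (1 / (2 * K)\<^sup>2)"
  have d0: "0 < d0" using K by (simp add: d0_def)
  have main: "ennreal (1 / (16 * K) * ((1 / (r - a)) * ln (1 / (r - a)))) \<le> expected_hit (Pr r) \<and>
      expected_hit (Pr r) \<le> ennreal (32 * ((1 / (r - a)) * ln (1 / (r - a))))"
    if r: "a < r" "r < b" "r - a < d0" for r
  proof
    define \<delta> where "\<delta> = r - a"
    have \<delta>: "0 < \<delta>" "\<delta> \<le> 1/5" "\<delta> \<le> 1 / (2 * K)\<^sup>2" using r by (auto simp: \<delta>_def d0_def)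
    note U = upper_numeric[OF \<delta>(1,2)]
    have "expected_hit (Pr r) \<le> ennreal (2 * real (nat \<lceil>real (nat \<lceil>4 / \<delta>\<rceil>) * (ln (real (nat \<lceil>4 / \<delta>\<rceil>)) + 1)\<rceil>))"
    proof (rule expected_hit_cover[OF _ U(3,4)])
      show "1 \<le> nat \<lceil>4 / \<delta>\<rceil>" using U(1) by linarith
      show "AE \<omega> in circle_process. \<forall>n. 1 \<le> n \<and> (\<forall>c<nat \<lceil>4 / \<delta>\<rceil>. \<not> avoids (nat \<lceil>4 / \<delta>\<rceil>) {..<n} {c} \<omega>) \<longrightarrow> Pr r (Xn \<omega> n)"
        using AE_circle
      proof eventually_elim
        case (elim \<omega>)
        show ?case
        proof (intro allI impI)
          fix n assume h: "1 \<le> n \<and> (\<forall>c<nat \<lceil>4 / \<delta>\<rceil>. \<not> avoids (nat \<lceil>4 / \<delta>\<rceil>) {..<n} {c} \<omega>)"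
          have "circle_dense (\<delta> / 2) (Xn \<omega> n)" by (rule cover_dense[OF U(1,2)]) (use h in blast)
          then show "Pr r (Xn \<omega> n)"
            by (rule up[OF r(1,2) Xn_props(1,2)[OF elim]]) (use \<delta> in \<open>auto simp: \<delta>_def\<close>)
        qed
      qed
    qed
    also have "\<dots> \<le> ennreal (32 * ((1 / \<delta>) * ln (1 / \<delta>)))" by (rule ennreal_leI[OF U(5)])
    finally show "expected_hit (Pr r) \<le> ennreal (32 * ((1 / (r - a)) * ln (1 / (r - a))))" by (simp only: \<delta>_def)
    note N = lower_numeric[OF K \<delta>(1,3)]
    define m where "m = nat \<lfloor>1 / (K * \<delta>)\<rfloor>"
    have "ennreal (1 / (16 * K) * ((1 / \<delta>) * ln (1 / \<delta>))) \<le> ennreal (real (nat \<lfloor>real m / 2 * ln (real m)\<rfloor> + 1) / 2)"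
      unfolding m_def by (rule ennreal_leI[OF N(4)])
    also have "\<dots> \<le> expected_hit (Pr r)"
    proof (rule expected_hit_empty_cell)
      show "2 \<le> m" unfolding m_def by (rule N(1))
      show "real (nat \<lfloor>real m / 2 * ln (real m)\<rfloor>) \<le> real m / 2 * ln (real m)" unfolding m_def by (rule N(3))
      have m1: "1 \<le> m" using \<open>2 \<le> m\<close> by simp
      show "AE \<omega> in circle_process. \<forall>k c. 1 \<le> k \<and> c < m \<and> avoids m {..<k} {c} \<omega> \<longrightarrow> \<not> Pr r (Xn \<omega> k)"
        using AE_circle
      proof eventually_elim
        case (elim \<omega>)
        show ?case
        proof (intro allI impI)
          fix k c assume h: "1 \<le> k \<and> c < m \<and> avoids m {..<k} {c} \<omega>"
          show "\<not> Pr r (Xn \<omega> k)"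
          proof (rule low[OF r(1,2) Xn_props(1,2)[OF elim] Xn_props(3)[OF elim]])
            show "1 \<le> k" using h by blast
            show "real c / real m \<in> {0..<1}" using h by simp
            show "\<not> (0 < cdist (real c / real m) x \<and> cdist (real c / real m) x < 1 / real m)" if "x \<in> Xn \<omega> k" for x
              by (rule avoids_gap[OF m1 _ _ that]) (use h that Xn_props(2)[OF elim, of k] in blast)+
            show "1 / real m \<le> 1" using m1 by simp
            have "real (2 * l + 1) * \<delta> < K * \<delta>" using \<delta>(1) by (intro mult_strict_right_mono) (simp_all add: K_def)
            also have "\<dots> \<le> 1 / real m" unfolding m_def by (rule N(2))
            finally show "real (2 * l + 1) * (r - a) < 1 / real m" by (simp only: \<delta>_def)
          qed
        qed
      qed
    qed
    finally show "ennreal (1 / (16 * K) * ((1 / (r - a)) * ln (1 / (r - a)))) \<le> expected_hit (Pr r)" by (simp only: \<delta>_def)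
  qed
  have K0: "0 < 1 / (16 * K)" using K by simp
  show ?thesis unfolding Theta_at0_def
    by (rule exI[of _ "1 / (16 * K)"], rule exI[of _ 32], rule exI[of _ d0]) (use main d0 K0 in auto)
qed

section \<open>Nearly regular tuples of points: the order with exponent
  \<open>2 * l / (2 * l + 1)\<close>\<close>

lemma cells_hit:
  assumes r: "a < r" "r < b" and X: "finite X" "X \<subseteq> {0..<1}" and M: "1 \<le> M" "1 / real M \<le> r - a"
    and p: "\<And>s. s < 2 * l + 1 \<Longrightarrow> \<exists>x\<in>X. x \<in> cell ((2 * l + 1) * M) (s * M + c)"
  shows "a \<le> wf strict X r"
proof -
  obtain r' where r': "r \<le> r'" "r' < b" "wf strict X r = wf True X r'"
    using effective_radius[OF X(1) r(2)] by metis
  have ar': "a < r'" using r r' by linarith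
  note rb = radius_bounds[OF ar'[unfolded a_def] r'(2)[unfolded b_def]]
  obtain q where q: "\<And>s. s < 2 * l + 1 \<Longrightarrow> q s \<in> X \<and> q s \<in> cell ((2 * l + 1) * M) (s * M + c)"
    using p by metis
  have "real M \<le> real ((2 * l + 1) * M)" using of_nat_mono[of M "(2 * l + 1) * M"] by simp
  moreover have "0 < real ((2 * l + 1) * M)" unfolding of_nat_0_less_iff using M by simp
  moreover have "0 < real M" using M by simp
  ultimately have "1 / real ((2 * l + 1) * M) \<le> 1 / real M" by (intro divide_left_mono mult_pos_pos zero_le_one)
  then have le: "a + 1 / real ((2 * l + 1) * M) \<le> r'" using M r' by linarith
  have "real l / real (2 * l + 1) \<le> wf True X r'"
  proof (rule wf_ge_of_cells[OF X rb(1)])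
    show "r' < 1" using rb(2) by simp
    show "0 < M" using M by simp
    show "q s \<in> X \<and> real (s * M + c) / real ((2 * l + 1) * M) \<le> q s \<and> q s < real (s * M + c + 1) / real ((2 * l + 1) * M)"
      if "s < 2 * l + 1" for s using q[OF that] unfolding cell_def atLeastLessThan_iff .
    show "real l / real (2 * l + 1) + 1 / real ((2 * l + 1) * M) \<le> r'" using le unfolding a_def .
  qed
  then show ?thesis unfolding r'(3) a_def .
qed

text \<open>Put \<open>L = 2 * l + 1\<close> and let \<open>p\<close> be the chance that a group
  hits its cell. Up to rounding, \<open>n\<close> makes \<open>n / (2 * L * M)\<close> equal to
  \<open>M powr (- 1 / L)\<close>, the value of \<open>p\<close> at which
  \<open>M * p ^ L = 1\<close>. The linear bound \<open>p \<ge> n / (2 * L * M)\<close> holds for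
  \<open>n \<le> L * M\<close>; beyond that \<open>p \<ge> 1/2\<close>, and smallness of \<delta>
  gives \<open>M \<ge> 2 ^ L\<close>.\<close>

lemma block_numeric:
  fixes \<delta> :: real
  assumes \<delta>: "0 < \<delta>" "\<delta> \<le> (1/2) ^ (2 * l + 1)"
  defines "\<beta> \<equiv> real (2 * l) / real (2 * l + 1)" and "M \<equiv> nat \<lceil>1 / \<delta>\<rceil>"
  defines "n \<equiv> nat \<lceil>2 * real (2 * l + 1) * real M powr \<beta>\<rceil>"
  shows "1 \<le> M" "1 / real M \<le> \<delta>" "1 \<le> n"
    "1 \<le> real M * (1 - (1 - 1 / real ((2 * l + 1) * M)) ^ n) ^ (2 * l + 1)"
    "2 * real ((2 * l + 1) * n) \<le> 2 * real (2 * l + 1) * (2 * real (2 * l + 1) + 1) * 2 powr \<beta> * (1 / \<delta>) powr \<beta>"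
proof -
  define L where "L = 2 * l + 1"
  have L1: "1 \<le> real L" by (simp add: L_def)
  have "(1/2::real) ^ L \<le> 1" by (simp add: power_le_one)
  then have \<delta>1: "\<delta> \<le> 1" using \<delta>(2) unfolding L_def by linarith
  have i: "2 ^ L \<le> 1 / \<delta>"
    using \<delta> unfolding L_def by (simp add: power_divide field_simps)
  have i1: "1 \<le> 1 / \<delta>" using \<delta> \<delta>1 by simp
  have M1: "1 / \<delta> \<le> real M" "real M < 1 / \<delta> + 1" unfolding M_def using i1 by linarith+
  have Mr: "1 \<le> real M" using M1 i1 by linarith
  then show M1': "1 \<le> M" by linarith
  show "1 / real M \<le> \<delta>" using M1(1) Mr \<delta>(1) by (simp add: field_simps)
  have M2: "real M \<le> 2 * (1 / \<delta>)" using M1 i1 by linarith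
  have \<beta>0: "0 \<le> \<beta>" by (simp add: \<beta>_def)
  have Mb: "1 \<le> real M powr \<beta>" using Mr \<beta>0 by (simp add: ge_one_powr_ge_zero)
  define y where "y = 2 * real L * real M powr \<beta>"
  have y2: "2 \<le> y"
  proof -
    have "1 * 1 \<le> real L * real M powr \<beta>" using L1 Mb by (intro mult_mono) auto
    then show ?thesis by (simp add: y_def)
  qed
  have n1: "y \<le> real n" "real n < y + 1" unfolding n_def L_def[symmetric] y_def[symmetric] using y2 by linarith+
  have "1 \<le> real n" using n1 y2 by linarith
  then show "1 \<le> n" by linarith
  define D where "D = L * M"
  have Dr: "real D = real L * real M" by (simp add: D_def)
  have D0: "0 < D" using M1' by (simp add: D_def L_def)
  have Dr0: "0 < real D" using D0 by simp
  define p where "p = 1 - (1 - 1 / real D) ^ n"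
  have pe: "1 - exp (- (real n / real D)) \<le> p" unfolding p_def using one_minus_power_le_exp[OF D0, of n] by linarith
  have "1 \<le> real M * p ^ L"
  proof (cases "n \<le> D")
    case True
    then have q: "real n / real D \<le> 1" using Dr0 by simp
    have "exp (- (2 * (real n / real D / 2))) \<le> 1 - real n / real D / 2"
      by (rule one_minus_ge_exp) (use q in auto)
    then have "real n / real D / 2 \<le> p" using pe by simp
    moreover have "real M powr (- 1 / real L) \<le> real n / real D / 2"
    proof -
      have "real M powr (- 1 / real L) = real M powr \<beta> / real M"
      proof -
        have "\<beta> - 1 = - 1 / real L" unfolding \<beta>_def L_def by (simp add: field_simps)
        then have "real M powr (- 1 / real L) = real M powr (\<beta> - 1)" by simp
        also have "\<dots> = real M powr \<beta> / real M" using Mr by (simp add: powr_diff)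
        finally show ?thesis .
      qed
      also have "\<dots> = y / real D / 2" unfolding y_def Dr using L1 by simp
      also have "\<dots> \<le> real n / real D / 2" using n1 Dr0 by (intro divide_right_mono) auto
      finally show ?thesis .
    qed
    ultimately have "real M powr (- 1 / real L) \<le> p" by linarith
    then have "(real M powr (- 1 / real L)) ^ L \<le> p ^ L" by (intro power_mono) auto
    moreover have "(real M powr (- 1 / real L)) ^ L = 1 / real M"
    proof -
      have "(real M powr (- 1 / real L)) ^ L = real M powr (- 1 / real L * real L)"
        using Mr by (simp add: powr_powr flip: powr_realpow)
      also have "- 1 / real L * real L = -1" using L1 by simp
      also have "real M powr (-1) = 1 / real M" using Mr by (simp add: powr_minus_divide)
      finally show ?thesis .
    qed
    ultimately have "1 / real M \<le> p ^ L" by simp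
    then show ?thesis using Mr by (simp add: field_simps)
  next
    case False
    then have "1 \<le> real n / real D" using Dr0 by simp
    then have "exp (- (real n / real D)) \<le> exp (- 1)" by simp
    moreover have "exp (- 1) \<le> (1/2::real)"
    proof -
      have "2 \<le> exp (1::real)" using exp_ge_add_one_self[of 1] by simp
      then show ?thesis by (simp add: exp_minus field_simps)
    qed
    ultimately have "1/2 \<le> p" using pe by linarith
    then have "(1/2) ^ L \<le> p ^ L" by (intro power_mono) auto
    moreover have "2 ^ L \<le> real M" using i M1(1) by linarith
    ultimately have "2 ^ L * (1/2) ^ L \<le> real M * p ^ L" by (intro mult_mono) simp_all
    then show ?thesis by (simp add: power_divide)
  qed
  then show "1 \<le> real M * (1 - (1 - 1 / real ((2 * l + 1) * M)) ^ n) ^ (2 * l + 1)"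
    unfolding p_def D_def L_def .
  have "real n \<le> (2 * real L + 1) * real M powr \<beta>" using n1 Mb by (simp add: y_def algebra_simps)
  also have "\<dots> \<le> (2 * real L + 1) * (2 powr \<beta> * (1 / \<delta>) powr \<beta>)"
  proof (rule mult_left_mono)
    have "real M powr \<beta> \<le> (2 * (1 / \<delta>)) powr \<beta>" using M2 Mr \<beta>0 by (intro powr_mono2) auto
    then show "real M powr \<beta> \<le> 2 powr \<beta> * (1 / \<delta>) powr \<beta>" by (simp only: powr_mult)
  qed simp
  finally have "real n \<le> (2 * real L + 1) * (2 powr \<beta> * (1 / \<delta>) powr \<beta>)" .
  then have "2 * real L * real n \<le> 2 * real L * ((2 * real L + 1) * (2 powr \<beta> * (1 / \<delta>) powr \<beta>))"
    using L1 by (intro mult_left_mono) auto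
  then have "2 * real (L * n) \<le> 2 * real L * (2 * real L + 1) * 2 powr \<beta> * (1 / \<delta>) powr \<beta>"
    by (simp only: of_nat_mult mult.assoc)
  then show "2 * real ((2 * l + 1) * n) \<le> 2 * real (2 * l + 1) * (2 * real (2 * l + 1) + 1) * 2 powr \<beta> * (1 / \<delta>) powr \<beta>"
    unfolding L_def .
qed

lemma expected_M_upper:
  assumes r: "a < r" "r < b" "r - a \<le> (1/2) ^ (2 * l + 1)"
  defines "\<beta> \<equiv> real (2 * l) / real (2 * l + 1)"
  shows "expected_hit (\<lambda>X. a \<le> wf strict X r) \<le>
    ennreal (2 * real (2 * l + 1) * (2 * real (2 * l + 1) + 1) * 2 powr \<beta> * (1 / (r - a)) powr \<beta>)"
proof -
  define \<delta> where "\<delta> = r - a"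
  have \<delta>: "0 < \<delta>" "\<delta> \<le> (1/2) ^ (2 * l + 1)" using r by (simp_all add: \<delta>_def)
  define M where "M = nat \<lceil>1 / \<delta>\<rceil>"
  define n where "n = nat \<lceil>2 * real (2 * l + 1) * real M powr \<beta>\<rceil>"
  note B = block_numeric[OF \<delta>, folded M_def, folded \<beta>_def, folded n_def]
  have L1: "1 \<le> 2 * l + 1" by simp
  have "expected_hit (\<lambda>X. a \<le> wf strict X r) \<le> ennreal (2 * real ((2 * l + 1) * n))"
  proof (rule expected_hit_block[where Pr = "\<lambda>X. a \<le> wf strict X r", OF L1 B(1,3) B(4)])
    show "AE \<omega> in circle_process. \<forall>j c. c < M \<and>
        (\<forall>s<2 * l + 1. \<not> avoids ((2 * l + 1) * M) {(j * (2 * l + 1) + s) * n..<(j * (2 * l + 1) + s + 1) * n} {s * M + c} \<omega>) \<longrightarrow>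
        a \<le> wf strict (Xn \<omega> (Suc j * ((2 * l + 1) * n))) r"
      using AE_circle
    proof eventually_elim
      case (elim \<omega>)
      show ?case
      proof (intro allI impI)
        fix j c assume h: "c < M \<and> (\<forall>s<2 * l + 1. \<not> avoids ((2 * l + 1) * M) {(j * (2 * l + 1) + s) * n..<(j * (2 * l + 1) + s + 1) * n} {s * M + c} \<omega>)"
        show "a \<le> wf strict (Xn \<omega> (Suc j * ((2 * l + 1) * n))) r"
        proof (rule cells_hit[OF r(1,2) Xn_props(1,2)[OF elim] B(1)])
          show "1 / real M \<le> r - a" using B(2) unfolding \<delta>_def .
          fix s assume s: "s < 2 * l + 1"
          then have "\<not> avoids ((2 * l + 1) * M) {(j * (2 * l + 1) + s) * n..<(j * (2 * l + 1) + s + 1) * n} {s * M + c} \<omega>"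
            using h by blast
          then obtain i where i: "i \<in> {(j * (2 * l + 1) + s) * n..<(j * (2 * l + 1) + s + 1) * n}"
              "\<omega> i \<in> cell ((2 * l + 1) * M) (s * M + c)"
            unfolding avoids_def by blast
          have i1: "i < (j * (2 * l + 1) + s + 1) * n" using i(1) unfolding atLeastLessThan_iff by blast
          have "(j * (2 * l + 1) + s + 1) * n \<le> (j * (2 * l + 1) + (2 * l + 1)) * n" using s by (intro mult_le_mono1) simp
          also have "\<dots> = Suc j * ((2 * l + 1) * n)" by (simp add: algebra_simps)
          finally have "i < Suc j * ((2 * l + 1) * n)" using i1 by (rule less_le_trans[rotated])
          then have "\<omega> i \<in> Xn \<omega> (Suc j * ((2 * l + 1) * n))" unfolding Xn_def by blast
          then show "\<exists>x\<in>Xn \<omega> (Suc j * ((2 * l + 1) * n)). x \<in> cell ((2 * l + 1) * M) (s * M + c)" using i(2) by blast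
        qed
      qed
    qed
  qed
  also have "\<dots> \<le> ennreal (2 * real (2 * l + 1) * (2 * real (2 * l + 1) + 1) * 2 powr \<beta> * (1 / \<delta>) powr \<beta>)"
    by (rule ennreal_leI[OF B(5)])
  finally show ?thesis unfolding \<delta>_def .
qed

text \<open>Modulo 1 the \<open>j\<close>-th point is within one cell width of
  \<open>x 0 + j * a\<close>, so the cell \<open>c\<close> of \<open>x 0\<close> determines its cell
  up to four choices, encoded by \<open>e j\<close>. This leaves only
  \<open>D * 4 ^ (2 * l + 1)\<close> cell tuples for the union bound.\<close>

lemma tuple_cells:
  assumes l: "1 \<le> l" and r: "a < r" "r < b" and X: "finite X" "X \<subseteq> {0..<1}" "X \<noteq> {}"
    and D: "1 \<le> D" "real (8 * l + 4) * (r - a) \<le> 1 / real D"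
    and small: "2 * (real (8 * l + 4) * (r - a)) * real (2 * l + 1) < 1" "2 * (r - a) \<le> a"
    and wf: "a \<le> wf strict X r"
  shows "\<exists>x c e. inj_on x {..2 * l} \<and> (\<forall>j\<le>2 * l. x j \<in> X) \<and> c < D \<and> e \<in> PiE {..2 * l} (\<lambda>_. {..<4}) \<and>
    (\<forall>j\<le>2 * l. x j \<in> cell D (nat ((int c + \<lfloor>real D * (real j * a)\<rfloor> + int (e j) - 1) mod int D)))"
proof -
  define Q where "Q = real (8 * l + 4) * (r - a)"
  \<comment> \<open>Letting the effective radius be up to twice as far from \<open>a\<close> turns
    the constant \<open>4 * l + 2\<close> into \<open>8 * l + 4\<close>.\<close>
  have "r < min b (a + 2 * (r - a))" using r by simp
  from effective_radius[OF X(1) this, of strict] obtain r' where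
    r': "r \<le> r'" "r' < min b (a + 2 * (r - a))" "wf strict X r = wf True X r'" by metis
  have ar': "a < r'" "r' < b" "r' - a < 2 * (r - a)" using r r' by auto
  note rb = radius_bounds[OF ar'(1)[unfolded a_def] ar'(2)[unfolded b_def]]
  have p1: "r' = a + (r' - a)" by simp
  have p2: "0 < r' - a" "r' - a < a" using ar' small(2) by linarith+
  have p3: "a \<le> wf True X r'" using wf r'(3) by simp
  have "\<exists>x. \<forall>j\<le>2 * l. x j \<in> X \<and> (\<exists>z::int. \<bar>x j - x 0 - real j * a + of_int z\<bar> \<le> real (4 * l + 2) * (r' - a))"
    using wf_ge_tuple[OF X rb(1,2), where l = l and \<delta> = "r' - a", folded a_def, OF p1 p2 p3] .
  then obtain x where x: "\<And>j. j \<le> 2 * l \<Longrightarrow> x j \<in> X"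
    "\<And>j. j \<le> 2 * l \<Longrightarrow> \<exists>z::int. \<bar>x j - x 0 - real j * a + of_int z\<bar> \<le> real (4 * l + 2) * (r' - a)" by blast
  have le: "real (4 * l + 2) * (r' - a) \<le> Q"
  proof -
    have "real (4 * l + 2) * (r' - a) \<le> real (4 * l + 2) * (2 * (r - a))" using ar'(3) by (intro mult_left_mono) auto
    also have "\<dots> = Q" by (simp add: Q_def algebra_simps)
    finally show ?thesis .
  qed
  have "\<forall>j. \<exists>z::int. j \<le> 2 * l \<longrightarrow> \<bar>x j - x 0 - real j * a + of_int z\<bar> \<le> Q"
    using x(2) le by (meson order_trans)
  then obtain z :: "nat \<Rightarrow> int" where z: "\<And>j. j \<le> 2 * l \<Longrightarrow> \<bar>x j - x 0 - real j * a + of_int (z j)\<bar> \<le> Q" by metis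
  have x01: "x j \<in> {0..<1}" if "j \<le> 2 * l" for j using x(1)[OF that] X by blast
  have D0: "0 < D" "0 < real D" using D by auto
  have "\<forall>j. \<exists>t. j \<le> 2 * l \<longrightarrow> t < D \<and> x j \<in> cell D t"
  proof
    fix j show "\<exists>t. j \<le> 2 * l \<longrightarrow> t < D \<and> x j \<in> cell D t"
      using cell_cover[OF x01 D0(1), of j] by metis
  qed
  then obtain t where t: "\<And>j. j \<le> 2 * l \<Longrightarrow> t j < D" "\<And>j. j \<le> 2 * l \<Longrightarrow> x j \<in> cell D (t j)" by metis
  define E where "E j = int (t j) - int (t 0) + int D * z j - \<lfloor>real D * (real j * a)\<rfloor>" for j
  \<comment> \<open>Rounding \<open>x j\<close>, \<open>x 0\<close> and \<open>D * j * a\<close> to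
    integers, plus a deviation of at most one cell, confines the correction strictly between -2 and
    3.\<close>
  have E: "-1 \<le> E j \<and> E j \<le> 2" if j: "j \<le> 2 * l" for j
  proof -
    have tb: "real (t j) \<le> real D * x j" "real D * x j < real (t j) + 1" if "j \<le> 2 * l" for j
      using t(2)[OF that] D0 unfolding cell_iff by (simp_all add: field_simps)
    define w where "w = x j - x 0 - real j * a + of_int (z j)"
    have "\<bar>w\<bar> \<le> 1 / real D" using z[OF j] D(2) unfolding w_def Q_def by linarith
    then have "real D * \<bar>w\<bar> \<le> 1" using D0 by (simp add: field_simps)
    then have "\<bar>real D * w\<bar> \<le> 1" using D0 by (simp add: abs_mult)
    then have w1: "- 1 \<le> real D * w" "real D * w \<le> 1" by linarith+
    define y where "y = real D * (real j * a)"
    have eq: "real D * w = real D * x j - real D * x 0 - y + real D * of_int (z j)"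
      by (simp add: w_def y_def algebra_simps)
    define F where "F = \<lfloor>y\<rfloor>"
    have fl: "of_int F \<le> y" "y < of_int F + 1" unfolding F_def by linarith+
    have rE: "real_of_int (E j) = real (t j) - real (t 0) + real D * of_int (z j) - of_int F"
      by (simp add: E_def F_def y_def)
    have "-2 < real_of_int (E j)" "real_of_int (E j) < 3"
      using w1 eq fl tb[OF j] tb[of 0] unfolding rE by linarith+
    then show ?thesis by linarith
  qed
  define e where "e = restrict (\<lambda>j. nat (E j + 1)) {..2 * l}"
  have e4: "nat (E j + 1) < 4" "int (nat (E j + 1)) = E j + 1" if "j \<le> 2 * l" for j
    using E[OF that] by linarith+
  have e: "e \<in> PiE {..2 * l} (\<lambda>_. {..<4})" unfolding e_def using e4(1) by (intro restrict_PiE_iff[THEN iffD2]) auto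
  have cell: "x j \<in> cell D (nat ((int (t 0) + \<lfloor>real D * (real j * a)\<rfloor> + int (e j) - 1) mod int D))" if j: "j \<le> 2 * l" for j
  proof -
    have "int (t 0) + \<lfloor>real D * (real j * a)\<rfloor> + int (e j) - 1 = int (t j) + int D * z j"
      using e4(2)[OF j] j by (simp add: e_def E_def)
    then have "(int (t 0) + \<lfloor>real D * (real j * a)\<rfloor> + int (e j) - 1) mod int D = int (t j) mod int D"
      by (simp only: mod_mult_self2)
    also have "\<dots> = int (t j)" using t(1)[OF j] by simp
    finally show ?thesis using t(2)[OF j] by simp
  qed
  \<comment> \<open>A coincidence would put \<open>d * l / (2 * l + 1)\<close> with
    \<open>0 < d < 2 * l + 1\<close> closer than \<open>1 / (2 * l + 1)\<close> to an integer, hence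
    onto it; but \<open>l\<close> and \<open>2 * l + 1\<close> are coprime.\<close>
  have ne: "x i \<noteq> x j" if ij: "i < j" "j \<le> 2 * l" for i j
  proof
    assume eq: "x i = x j"
    define d where "d = j - i"
    have d: "0 < d" "d < 2 * l + 1" "real d = real j - real i" using ij by (auto simp: d_def of_nat_diff)
    define zz where "zz = z j - z i"
    define da where "da = real j * a - real i * a"
    have "\<bar>of_int zz - da\<bar> \<le> 2 * Q"
      using z[of i] z[of j] ij eq unfolding zz_def da_def of_int_diff by linarith
    then have "\<bar>of_int zz - real d * a\<bar> \<le> 2 * Q" by (simp only: d(3) left_diff_distrib da_def)
    then have "\<bar>of_int zz - real d * a\<bar> * real (2 * l + 1) \<le> 2 * Q * real (2 * l + 1)" by (intro mult_right_mono) auto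
    also have "\<dots> < 1" using small(1) by (simp only: Q_def)
    also have "\<bar>of_int zz - real d * a\<bar> * real (2 * l + 1) = \<bar>(of_int zz - real d * a) * real (2 * l + 1)\<bar>" by (simp add: abs_mult)
    also have "(of_int zz - real d * a) * real (2 * l + 1) = of_int (zz * int (2 * l + 1) - int (d * l))"
    proof -
      have "(of_int zz - real d * a) * real (2 * l + 1) = of_int zz * real (2 * l + 1) - real d * (real (2 * l + 1) * a)"
        by (simp only: left_diff_distrib mult.assoc mult.commute[of a])
      then show ?thesis unfolding denominator_mult by simp
    qed
    finally have "\<bar>real_of_int (zz * int (2 * l + 1) - int (d * l))\<bar> < 1" .
    then have "zz * int (2 * l + 1) - int (d * l) = 0" by linarith
    then have "int (2 * l + 1) dvd int (d * l)" by (metis dvd_triv_right eq_iff_diff_eq_0)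
    then have "2 * l + 1 dvd d * l" by (simp only: int_dvd_int_iff)
    moreover have "coprime (2 * l + 1) l"
    proof (rule coprimeI)
      fix c assume c: "c dvd 2 * l + 1" "c dvd l"
      then have "c dvd 2 * l" by simp
      then show "c dvd 1" using c(1) by (simp only: dvd_add_right_iff)
    qed
    ultimately have "2 * l + 1 dvd d" by (simp add: coprime_dvd_mult_left_iff)
    then show False using d by (auto dest: dvd_imp_le)
  qed
  have "inj_on x {..2 * l}"
    by (rule linorder_inj_onI) (use ne in auto)
  then show ?thesis using x(1) t(1)[of 0] e cell
    by (intro exI[of _ x] exI[of _ "t 0"] exI[of _ e]) auto
qed

text \<open>\<open>D\<close> is the largest number of cells at least \<open>Q * \<delta>\<close>
  wide. With \<open>L = 2 * l + 1\<close>, the 8 in \<open>N\<close> gives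
  \<open>N ^ L \<le> D ^ (2 * l) / 8 ^ L\<close>, which pays for the four choices per point and
  leaves \<open>2 ^ L \<ge> 2\<close> for the probability 1/2.\<close>

lemma tuple_numeric:
  fixes \<delta> Q :: real
  assumes Q: "1 \<le> Q" and \<delta>: "0 < \<delta>" "Q * \<delta> \<le> 1/2"
  defines "\<beta> \<equiv> real (2 * l) / real (2 * l + 1)" and "D \<equiv> nat \<lfloor>1 / (Q * \<delta>)\<rfloor>"
  defines "N \<equiv> nat \<lfloor>real D powr \<beta> / 8\<rfloor>"
  shows "1 \<le> D" "Q * \<delta> \<le> 1 / real D" "2 * (real (D * 4 ^ Suc (2 * l)) * real N ^ Suc (2 * l)) \<le> real D ^ Suc (2 * l)"
    "(1 / (2 * Q)) powr \<beta> / 16 * (1 / \<delta>) powr \<beta> \<le> real (N + 1) / 2"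
proof -
  define x where "x = 1 / (Q * \<delta>)"
  have Q\<delta>: "0 < Q * \<delta>" using Q \<delta> by simp
  have x2: "2 \<le> x" using \<delta>(2) Q\<delta> by (simp add: x_def field_simps)
  have D1: "real D \<le> x" "x < real D + 1" unfolding D_def x_def[symmetric] using x2 by linarith+
  have Dx: "x / 2 \<le> real D" "1 \<le> real D" using D1 x2 by linarith+
  then show D1': "1 \<le> D" by linarith
  have "1 / x \<le> 1 / real D" using D1 Dx x2 by (intro divide_left_mono) auto
  then show "Q * \<delta> \<le> 1 / real D" by (simp add: x_def)
  define L where "L = Suc (2 * l)"
  have \<beta>0: "0 \<le> \<beta>" by (simp add: \<beta>_def)
  define y where "y = real D powr \<beta>"
  have y1: "1 \<le> y" unfolding y_def using Dx \<beta>0 by (simp add: ge_one_powr_ge_zero)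
  have N1: "real N \<le> y / 8" "y / 8 < real (N + 1)" unfolding N_def y_def[symmetric] using y1 by linarith+
  have yL: "y ^ L = real D ^ (2 * l)"
  proof -
    have "y ^ L = real D powr (\<beta> * real L)" unfolding y_def using Dx by (simp add: powr_powr flip: powr_realpow)
    also have "\<beta> * real L = real (2 * l)" by (simp add: \<beta>_def L_def)
    also have "real D powr real (2 * l) = real D ^ (2 * l)" using Dx by (subst powr_realpow) auto
    finally show ?thesis .
  qed
  have "real N ^ L \<le> (y / 8) ^ L" using N1(1) by (intro power_mono) auto
  also have "\<dots> = real D ^ (2 * l) / 8 ^ L" by (simp add: power_divide yL)
  finally have NL: "real N ^ L \<le> real D ^ (2 * l) / 8 ^ L" .
  have "2 * (real (D * 4 ^ L) * real N ^ L) = (2 * real D * 4 ^ L) * real N ^ L" by simp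
  also have "\<dots> \<le> (2 * real D * 4 ^ L) * (real D ^ (2 * l) / 8 ^ L)" using NL by (intro mult_left_mono) auto
  also have "\<dots> = real D ^ L * (2 * (4 ^ L / 8 ^ L))" by (simp add: L_def)
  also have "(4::real) ^ L / 8 ^ L = (1/2) ^ L" by (simp flip: power_divide)
  also have "real D ^ L * (2 * (1/2) ^ L) \<le> real D ^ L * 1"
  proof (rule mult_left_mono)
    have "(1/2::real) ^ (2 * l) \<le> 1" by (simp add: power_le_one)
    then show "2 * (1/2::real) ^ L \<le> 1" by (simp add: L_def)
  qed simp
  finally show "2 * (real (D * 4 ^ Suc (2 * l)) * real N ^ Suc (2 * l)) \<le> real D ^ Suc (2 * l)" unfolding L_def by simp
  have "(1 / (2 * Q)) powr \<beta> * (1 / \<delta>) powr \<beta> = (1 / (2 * Q) * (1 / \<delta>)) powr \<beta>"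
    by (simp only: powr_mult)
  also have "1 / (2 * Q) * (1 / \<delta>) = x / 2" by (simp add: x_def)
  also have "(x / 2) powr \<beta> \<le> y" unfolding y_def using Dx x2 \<beta>0 by (intro powr_mono2) auto
  finally have A: "(1 / (2 * Q)) powr \<beta> * (1 / \<delta>) powr \<beta> \<le> y" .
  have "u / 16 \<le> w / 2" if "u \<le> v" "v / 8 < w" for u v w :: real using that by (simp add: field_simps)
  from this[OF A N1(2)] have "(1 / (2 * Q)) powr \<beta> * (1 / \<delta>) powr \<beta> / 16 \<le> real (N + 1) / 2" .
  then show "(1 / (2 * Q)) powr \<beta> / 16 * (1 / \<delta>) powr \<beta> \<le> real (N + 1) / 2" by (simp only: times_divide_eq_left)
qed

lemma expected_M_lower:
  assumes l: "1 \<le> l" and r: "a < r" "r < b"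
    and small: "2 * (real (8 * l + 4) * (r - a)) * real (2 * l + 1) < 1" "2 * (r - a) \<le> a"
  defines "\<beta> \<equiv> real (2 * l) / real (2 * l + 1)"
  shows "ennreal ((1 / (2 * real (8 * l + 4))) powr \<beta> / 16 * (1 / (r - a)) powr \<beta>) \<le> expected_hit (\<lambda>X. a \<le> wf strict X r)"
proof -
  define \<delta> where "\<delta> = r - a"
  define Q where "Q = real (8 * l + 4)"
  have \<delta>: "0 < \<delta>" using r by (simp add: \<delta>_def)
  have Q1: "1 \<le> Q" by (simp add: Q_def)
  have "2 * (Q * \<delta>) * 1 \<le> 2 * (Q * \<delta>) * real (2 * l + 1)" using \<delta> Q1 by (intro mult_left_mono) auto
  then have Qd: "Q * \<delta> \<le> 1/2" using small(1) unfolding Q_def[symmetric] \<delta>_def[symmetric] by linarith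
  define D where "D = nat \<lfloor>1 / (Q * \<delta>)\<rfloor>"
  define N where "N = nat \<lfloor>real D powr \<beta> / 8\<rfloor>"
  note T = tuple_numeric[OF Q1 \<delta> Qd, folded D_def, folded \<beta>_def, folded N_def]
  define \<tau> where "\<tau> = (\<lambda>(c::nat, e::nat \<Rightarrow> nat) j. nat ((int c + \<lfloor>real D * (real j * a)\<rfloor> + int (e j) - 1) mod int D))"
  define P where "P = {..<D} \<times> PiE {..2 * l} (\<lambda>_. {..<4::nat})"
  have finP: "finite P" unfolding P_def by (intro finite_cartesian_product finite_PiE) auto
  have cardP: "card P = D * 4 ^ Suc (2 * l)" unfolding P_def by (simp add: card_cartesian_product card_PiE)
  have cardF: "card (\<tau> ` P) \<le> D * 4 ^ Suc (2 * l)" using card_image_le[OF finP, of \<tau>] cardP by simp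
  have "ennreal ((1 / (2 * Q)) powr \<beta> / 16 * (1 / \<delta>) powr \<beta>) \<le> ennreal (real (N + 1) / 2)" by (rule ennreal_leI[OF T(4)])
  also have "\<dots> \<le> expected_hit (\<lambda>X. a \<le> wf strict X r)"
  proof (rule expected_hit_tuple[where D = D and F = "\<tau> ` P" and k = "2 * l"])
    show D0: "0 < D" using T(1) by simp
    show "finite (\<tau> ` P)" using finP by simp
    show "t j < D" if "t \<in> \<tau> ` P" for t j
    proof -
      from that obtain ce where t: "t = \<tau> ce" by (elim imageE)
      have "int D > 0" using D0 by simp
      then have "nat (k mod int D) < D" for k by (simp only: nat_less_iff pos_mod_sign pos_mod_bound)
      then show ?thesis unfolding t \<tau>_def case_prod_beta .
    qed
    have "real (card (\<tau> ` P)) \<le> real (D * 4 ^ Suc (2 * l))" using cardF by (rule of_nat_mono)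
    then have "real (card (\<tau> ` P)) * real N ^ Suc (2 * l) \<le> real (D * 4 ^ Suc (2 * l)) * real N ^ Suc (2 * l)"
      by (rule mult_right_mono) (rule zero_le_power, rule of_nat_0_le_iff)
    then have "2 * (real (card (\<tau> ` P)) * real N ^ Suc (2 * l)) \<le> 2 * (real (D * 4 ^ Suc (2 * l)) * real N ^ Suc (2 * l))"
      by (rule mult_left_mono) (rule zero_le_numeral)
    then show "2 * (real (card (\<tau> ` P)) * real N ^ Suc (2 * l)) \<le> real D ^ Suc (2 * l)" using T(3) by (rule order_trans)
    show "AE \<omega> in circle_process. \<forall>n. 1 \<le> n \<and> n \<le> N \<and> a \<le> wf strict (Xn \<omega> n) r \<longrightarrow>
      (\<exists>t\<in>\<tau> ` P. \<exists>\<iota>. inj_on \<iota> {..2 * l} \<and> (\<forall>j\<le>2 * l. \<iota> j < n \<and> \<omega> (\<iota> j) \<in> cell D (t j)))"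
      using AE_circle
    proof eventually_elim
      case (elim \<omega>)
      show ?case
      proof (intro allI impI)
        fix n assume h: "1 \<le> n \<and> n \<le> N \<and> a \<le> wf strict (Xn \<omega> n) r"
        have n1: "1 \<le> n" and wf: "a \<le> wf strict (Xn \<omega> n) r" using h by blast+
        have D2: "real (8 * l + 4) * (r - a) \<le> 1 / real D" using T(2) by (simp only: Q_def \<delta>_def)
        have "\<exists>x c e. inj_on x {..2 * l} \<and> (\<forall>j\<le>2 * l. x j \<in> Xn \<omega> n) \<and> c < D \<and> e \<in> PiE {..2 * l} (\<lambda>_. {..<4}) \<and>
            (\<forall>j\<le>2 * l. x j \<in> cell D (nat ((int c + \<lfloor>real D * (real j * a)\<rfloor> + int (e j) - 1) mod int D)))"
          by (rule tuple_cells[where strict = strict, OF l r Xn_props(1,2)[OF elim] Xn_props(3)[OF elim n1] T(1) D2 small wf])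
        then obtain x c e where xce: "inj_on x {..2 * l} \<and> (\<forall>j\<le>2 * l. x j \<in> Xn \<omega> n) \<and> c < D \<and> e \<in> PiE {..2 * l} (\<lambda>_. {..<4}) \<and>
            (\<forall>j\<le>2 * l. x j \<in> cell D (nat ((int c + \<lfloor>real D * (real j * a)\<rfloor> + int (e j) - 1) mod int D)))"
          by (elim exE) (rule that)
        have \<tau>: "\<tau> (c, e) j = nat ((int c + \<lfloor>real D * (real j * a)\<rfloor> + int (e j) - 1) mod int D)" for j
          by (simp only: \<tau>_def case_prod_conv)
        have x: "inj_on x {..2 * l}" "\<And>j. j \<le> 2 * l \<Longrightarrow> x j \<in> Xn \<omega> n" "c < D"
          "e \<in> PiE {..2 * l} (\<lambda>_. {..<4})" "\<And>j. j \<le> 2 * l \<Longrightarrow> x j \<in> cell D (\<tau> (c, e) j)"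
          unfolding \<tau> using xce by blast+
        have "\<forall>j. \<exists>i. j \<le> 2 * l \<longrightarrow> i < n \<and> \<omega> i = x j" 
        proof
          fix j show "\<exists>i. j \<le> 2 * l \<longrightarrow> i < n \<and> \<omega> i = x j"
            using x(2)[of j] unfolding Xn_def image_iff by fastforce
        qed
        then obtain \<iota> where \<iota>: "\<And>j. j \<le> 2 * l \<Longrightarrow> \<iota> j < n \<and> \<omega> (\<iota> j) = x j" by metis
        have "inj_on \<iota> {..2 * l}"
        proof (rule inj_onI)
          fix i j assume "i \<in> {..2 * l}" "j \<in> {..2 * l}" "\<iota> i = \<iota> j"
          then show "i = j" using \<iota>[of i] \<iota>[of j] inj_onD[OF x(1), of i j] by simp
        qed
        moreover have "\<forall>j\<le>2 * l. \<iota> j < n \<and> \<omega> (\<iota> j) \<in> cell D (\<tau> (c, e) j)" using \<iota> x(5) by simp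
        moreover have "\<tau> (c, e) \<in> \<tau> ` P" by (rule imageI) (simp only: P_def mem_Times_iff fst_conv snd_conv lessThan_iff x)
        ultimately show "\<exists>t\<in>\<tau> ` P. \<exists>\<iota>. inj_on \<iota> {..2 * l} \<and> (\<forall>j\<le>2 * l. \<iota> j < n \<and> \<omega> (\<iota> j) \<in> cell D (t j))"
          by (intro bexI[of _ "\<tau> (c, e)"] exI[of _ \<iota>] conjI)
      qed
    qed
  qed
  finally show ?thesis unfolding Q_def \<delta>_def .
qed

lemma Theta_M:
  "Theta_at0 a b (\<lambda>r. expected_hit (\<lambda>X. a \<le> wf strict X r))
     (\<lambda>\<delta>. (1 / \<delta>) powr (real (2 * l) / real (2 * l + 1)))"
proof -
  define \<beta> where "\<beta> = real (2 * l) / real (2 * l + 1)"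
  define C2 where "C2 = 2 * real (2 * l + 1) * (2 * real (2 * l + 1) + 1) * 2 powr \<beta>"
  have C2: "0 < C2" unfolding C2_def by (intro mult_pos_pos add_pos_pos) auto
  define Q where "Q = real (8 * l + 4)"
  define L where "L = real (2 * l + 1)"
  have Q0: "0 < Q" and L0: "0 < L" by (simp_all add: Q_def L_def)
  \<comment> \<open>For \<open>l = 0\<close> the exponent and \<open>a\<close> are both 0, and the
    tuple estimate does not apply; the constant 1/2 comes from \<open>expected_hit_lower\<close>
    with \<open>N = 0\<close>.\<close>
  define C1 where "C1 = (if l = 0 then 1/2 else (1 / (2 * Q)) powr \<beta> / 16)"
  have C1: "0 < C1" using Q0 by (simp add: C1_def)
  \<comment> \<open>The three bounds serve the block estimate, the distinctness of the tuple points,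
    and, for \<open>l > 0\<close>, keeping the effective radius below \<open>2 * a\<close>.\<close>
  define d0 where "d0 = min ((1/2) ^ (2 * l + 1)) (min (1 / (2 * Q * L)) (if l = 0 then 1 else a / 2))"
  have d0: "0 < d0" using Q0 L0 by (auto simp: d0_def a_def)
  have main: "ennreal (C1 * (1 / (r - a)) powr \<beta>) \<le> expected_hit (\<lambda>X. a \<le> wf strict X r) \<and>
      expected_hit (\<lambda>X. a \<le> wf strict X r) \<le> ennreal (C2 * (1 / (r - a)) powr \<beta>)"
    if r: "a < r" "r < b" "r - a < d0" for r
  proof
    have "r - a \<le> (1/2) ^ (2 * l + 1)" using r(3) by (simp add: d0_def)
    then show "expected_hit (\<lambda>X. a \<le> wf strict X r) \<le> ennreal (C2 * (1 / (r - a)) powr \<beta>)"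
      using expected_M_upper[OF r(1,2), of strict] by (simp only: C2_def \<beta>_def)
    show "ennreal (C1 * (1 / (r - a)) powr \<beta>) \<le> expected_hit (\<lambda>X. a \<le> wf strict X r)"
    proof (cases "l = 0")
      case True
      have "ennreal (real (0 + 1) / 2) \<le> expected_hit (\<lambda>X. a \<le> wf strict X r)"
        by (rule expected_hit_lower[where G = UNIV]) (use C.prob_space sets.top[of circle_process] in auto)
      moreover have "C1 * (1 / (r - a)) powr \<beta> = real (0 + 1) / 2" using True r by (simp add: C1_def \<beta>_def)
      ultimately show ?thesis by (simp only:)
    next
      case False
      have "r - a < 1 / (2 * Q * L)" using r(3) by (simp add: d0_def)
      then have "2 * (Q * (r - a)) * L < 1" using Q0 L0 by (simp add: field_simps)
      then have s1: "2 * (real (8 * l + 4) * (r - a)) * real (2 * l + 1) < 1" by (simp only: Q_def L_def)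
      have s2: "2 * (r - a) \<le> a" using r(3) False by (simp add: d0_def)
      have "1 \<le> l" using False by simp
      from expected_M_lower[OF this r(1,2) s1 s2, of strict]
      show ?thesis using False by (simp only: C1_def Q_def \<beta>_def if_False)
    qed
  qed
  show ?thesis unfolding Theta_at0_def \<beta>_def[symmetric]
    by (rule exI[of _ C1], rule exI[of _ C2], rule exI[of _ d0]) (use main d0 C1 C2 in blast)
qed

end

theorem theorem6p1:
  fixes l :: nat and strict :: bool
  defines "a \<equiv> real l / real (2 * l + 1)"
      and "b \<equiv> real (l + 1) / real (2 * l + 3)"
  shows "Theta_at0 a b (\<lambda>r. expected_hit (\<lambda>X. wf strict X r \<ge> a))
           (\<lambda>\<delta>. (1 / \<delta>) powr (real (2 * l) / real (2 * l + 1)))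
       \<and> Theta_at0 a b (\<lambda>r. expected_hit (\<lambda>X. wf strict X r > a))
           (\<lambda>\<delta>. (1 / \<delta>) * ln (1 / \<delta>))
       \<and> Theta_at0 a b
           (\<lambda>r. expected_hit (\<lambda>X. (VR_top strict X r) homotopy_equivalent_space (nsphere (2 * l + 1))))
           (\<lambda>\<delta>. (1 / \<delta>) * ln (1 / \<delta>))"
proof (intro conjI)
  show "Theta_at0 a b (\<lambda>r. expected_hit (\<lambda>X. wf strict X r \<ge> a))
      (\<lambda>\<delta>. (1 / \<delta>) powr (real (2 * l) / real (2 * l + 1)))"
    unfolding a_def b_def by (rule Theta_M)
  show "Theta_at0 a b (\<lambda>r. expected_hit (\<lambda>X. wf strict X r > a)) (\<lambda>\<delta>. (1 / \<delta>) * ln (1 / \<delta>))"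
    unfolding a_def b_def by (rule Theta_log[where Pr = "\<lambda>r X. real l / real (2 * l + 1) < wf strict X r", OF dense_hits(1) gap_misses(1)])
  show "Theta_at0 a b
      (\<lambda>r. expected_hit (\<lambda>X. (VR_top strict X r) homotopy_equivalent_space (nsphere (2 * l + 1))))
      (\<lambda>\<delta>. (1 / \<delta>) * ln (1 / \<delta>))"
    unfolding a_def b_def by (rule Theta_log[where Pr = "\<lambda>r X. VR_top strict X r homotopy_equivalent_space nsphere (2 * l + 1)", OF dense_hits(2) gap_misses(2)])
qed

end
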